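(* Let $\Lambda\ge\lambda>0$, $\omega=\Lambda/\lambda\ge1$, $\theta_0\in(0,\pi)$, $p\in\mathbb R$, and $\mathcal C_0=\{(x,y)\in\mathbb R^2: y>\cos(\theta_0)\sqrt{x^2+y^2}\}$. The inequality $$\mathcal M^-_{\lambda,\Lambda}(D^2u)+u^p\le0\quad\text{in }\mathcal C_0$$ has no positive lower semicontinuous viscosity solution $u:\mathcal C_0\to(0,+\infty)$ if and only if $$g_\omega\left(\frac{2}{1-p}\right)\le\theta_0,$$ where $g_\omega$ is the function defined in the context, with the conventions there for $p=1$ and for $\frac{2}{1-p}$ outside the domain of $g_\omega$.
   Context: For a symmetric real matrix $M$ with eigenvalues $\mu_i$ (counted with multiplicity), $\mathcal M^-_{\lambda,\Lambda}(M)=\lambda\sum_{\mu_i>0}\mu_i+\Lambda\sum_{\mu_i<0}\mu_i$. Write $A=\alpha-1+\frac1\omega$, $B=\alpha-1+\omega$. The function $g_\omega:(-\infty,1-\omega)\cup(1-\frac1\omega,+\infty)\to(0,+\infty)$ is defined by - if $\alpha\ge1$: $g_\omega(\alpha)=\arctan\sqrt\omega+\frac{2-\alpha}{\sqrt{AB}}\arctan\sqrt{\frac{\omega A}{B}}$; - if $1-\frac1\omega<\alpha<1$: $g_\omega(\alpha)=\arctan\frac{1}{\sqrt\omega}+\frac{2-\alpha}{\sqrt{AB}}\arctan\sqrt{\frac{B}{\omega A}}$; - if $\alpha<1-\omega$: $g_\omega(\alpha)=-\arctan\sqrt\omega+\frac{2-\alpha}{\sqrt{AB}}\arctan\sqrt{\frac{\omega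 A}{B}}$. It is strictly increasing on $(-\infty,1-\omega)$ and strictly decreasing on $(1-\frac1\omega,+\infty)$. Conventions: for $p=1$ the condition $g_\omega\left(\frac{2}{1-p}\right)\le\theta_0$ is regarded as satisfied (the limit of $g_\omega$ at $\pm\infty$ is $0$), and if $\frac{2}{1-p}\in[1-\omega,1-\frac1\omega]$ one sets $g_\omega\left(\frac{2}{1-p}\right)=+\infty$, so that the condition is not satisfied. With these conventions the condition is the same as $1-\frac{2}{\alpha^+}\le p\le1-\frac{2}{\alpha^-}$, where $\alpha^-<0<\alpha^+$ are the solutions of $g_\omega(\alpha^\pm)=\theta_0$. *)

theory Defs
  imports "HOL-Analysis.Analysis" "HOL-Computational_Algebra.Computational_Algebra"
begin

definition charpoly :: "real^'n^'n \<Rightarrow> real poly" where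
  "charpoly M = det (\<chi> i j. (if i = j then [:0, 1:] else 0) - [:M $ i $ j:])"

text \<open>For symmetric \<open>M\<close> this multiset consists of all \<open>CARD('n)\<close> eigenvalues of \<open>M\<close>.\<close>

definition eigenvalues :: "real^'n^'n \<Rightarrow> real multiset" where
  "eigenvalues M = proots (charpoly M)"

definition pucci_minus :: "real \<Rightarrow> real \<Rightarrow> real^'n^'n \<Rightarrow> real" where
  "pucci_minus lam Lam M =
     lam * (\<Sum>\<mu>\<in>#filter_mset (\<lambda>\<mu>. \<mu> > 0) (eigenvalues M). \<mu>)
   + Lam * (\<Sum>\<mu>\<in>#filter_mset (\<lambda>\<mu>. \<mu> < 0) (eigenvalues M). \<mu>)"

text \<open>\<open>\<phi>\<close> is of class \<open>C\<^sup>2\<close> on the open set \<open>U\<close> with gradient \<open>G\<close> and Hessian matrix \<open>H\<close>.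
  Continuity of \<open>H\<close> makes the matrices \<open>H x\<close> symmetric (Schwarz).\<close>

definition C2_on ::
  "(real^'n) set \<Rightarrow> (real^'n \<Rightarrow> real) \<Rightarrow> (real^'n \<Rightarrow> real^'n) \<Rightarrow> (real^'n \<Rightarrow> real^'n^'n) \<Rightarrow> bool" where
  "C2_on U \<phi> G H \<longleftrightarrow>
     (\<forall>x\<in>U. (\<phi> has_derivative (\<lambda>h. G x \<bullet> h)) (at x) \<and>
            (G has_derivative (\<lambda>h. H x *v h)) (at x)) \<and>
     continuous_on U H"

definition lsc_on :: "'a::topological_space set \<Rightarrow> ('a \<Rightarrow> real) \<Rightarrow> bool" where
  "lsc_on S u \<longleftrightarrow> (\<forall>x\<in>S. \<forall>a < u x. eventually (\<lambda>y. a < u y) (at x within S))"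

text \<open>Viscosity sense of \<open>F (D\<^sup>2 u) + f u \<le> 0\<close> in the open set \<open>\<Omega>\<close>: a test function is of class
  \<open>C\<^sup>2\<close> near the point at which \<open>u - \<phi>\<close> has a local minimum; \<open>U\<close> is a neighbourhood on
  which both hold. Only the values of \<open>u\<close> on \<open>\<Omega>\<close> matter.\<close>

definition viscosity_supersolution ::
  "(real^'n^'n \<Rightarrow> real) \<Rightarrow> (real \<Rightarrow> real) \<Rightarrow> (real^'n) set \<Rightarrow> (real^'n \<Rightarrow> real) \<Rightarrow> bool" where
  "viscosity_supersolution F f \<Omega> u \<longleftrightarrow>
     (\<forall>x U \<phi> G H. open U \<and> x \<in> U \<and> U \<subseteq> \<Omega> \<and> C2_on U \<phi> G H \<and>
        (\<forall>y\<in>U. u x - \<phi> x \<le> u y - \<phi> y) \<longrightarrow>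
        F (H x) + f (u x) \<le> 0)"

definition cone_C :: "real \<Rightarrow> (real^2) set" where
  "cone_C \<theta> = {z. z $ 2 > cos \<theta> * sqrt ((z $ 1)\<^sup>2 + (z $ 2)\<^sup>2)}"

text \<open>Extended by \<open>+\<infinity>\<close> to the interval \<open>[1 - \<omega>, 1 - 1/\<omega>]\<close>.\<close>

definition g_omega :: "real \<Rightarrow> real \<Rightarrow> ereal" where
  "g_omega \<omega> \<alpha> =
    (let A = \<alpha> - 1 + 1 / \<omega>; B = \<alpha> - 1 + \<omega> in
     if \<alpha> \<ge> 1 then
       ereal (arctan (sqrt \<omega>) + (2 - \<alpha>) / sqrt (A * B) * arctan (sqrt (\<omega> * A / B)))
     else if 1 - 1 / \<omega> < \<alpha> then
       ereal (arctan (1 / sqrt \<omega>) + (2 - \<alpha>) / sqrt (A * B) * arctan (sqrt (B / (\<omega> * A))))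
     else if \<alpha> < 1 - \<omega> then
       ereal (- arctan (sqrt \<omega>) + (2 - \<alpha>) / sqrt (A * B) * arctan (sqrt (\<omega> * A / B)))
     else \<infinity>)"

end

theory Submission
  imports Defs
begin

text \<open>
  The exponent \<open>\<alpha> = 2 / (1 - p)\<close> is the one for which \<open>r\<^sup>\<alpha>\<close>-homogeneous functions respect the
  scaling of the inequality. In polar coordinates (\<open>t\<close> is the angle with the axis of the cone) the
  Pucci operator of \<open>r\<^sup>\<alpha> \<phi>(t)\<close> is \<open>r\<^sup>\<alpha>\<^sup>-\<^sup>2\<close> times an ordinary differential expression in \<open>\<phi>\<close>. The
  equation obtained by setting it to zero is solved explicitly, with the slope of the eigenvectors
  of the Hessian as parameter; its even solution is positive exactly on an interval \<open>(-g, g)\<close> with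
  \<open>g = g\<^sub>\<omega>(\<alpha>)\<close> (\<open>angular_profile_exists\<close>, \<open>g_omega_profile\<close>). So the threshold says whether the cone
  \<open>\<C>\<^sub>g\<close> on which the homogeneous solution \<open>\<Phi> = r\<^sup>\<alpha> \<phi>\<close> is positive fits into \<open>\<C>\<^sub>0\<close>.

  If \<open>g > \<theta>\<^sub>0\<close>, then \<open>\<Phi>\<close> is positive up to the boundary of \<open>\<C>\<^sub>0\<close>. The operator is concave, so subtracting
  a small multiple of \<open>r\<^sup>\<alpha> cosh (K t)\<close>, on which it is positive for large \<open>K\<close>, leaves a positive strict
  supersolution, and a multiplicative constant makes it absorb \<open>u\<^sup>p\<close> because \<open>p \<noteq> 1\<close>. Where
  \<open>g\<^sub>\<omega>(\<alpha>) = \<infinity>\<close> the function \<open>r\<^sup>\<alpha>\<close> serves as \<open>\<Phi>\<close> (\<open>supersolution_exists\<close>).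

  If \<open>g \<le> \<theta>\<^sub>0\<close>, a positive supersolution \<open>u\<close> is compared, on \<open>\<C>\<^sub>g\<close>, with
  \<open>A r\<^sup>\<alpha> (\<phi> + \<epsilon> \<sigma>) / cosh (\<nu> (ln r - T))\<close>. The corrector \<open>\<epsilon> \<sigma>\<close> gains \<open>\<epsilon>\<close> near the lateral boundary and
  pulls the zeros of the profile inside the cone, the slow modulation costs \<open>O(\<nu>)\<close>, and in the middle
  of the cone the error \<open>O(\<epsilon> + \<nu>) r\<^sup>\<alpha>\<^sup>-\<^sup>2\<close> is absorbed by the source \<open>u\<^sup>p\<close>, which is at least a
  multiple of \<open>r\<^sup>\<alpha>\<^sup>-\<^sup>2\<close> if \<open>u\<close> is at least a multiple of \<open>r\<^sup>\<alpha>\<close> (for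
  \<open>p < 0\<close> because \<open>u\<close> lies below the barrier where the two are compared). Since the errors tend to zero for
  every fixed \<open>A\<close>, the bound \<open>u \<ge> A r\<^sup>\<alpha> (\<phi> - e) / cosh (\<nu> (ln r - T))\<close> holds with \<open>A\<close> as large as one likes
  (\<open>hump_lower_bound\<close>). It remains to start and to stop this amplification, both by comparison with
  bump functions in balls (\<open>bump_bound\<close>). For \<open>p < 1\<close> bumps give the initial bound
  \<open>u \<ge> c r\<^sup>\<alpha>\<close>, and finiteness of \<open>u\<close> at one point is the contradiction. For \<open>p > 1\<close> the initial
  bound is a comparison with \<open>\<Phi>\<close> at infinity, where \<open>\<Phi>\<close> decays, and bumps give the upper bound
  \<open>C r\<^sup>\<alpha>\<close> at some point of a ball of radius comparable to \<open>r\<close>, which is the contradiction. For \<open>p = 1\<close> a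
  bump in a large ball contradicts the inequality at once.
\<close>
(* The dollar sign is reserved for vector components; otherwise every component is parsed twice. *)
no_notation fps_nth (infixl "$" 75)

section \<open>The Pucci operator on symmetric 2 by 2 matrices\<close>

text \<open>The Pucci operator of the symmetric matrix with rows \<open>(a, b)\<close> and \<open>(b, c)\<close>. The sum of
  \<open>\<bar>\<mu>\<^sub>1\<bar>\<close> and \<open>\<bar>\<mu>\<^sub>2\<bar>\<close> is the larger one of \<open>\<bar>\<mu>\<^sub>1 + \<mu>\<^sub>2\<bar>\<close> and \<open>\<bar>\<mu>\<^sub>1 - \<mu>\<^sub>2\<bar>\<close>, and both are
  norms of linear functions of the matrix; this form makes concavity visible.\<close>

definition pucci2 :: "real \<Rightarrow> real \<Rightarrow> real \<Rightarrow> real \<Rightarrow> real \<Rightarrow> real" where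
  "pucci2 l L a b c = ((l + L) * (a + c) - (L - l) * max \<bar>a + c\<bar> (sqrt ((a - c)\<^sup>2 + (2 * b)\<^sup>2))) / 2"

lemma charpoly_2:
  fixes M :: "real^2^2"
  shows "charpoly M = [: M$1$1 * M$2$2 - M$1$2 * M$2$1, - (M$1$1 + M$2$2), 1 :]"
  unfolding charpoly_def det_2 by simp

lemma pucci_minus_symmetric:
  fixes M :: "real^2^2"
  assumes sym: "M$1$2 = M$2$1"
  shows "pucci_minus l L M = pucci2 l L (M$1$1) (M$1$2) (M$2$2)"
proof -
  define a b c where "a = M$1$1" and "b = M$1$2" and "c = M$2$2"
  define R where "R = sqrt ((a - c)\<^sup>2 + (2 * b)\<^sup>2)"
  define m1 m2 where "m1 = (a + c + R) / 2" and "m2 = (a + c - R) / 2"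
  have R0: "R \<ge> 0" and R2: "R\<^sup>2 = (a - c)\<^sup>2 + (2 * b)\<^sup>2" unfolding R_def by auto
  have pr: "m1 * m2 = a * c - b * b"
    using R2 unfolding m1_def m2_def by (simp add: power2_eq_square field_simps)
  have "charpoly M = [: m1 * m2, - (m1 + m2), 1 :]"
    unfolding charpoly_2 pr using sym by (simp add: a_def b_def c_def m1_def m2_def add_divide_distrib diff_divide_distrib)
  also have "\<dots> = [:- m1, 1:] * [:- m2, 1:]" by simp
  finally have "eigenvalues M = proots ([:- m1, 1:] * [:- m2, 1:])"
    unfolding eigenvalues_def by simp
  also have "\<dots> = {#m1, m2#}"
    by (subst proots_mult) auto
  finally have ev: "eigenvalues M = {#m1, m2#}" .
  have m12: "m1 \<ge> m2" "m1 + m2 = a + c" "m1 - m2 = R" using R0 unfolding m1_def m2_def by (auto simp: field_simps)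
  have key: "l * (max m1 0 + max m2 0) + L * (min m1 0 + min m2 0) = pucci2 l L a b c"
    unfolding pucci2_def R_def[symmetric] m12(2)[symmetric] m12(3)[symmetric] using m12(1)
    by (auto simp: max_def min_def abs_if field_simps)
  have "pucci_minus l L M = l * (max m1 0 + max m2 0) + L * (min m1 0 + min m2 0)"
    unfolding pucci_minus_def ev by (auto simp: max_def min_def)
  then show ?thesis using key by (simp add: a_def b_def c_def)
qed

text \<open>Concavity and positive homogeneity together, from the triangle inequality. All barriers below
  are sums that are treated term by term with it.\<close>

lemma pucci2_superadd:
  assumes "0 < l" "l \<le> L"
  shows "pucci2 l L a b c + pucci2 l L a' b' c' \<le> pucci2 l L (a + a') (b + b') (c + c')"
proof -
  have "sqrt ((a + a' - (c + c'))\<^sup>2 + (2 * (b + b'))\<^sup>2)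
        \<le> sqrt ((a - c)\<^sup>2 + (2 * b)\<^sup>2) + sqrt ((a' - c')\<^sup>2 + (2 * b')\<^sup>2)"
    using real_sqrt_sum_squares_triangle_ineq[of "a - c" "a' - c'" "2 * b" "2 * b'"]
    by (simp add: algebra_simps)
  moreover define m where "m a b c = max \<bar>a + c\<bar> (sqrt ((a - c)\<^sup>2 + (2 * b)\<^sup>2))" for a b c :: real
  ultimately have "m (a + a') (b + b') (c + c') \<le> m a b c + m a' b' c'"
    unfolding m_def by linarith
  from mult_left_mono[OF this, of "L - l"] assms
  have "(L - l) * m (a + a') (b + b') (c + c') \<le> (L - l) * m a b c + (L - l) * m a' b' c'"
    by (simp add: distrib_left)
  moreover have "(l + L) * (a + a' + (c + c')) = (l + L) * (a + c) + (l + L) * (a' + c')"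
    by (simp only: distrib_left distrib_right add_ac)
  moreover have pucci2: "pucci2 l L a b c = ((l + L) * (a + c) - (L - l) * m a b c) / 2" for a b c
    unfolding pucci2_def m_def ..
  moreover have "(U - Y) / 2 + (V - Z) / 2 \<le> (W - X) / 2" if "X \<le> Y + Z" "W = U + V" for U V W X Y Z :: real
    using that by argo
  ultimately show ?thesis unfolding pucci2 by blast
qed

lemma pucci2_scale:
  assumes "0 \<le> k"
  shows "pucci2 l L (k * a) (k * b) (k * c) = k * pucci2 l L a b c"
proof -
  have "(k * a - k * c)\<^sup>2 + (2 * (k * b))\<^sup>2 = k\<^sup>2 * ((a - c)\<^sup>2 + (2 * b)\<^sup>2)"
    by (simp add: algebra_simps power2_eq_square)
  then have "sqrt ((k * a - k * c)\<^sup>2 + (2 * (k * b))\<^sup>2) = k * sqrt ((a - c)\<^sup>2 + (2 * b)\<^sup>2)"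
    using assms by (simp add: real_sqrt_mult)
  moreover have "\<bar>k * a + k * c\<bar> = k * \<bar>a + c\<bar>"
    using assms by (simp add: abs_mult flip: distrib_left)
  moreover have "max (k * \<bar>a + c\<bar>) (k * sqrt ((a - c)\<^sup>2 + (2 * b)\<^sup>2)) = k * max \<bar>a + c\<bar> (sqrt ((a - c)\<^sup>2 + (2 * b)\<^sup>2))"
    using assms by (simp add: max_mult_distrib_left)
  ultimately show ?thesis unfolding pucci2_def
    by (simp add: right_diff_distrib distrib_left mult.left_commute)
qed

lemma pucci2_abs_le:
  assumes "0 < l" "l \<le> L"
  shows "\<bar>pucci2 l L a b c\<bar> \<le> L * (\<bar>a\<bar> + 2 * \<bar>b\<bar> + \<bar>c\<bar>)"
proof -
  have 1: "sqrt ((a - c)\<^sup>2 + (2 * b)\<^sup>2) \<le> \<bar>a\<bar> + 2 * \<bar>b\<bar> + \<bar>c\<bar>"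
    using sqrt_sum_squares_le_sum_abs[of "a - c" "2 * b"] by (simp add: abs_mult)
  define m where "m = max \<bar>a + c\<bar> (sqrt ((a - c)\<^sup>2 + (2 * b)\<^sup>2))"
  define s where "s = \<bar>a\<bar> + 2 * \<bar>b\<bar> + \<bar>c\<bar>"
  have m: "0 \<le> m" "m \<le> s" unfolding m_def s_def using 1 by auto
  have t: "\<bar>a + c\<bar> \<le> s" unfolding s_def by auto
  have "\<bar>(l + L) * (a + c)\<bar> \<le> (l + L) * s"
    using assms t by (simp add: abs_mult mult_left_mono)
  moreover have "0 \<le> (L - l) * m" "(L - l) * m \<le> (L - l) * s"
    using assms m by (auto intro: mult_left_mono)
  ultimately have "\<bar>(l + L) * (a + c) - (L - l) * m\<bar> \<le> (l + L) * s + (L - l) * s" by linarith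
  then show ?thesis unfolding pucci2_def m_def s_def by (simp add: algebra_simps)
qed

lemma pucci2_psd:
  assumes "0 < l" "l \<le> L" "0 \<le> a" "0 \<le> c" "b\<^sup>2 \<le> a * c"
  shows "pucci2 l L a b c = l * (a + c)"
proof -
  have "sqrt ((a - c)\<^sup>2 + (2 * b)\<^sup>2) \<le> a + c"
    by (rule real_le_lsqrt) (use assms in \<open>auto simp: power2_eq_square algebra_simps\<close>)
  then show ?thesis using assms unfolding pucci2_def by (simp add: algebra_simps)
qed

lemma pucci2_nsd:
  assumes "0 < l" "l \<le> L" "a \<le> 0" "c \<le> 0" "b\<^sup>2 \<le> a * c"
  shows "pucci2 l L a b c = L * (a + c)"
proof -
  have "sqrt ((a - c)\<^sup>2 + (2 * b)\<^sup>2) \<le> - (a + c)"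
    by (rule real_le_lsqrt) (use assms in \<open>auto simp: power2_eq_square algebra_simps\<close>)
  then show ?thesis using assms unfolding pucci2_def by (simp add: algebra_simps)
qed


section \<open>Second derivatives in polar coordinates\<close>

text \<open>\<open>r\<^sup>\<alpha>\<^sup>-\<^sup>2\<close> times this is the Pucci operator of \<open>r\<^sup>\<alpha> h(t)\<close>, if \<open>h1\<close> and \<open>h2\<close> are the derivatives of \<open>h\<close>.\<close>

abbreviation homog_pucci where
  "homog_pucci l L \<alpha> h h1 h2 \<equiv> pucci2 l L (\<alpha> * (\<alpha> - 1) * h) ((\<alpha> - 1) * h1) (\<alpha> * h + h2)"

text \<open>Entries of the matrix \<open>a P P\<^sup>T + b (P Q\<^sup>T + Q P\<^sup>T) + c Q Q\<^sup>T\<close> with \<open>P = (x, y) / r\<^sup>2\<close> and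
  \<open>Q = (y, -x) / r\<^sup>2\<close>, the gradients of \<open>ln r\<close> and of the angle.\<close>

definition polar11 where "polar11 a b c (z::real^2) = (a * (z$1)\<^sup>2 + 2 * b * (z$1 * z$2) + c * (z$2)\<^sup>2) / norm z ^ 4"
definition polar12 where "polar12 a b c (z::real^2) = ((a - c) * (z$1 * z$2) + b * ((z$2)\<^sup>2 - (z$1)\<^sup>2)) / norm z ^ 4"
definition polar22 where "polar22 a b c (z::real^2) = (a * (z$2)\<^sup>2 - 2 * b * (z$1 * z$2) + c * (z$1)\<^sup>2) / norm z ^ 4"

definition polar_matrix :: "real \<Rightarrow> real \<Rightarrow> real \<Rightarrow> real^2 \<Rightarrow> real^2^2" where
  "polar_matrix a b c z = (\<chi> i j. if i = 1 \<and> j = 1 then polar11 a b c z else if i = 2 \<and> j = 2 then polar22 a b c z else polar12 a b c z)"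

lemma norm2_sq: "(norm (z::real^2))\<^sup>2 = (z$1)\<^sup>2 + (z$2)\<^sup>2"
  by (simp add: norm_vec_def L2_set_def UNIV_2)

text \<open>The gradients of \<open>ln r\<close> and of the angle are orthogonal of length \<open>1 / r\<close>, so up to the factor
  \<open>1 / r\<^sup>2\<close> the change of basis is orthogonal and keeps the trace and the eigenvalue gap.\<close>

lemma pucci_polar_matrix:
  assumes "z \<noteq> 0"
  shows "pucci_minus l L (polar_matrix a b c z) = pucci2 l L a b c / (norm z)\<^sup>2"
proof -
  define x y n where "x = z$1" and "y = z$2" and "n = (norm z)\<^sup>2"
  have n: "n = x\<^sup>2 + y\<^sup>2" "n > 0" using assms by (simp_all add: n_def x_def y_def norm2_sq[symmetric])
  have n4: "norm z ^ 4 = n\<^sup>2" by (simp add: n_def)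
  define p11 p12 p22 where "p11 = polar11 a b c z" and "p12 = polar12 a b c z" and "p22 = polar22 a b c z"
  have e: "p11 = (a * x\<^sup>2 + 2 * b * (x * y) + c * y\<^sup>2) / n\<^sup>2"
    "p12 = ((a - c) * (x * y) + b * (y\<^sup>2 - x\<^sup>2)) / n\<^sup>2"
    "p22 = (a * y\<^sup>2 - 2 * b * (x * y) + c * x\<^sup>2) / n\<^sup>2"
    unfolding p11_def p12_def p22_def polar11_def polar12_def polar22_def n4 x_def y_def by auto
  have "p11 + p22 = (a + c) * n / n\<^sup>2" unfolding e n(1) by (simp add: algebra_simps add_divide_distrib diff_divide_distrib)
  then have t: "p11 + p22 = (a + c) / n" using n(2) by (simp add: power2_eq_square)
  have "(p11 - p22)\<^sup>2 + (2 * p12)\<^sup>2 = ((a - c)\<^sup>2 + (2 * b)\<^sup>2) * n\<^sup>2 / (n\<^sup>2)\<^sup>2"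
  proof -
    have "p11 - p22 = ((a - c) * (x\<^sup>2 - y\<^sup>2) + 4 * b * (x * y)) / n\<^sup>2"
      unfolding e by (simp add: algebra_simps add_divide_distrib diff_divide_distrib)
    moreover have "2 * p12 = (2 * (a - c) * (x * y) + 2 * b * (y\<^sup>2 - x\<^sup>2)) / n\<^sup>2" unfolding e by (simp add: algebra_simps)
    moreover have "((a - c) * (x\<^sup>2 - y\<^sup>2) + 4 * b * (x * y))\<^sup>2 + (2 * (a - c) * (x * y) + 2 * b * (y\<^sup>2 - x\<^sup>2))\<^sup>2
       = ((a - c)\<^sup>2 + (2 * b)\<^sup>2) * n\<^sup>2" unfolding n(1) by algebra
    ultimately show ?thesis by (simp add: power_divide flip: add_divide_distrib)
  qed
  also have "\<dots> = ((a - c)\<^sup>2 + (2 * b)\<^sup>2) / n\<^sup>2" using n(2) by (simp add: power2_eq_square)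
  finally have d: "sqrt ((p11 - p22)\<^sup>2 + (2 * p12)\<^sup>2) = sqrt ((a - c)\<^sup>2 + (2 * b)\<^sup>2) / n"
    using n(2) by (simp add: real_sqrt_divide)
  have "pucci_minus l L (polar_matrix a b c z) = pucci2 l L p11 p12 p22"
    by (subst pucci_minus_symmetric) (auto simp: polar_matrix_def p11_def p12_def p22_def)
  also have "\<dots> = pucci2 l L a b c / n"
  proof -
    have "max \<bar>(a + c) / n\<bar> (sqrt ((a - c)\<^sup>2 + (2 * b)\<^sup>2) / n) = max \<bar>a + c\<bar> (sqrt ((a - c)\<^sup>2 + (2 * b)\<^sup>2)) / n"
      using n(2) by (simp add: max_divide_distrib_right)
    then show ?thesis unfolding pucci2_def t d using n(2) by (simp add: field_simps)
  qed
  finally show ?thesis by (simp add: n_def)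
qed

text \<open>The signed angle with the positive second axis. The half-angle formula makes it smooth on the
  whole plane slit along the negative second axis.\<close>

definition ang :: "real^2 \<Rightarrow> real" where
  "ang z = 2 * arctan (z$1 / (norm z + z$2))"

definition slit :: "(real^2) set" where
  "slit = {z. 0 < norm z + z$2}"

definition pgrad :: "real \<Rightarrow> real \<Rightarrow> real^2 \<Rightarrow> real^2" where
  "pgrad a b z = (\<chi> i. if i = 1 then (a * z$1 + b * z$2) / (norm z)\<^sup>2 else (a * z$2 - b * z$1) / (norm z)\<^sup>2)"

lemma slit_nz: "z \<in> slit \<Longrightarrow> z \<noteq> 0"
  by (auto simp: slit_def)

lemma inner_2: "(x::real^2) \<bullet> y = x$1 * y$1 + x$2 * y$2"
  by (simp add: inner_vec_def UNIV_2)

lemma deriv_norm: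
  assumes "z \<noteq> (0::real^2)"
  shows "(norm has_derivative (\<lambda>k. (z$1 * k$1 + z$2 * k$2) / norm z)) (at z)"
  using has_derivative_norm[OF assms] by (simp add: inner_2 sgn_div_norm add_divide_distrib divide_inverse algebra_simps)

lemma deriv_ln_norm:
  assumes "z \<noteq> (0::real^2)"
  shows "((\<lambda>z. ln (norm z)) has_derivative (\<lambda>k. z$1 / (norm z)\<^sup>2 * k$1 + z$2 / (norm z)\<^sup>2 * k$2)) (at z)"
proof -
  have n: "norm z > 0" using assms by simp
  have "((\<lambda>z. ln (norm z)) has_derivative (\<lambda>k. 1 / norm z * ((z$1 * k$1 + z$2 * k$2) / norm z))) (at z)"
    using has_derivative_compose[OF deriv_norm[OF assms] DERIV_ln_divide[OF n, unfolded has_field_derivative_def]] .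
  then show ?thesis
    by (rule has_derivative_eq_rhs) (simp add: fun_eq_iff power2_eq_square add_divide_distrib)
qed

lemma deriv_comp [derivative_intros]: "((\<lambda>z::real^2. z$i) has_derivative (\<lambda>k. k$i)) (at z)"
  by (rule bounded_linear_imp_has_derivative) (rule bounded_linear_vec_nth)

lemma deriv_ang:
  assumes "z \<in> slit"
  shows "(ang has_derivative (\<lambda>k. z$2 / (norm z)\<^sup>2 * k$1 - z$1 / (norm z)\<^sup>2 * k$2)) (at z)"
proof -
  define x y r where "x = z$1" and "y = z$2" and "r = norm z"
  have r: "r > 0" "r + y > 0" and r2: "r\<^sup>2 = x\<^sup>2 + y\<^sup>2"
    using assms slit_nz[OF assms] by (auto simp: slit_def r_def x_def y_def norm2_sq)
  have xx: "x * x = (r - y) * (r + y)" using r2 by (simp add: algebra_simps power2_eq_square)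
  define t where "t = x / (r + y)"
  have t: "1 + t\<^sup>2 = 2 * r / (r + y)"
  proof -
    have "t\<^sup>2 = (r - y) / (r + y)" using xx r(2) by (simp add: t_def power2_eq_square)
    then show ?thesis using r(2) by (simp add: field_simps)
  qed
  have nz: "norm z + z$2 \<noteq> 0" using r(2) by (simp add: r_def y_def)
  have dt: "((\<lambda>z. z$1 / (norm z + z$2)) has_derivative
      (\<lambda>k. (k$1 * (r + y) - x * ((x * k$1 + y * k$2) / r + k$2)) / ((r + y) * (r + y)))) (at z)"
    using has_derivative_divide'[OF deriv_comp has_derivative_add[OF deriv_norm[OF slit_nz[OF assms]] deriv_comp] nz]
    unfolding x_def y_def r_def .
  have "((\<lambda>z. 2 * arctan (z$1 / (norm z + z$2))) has_derivative
      (\<lambda>k. 2 * (((k$1 * (r + y) - x * ((x * k$1 + y * k$2) / r + k$2)) / ((r + y) * (r + y))) * inverse (1 + t\<^sup>2)))) (at z)"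
    using has_derivative_mult_right[OF has_derivative_compose[OF dt DERIV_arctan[unfolded has_field_derivative_def]], of 2]
    unfolding t_def x_def y_def r_def by (simp add: mult.commute)
  moreover have "2 * (((k1 * (r + y) - x * ((x * k1 + y * k2) / r + k2)) / ((r + y) * (r + y))) * inverse (1 + t\<^sup>2))
      = y / r\<^sup>2 * k1 - x / r\<^sup>2 * k2" for k1 k2
  proof -
    have e1: "2 * ((E / (s * s)) * inverse (2 * r / s)) = E / (s * r)"
      and e2: "s * E / r / (s * r) = E / r\<^sup>2" if "s > 0" for E s
      using that r(1) by (simp_all add: field_simps power2_eq_square)
    have "k1 * (r + y) - x * ((x * k1 + y * k2) / r + k2) = (k1 * (r * (r + y) - x * x) - x * k2 * (r + y)) / r"
      using r by (simp add: field_simps)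
    also have "\<dots> = (r + y) * (k1 * y - x * k2) / r" unfolding xx by (simp add: algebra_simps)
    finally have num: "k1 * (r + y) - x * ((x * k1 + y * k2) / r + k2) = (r + y) * (k1 * y - x * k2) / r" .
    have "2 * (((k1 * (r + y) - x * ((x * k1 + y * k2) / r + k2)) / ((r + y) * (r + y))) * inverse (1 + t\<^sup>2))
       = (k1 * y - x * k2) / r\<^sup>2"
      unfolding t num e1[OF r(2)] e2[OF r(2)] ..
    also have "\<dots> = y / r\<^sup>2 * k1 - x / r\<^sup>2 * k2" by (simp add: diff_divide_distrib)
    finally show ?thesis .
  qed
  ultimately show ?thesis unfolding ang_def[abs_def] x_def y_def r_def by simp
qed

lemma deriv_P:
  assumes "z \<noteq> (0::real^2)"
  defines "P1 \<equiv> z$1 / (norm z)\<^sup>2" and "P2 \<equiv> z$2 / (norm z)\<^sup>2"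
  shows "((\<lambda>z. z$1 / (norm z)\<^sup>2) has_derivative (\<lambda>k. (P2\<^sup>2 - P1\<^sup>2) * k$1 - 2 * P1 * P2 * k$2)) (at z)"
    and "((\<lambda>z. z$2 / (norm z)\<^sup>2) has_derivative (\<lambda>k. (P1\<^sup>2 - P2\<^sup>2) * k$2 - 2 * P1 * P2 * k$1)) (at z)"
proof -
  define x y n where "x = z$1" and "y = z$2" and "n = (z$1)\<^sup>2 + (z$2)\<^sup>2"
  have n: "n > 0" "n = x\<^sup>2 + y\<^sup>2" using assms(1) by (auto simp: n_def x_def y_def simp flip: norm2_sq)
  have P: "P1 = x / n" "P2 = y / n" unfolding P1_def P2_def norm2_sq x_def y_def n_def by auto
  have 1: "((\<lambda>z. z$1 / ((z$1)\<^sup>2 + (z$2)\<^sup>2)) has_derivative (\<lambda>k. (k$1 * n - x * (2 * x * k$1 + 2 * y * k$2)) / (n * n))) (at z)"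
    using n(1) unfolding n_def x_def y_def
    by (auto intro!: derivative_eq_intros simp: fun_eq_iff field_simps)
  have 2: "((\<lambda>z. z$2 / ((z$1)\<^sup>2 + (z$2)\<^sup>2)) has_derivative (\<lambda>k. (k$2 * n - y * (2 * x * k$1 + 2 * y * k$2)) / (n * n))) (at z)"
    using n(1) unfolding n_def x_def y_def
    by (auto intro!: derivative_eq_intros simp: fun_eq_iff field_simps)
  have "(k1 * n - x * (2 * x * k1 + 2 * y * k2)) / (n * n) = (P2\<^sup>2 - P1\<^sup>2) * k1 - 2 * P1 * P2 * k2" for k1 k2
  proof -
    have "(P2\<^sup>2 - P1\<^sup>2) * k1 - 2 * P1 * P2 * k2 = ((y\<^sup>2 - x\<^sup>2) * k1 - 2 * x * y * k2) / (n * n)"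
      unfolding P by (simp add: power2_eq_square diff_divide_distrib left_diff_distrib)
    moreover have "k1 * n - x * (2 * x * k1 + 2 * y * k2) = (y\<^sup>2 - x\<^sup>2) * k1 - 2 * x * y * k2" unfolding n(2) by algebra
    ultimately show ?thesis by simp
  qed
  moreover have "(k2 * n - y * (2 * x * k1 + 2 * y * k2)) / (n * n) = (P1\<^sup>2 - P2\<^sup>2) * k2 - 2 * P1 * P2 * k1" for k1 k2
  proof -
    have "(P1\<^sup>2 - P2\<^sup>2) * k2 - 2 * P1 * P2 * k1 = ((x\<^sup>2 - y\<^sup>2) * k2 - 2 * x * y * k1) / (n * n)"
      unfolding P by (simp add: power2_eq_square diff_divide_distrib left_diff_distrib)
    moreover have "k2 * n - y * (2 * x * k1 + 2 * y * k2) = (x\<^sup>2 - y\<^sup>2) * k2 - 2 * x * y * k1" unfolding n(2) by algebra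
    ultimately show ?thesis by simp
  qed
  ultimately show "((\<lambda>z. z$1 / (norm z)\<^sup>2) has_derivative (\<lambda>k. (P2\<^sup>2 - P1\<^sup>2) * k$1 - 2 * P1 * P2 * k$2)) (at z)"
    and "((\<lambda>z. z$2 / (norm z)\<^sup>2) has_derivative (\<lambda>k. (P1\<^sup>2 - P2\<^sup>2) * k$2 - 2 * P1 * P2 * k$1)) (at z)"
    using 1 2 unfolding norm2_sq by simp_all
qed

lemma polar_entries:
  defines "P1 \<equiv> \<lambda>z::real^2. z$1 / (norm z)\<^sup>2" and "P2 \<equiv> \<lambda>z::real^2. z$2 / (norm z)\<^sup>2"
  shows "polar11 a b c z = a * (P1 z)\<^sup>2 + 2 * b * P1 z * P2 z + c * (P2 z)\<^sup>2"
    and "polar12 a b c z = (a - c) * P1 z * P2 z + b * ((P2 z)\<^sup>2 - (P1 z)\<^sup>2)"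
    and "polar22 a b c z = a * (P2 z)\<^sup>2 - 2 * b * P1 z * P2 z + c * (P1 z)\<^sup>2"
proof -
  have e: "norm z ^ 4 = ((norm z)\<^sup>2)\<^sup>2" by simp
  show "polar11 a b c z = a * (P1 z)\<^sup>2 + 2 * b * P1 z * P2 z + c * (P2 z)\<^sup>2"
    and "polar12 a b c z = (a - c) * P1 z * P2 z + b * ((P2 z)\<^sup>2 - (P1 z)\<^sup>2)"
    and "polar22 a b c z = a * (P2 z)\<^sup>2 - 2 * b * P1 z * P2 z + c * (P1 z)\<^sup>2"
    unfolding polar11_def polar12_def polar22_def P1_def P2_def e
    by (simp_all add: power_divide add_divide_distrib diff_divide_distrib power2_eq_square algebra_simps)
qed

text \<open>With \<open>P\<close>, \<open>Q\<close> the gradients of \<open>\<rho> = ln r\<close> and of the angle, \<open>DP = Q Q\<^sup>T - P P\<^sup>T\<close> and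
  \<open>DQ = - (P Q\<^sup>T + Q P\<^sup>T)\<close>; the product rule then gives the Hessian of a separated function in the
  frame \<open>P\<close>, \<open>Q\<close>.\<close>

lemma C2_on_separated_polar:
  fixes f h :: "real \<Rightarrow> real"
  assumes f: "\<And>t. (f has_real_derivative f1 t) (at t)" "\<And>t. (f1 has_real_derivative f2 t) (at t)" "continuous_on UNIV f2"
    and h: "\<And>t. t \<in> I \<Longrightarrow> (h has_real_derivative h1 t) (at t)"
      "\<And>t. t \<in> I \<Longrightarrow> (h1 has_real_derivative h2 t) (at t)" "continuous_on I h2"
    and U: "U \<subseteq> slit" "\<And>z. z \<in> U \<Longrightarrow> ang z \<in> I"
  defines "\<rho> \<equiv> \<lambda>z::real^2. ln (norm z)"
  shows "C2_on U (\<lambda>z. f (\<rho> z) * h (ang z)) (\<lambda>z. pgrad (f1 (\<rho> z) * h (ang z)) (f (\<rho> z) * h1 (ang z)) z)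
     (\<lambda>z. polar_matrix ((f2 (\<rho> z) - f1 (\<rho> z)) * h (ang z)) ((f1 (\<rho> z) - f (\<rho> z)) * h1 (ang z))
        (f (\<rho> z) * h2 (ang z) + f1 (\<rho> z) * h (ang z)) z)"
  unfolding C2_on_def
proof (intro conjI ballI)
  define P1 P2 where "P1 = (\<lambda>z::real^2. z$1 / (norm z)\<^sup>2)" and "P2 = (\<lambda>z::real^2. z$2 / (norm z)\<^sup>2)"
  have pg: "pgrad a b z $ 1 = a * P1 z + b * P2 z" "pgrad a b z $ 2 = a * P2 z - b * P1 z" for a b z
    unfolding pgrad_def P1_def P2_def by (simp_all add: add_divide_distrib diff_divide_distrib)
  have pol: "polar11 a b c z = a * (P1 z)\<^sup>2 + 2 * b * P1 z * P2 z + c * (P2 z)\<^sup>2"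
    "polar12 a b c z = (a - c) * P1 z * P2 z + b * ((P2 z)\<^sup>2 - (P1 z)\<^sup>2)"
    "polar22 a b c z = a * (P2 z)\<^sup>2 - 2 * b * P1 z * P2 z + c * (P1 z)\<^sup>2" for a b c z
    unfolding P1_def P2_def by (rule polar_entries)+
  have dP: "(P1 has_derivative (\<lambda>k. ((P2 z)\<^sup>2 - (P1 z)\<^sup>2) * k$1 - 2 * P1 z * P2 z * k$2)) (at z)"
    "(P2 has_derivative (\<lambda>k. ((P1 z)\<^sup>2 - (P2 z)\<^sup>2) * k$2 - 2 * P1 z * P2 z * k$1)) (at z)" if "z \<noteq> 0" for z
    using deriv_P[OF that] unfolding P1_def P2_def by simp_all
  have d\<rho>: "(\<rho> has_derivative (\<lambda>k. P1 z * k$1 + P2 z * k$2)) (at z)" if "z \<noteq> 0" for z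
    using deriv_ln_norm[OF that] unfolding \<rho>_def P1_def P2_def by simp
  have dang: "(ang has_derivative (\<lambda>k. P2 z * k$1 - P1 z * k$2)) (at z)" if "z \<in> slit" for z
    using deriv_ang[OF that] unfolding P1_def P2_def by simp
  have chr: "((\<lambda>z. F (\<rho> z)) has_derivative (\<lambda>k. (P1 z * k$1 + P2 z * k$2) * F' (\<rho> z))) (at z)"
    if "z \<noteq> 0" "\<And>t. (F has_real_derivative F' t) (at t)" for F F' z
    using has_derivative_compose[OF d\<rho>[OF that(1)], of F "(*) (F' (\<rho> z))"] that(2)[of "\<rho> z"]
    by (simp add: has_field_derivative_def mult.commute)
  have cha: "((\<lambda>z. F (ang z)) has_derivative (\<lambda>k. (P2 z * k$1 - P1 z * k$2) * F' (ang z))) (at z)"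
    if "z \<in> slit" "(F has_real_derivative F' (ang z)) (at (ang z))" for F F' z
    using has_derivative_compose[OF dang[OF that(1)], of F "(*) (F' (ang z))"] that(2)
    by (simp add: has_field_derivative_def mult.commute)
  {
    fix z assume z: "z \<in> U"
    then have zs: "z \<in> slit" and z0: "z \<noteq> 0" and zI: "ang z \<in> I" using U slit_nz by auto
    note df = chr[of z f f1, OF z0 f(1)] and df1 = chr[of z f1 f2, OF z0 f(2)]
    note dh = cha[of z h h1, OF zs h(1)[OF zI]] and dh1 = cha[of z h1 h2, OF zs h(2)[OF zI]]
    show "((\<lambda>z. f (\<rho> z) * h (ang z)) has_derivative
        (\<lambda>k. pgrad (f1 (\<rho> z) * h (ang z)) (f (\<rho> z) * h1 (ang z)) z \<bullet> k)) (at z)"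
      by (rule has_derivative_eq_rhs[OF has_derivative_mult[OF df dh]])
         (auto simp: fun_eq_iff inner_2 pg algebra_simps)
    let ?M = "\<lambda>z. polar_matrix ((f2 (\<rho> z) - f1 (\<rho> z)) * h (ang z)) ((f1 (\<rho> z) - f (\<rho> z)) * h1 (ang z))
        (f (\<rho> z) * h2 (ang z) + f1 (\<rho> z) * h (ang z)) z"
    let ?a = "(f2 (\<rho> z) - f1 (\<rho> z)) * h (ang z)" and ?b = "(f1 (\<rho> z) - f (\<rho> z)) * h1 (ang z)"
      and ?c = "f (\<rho> z) * h2 (ang z) + f1 (\<rho> z) * h (ang z)"
    have Mk: "(?M z *v k) $ 1 = polar11 ?a ?b ?c z * k$1
        + polar12 ?a ?b ?c z * k$2"
      "(?M z *v k) $ 2 = polar12 ?a ?b ?c z * k$1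
        + polar22 ?a ?b ?c z * k$2" for k
      by (simp_all add: matrix_vector_mult_def polar_matrix_def UNIV_2)
    have da: "((\<lambda>z. f1 (\<rho> z) * h (ang z)) has_derivative (\<lambda>k. f1 (\<rho> z) * ((P2 z * k$1 - P1 z * k$2) * h1 (ang z))
       + (P1 z * k$1 + P2 z * k$2) * f2 (\<rho> z) * h (ang z))) (at z)"
      by (rule has_derivative_mult[OF df1 dh])
    have db: "((\<lambda>z. f (\<rho> z) * h1 (ang z)) has_derivative (\<lambda>k. f (\<rho> z) * ((P2 z * k$1 - P1 z * k$2) * h2 (ang z))
       + (P1 z * k$1 + P2 z * k$2) * f1 (\<rho> z) * h1 (ang z))) (at z)"
      by (rule has_derivative_mult[OF df dh1])
    have g1: "((\<lambda>z. pgrad (f1 (\<rho> z) * h (ang z)) (f (\<rho> z) * h1 (ang z)) z $ 1) has_derivative (\<lambda>k. (?M z *v k) $ 1)) (at z)"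
      unfolding pg Mk pol
      by (rule has_derivative_eq_rhs[OF has_derivative_add[OF has_derivative_mult[OF da dP(1)[OF z0]] has_derivative_mult[OF db dP(2)[OF z0]]]])
         (auto simp: fun_eq_iff algebra_simps power2_eq_square)
    have g2: "((\<lambda>z. pgrad (f1 (\<rho> z) * h (ang z)) (f (\<rho> z) * h1 (ang z)) z $ 2) has_derivative (\<lambda>k. (?M z *v k) $ 2)) (at z)"
      unfolding pg Mk pol
      by (rule has_derivative_eq_rhs[OF has_derivative_diff[OF has_derivative_mult[OF da dP(2)[OF z0]] has_derivative_mult[OF db dP(1)[OF z0]]]])
         (auto simp: fun_eq_iff algebra_simps power2_eq_square)
    show "((\<lambda>z. pgrad (f1 (\<rho> z) * h (ang z)) (f (\<rho> z) * h1 (ang z)) z) has_derivative (\<lambda>k. ?M z *v k)) (at z)"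
    proof (subst has_derivative_componentwise_within, intro ballI)
      fix i :: "real^2" assume "i \<in> Basis"
      then obtain j where i: "i = axis j 1" by (auto simp: Basis_vec_def)
      have "j = 1 \<or> j = 2" using exhaust_2 by blast
      then show "((\<lambda>x. pgrad (f1 (\<rho> x) * h (ang x)) (f (\<rho> x) * h1 (ang x)) x \<bullet> i) has_derivative (\<lambda>x. (?M z *v x) \<bullet> i)) (at z)"
        unfolding i inner_axis using g1 g2 by auto
    qed
  }
  have cd: "continuous_on V F" if "\<And>z. z \<in> V \<Longrightarrow> (F has_derivative F' z) (at z)"
    for F :: "'x::real_normed_vector \<Rightarrow> real" and F' V
    by (rule continuous_at_imp_continuous_on) (use that has_derivative_continuous in blast)
  have nz: "z \<noteq> 0" "z \<in> slit" if "z \<in> U" for z using that U(1) slit_nz by auto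
  have cP: "continuous_on U P1" "continuous_on U P2"
    by (rule cd, rule dP, erule nz)+
  have cr: "continuous_on U \<rho>" by (rule cd, rule d\<rho>, erule nz)
  have ca: "continuous_on U ang" by (rule cd, rule dang, erule nz)
  have cf: "continuous_on UNIV f" "continuous_on UNIV f1"
    by (rule cd, rule f(1,2)[unfolded has_field_derivative_def])+
  have chh: "continuous_on I h" "continuous_on I h1"
    by (rule cd, erule h(1,2)[unfolded has_field_derivative_def])+
  have c1: "continuous_on U (\<lambda>z. F (\<rho> z))" if "continuous_on UNIV F" for F :: "real \<Rightarrow> real"
    using continuous_on_compose2[OF that cr] by simp
  have c2: "continuous_on U (\<lambda>z. F (ang z))" if "continuous_on I F" for F :: "real \<Rightarrow> real"
    using continuous_on_compose2[OF that ca] U(2) by blast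
  note cc = c1[OF cf(1)] c1[OF cf(2)] c1[OF f(3)] c2[OF chh(1)] c2[OF chh(2)] c2[OF h(3)] cP
  show "continuous_on U (\<lambda>z. polar_matrix ((f2 (\<rho> z) - f1 (\<rho> z)) * h (ang z)) ((f1 (\<rho> z) - f (\<rho> z)) * h1 (ang z))
        (f (\<rho> z) * h2 (ang z) + f1 (\<rho> z) * h (ang z)) z)"
  proof -
    have ck: "continuous_on U (\<lambda>z. polar11 (fa z) (fb z) (fc z) z)" "continuous_on U (\<lambda>z. polar12 (fa z) (fb z) (fc z) z)"
      "continuous_on U (\<lambda>z. polar22 (fa z) (fb z) (fc z) z)"
      if "continuous_on U fa" "continuous_on U fb" "continuous_on U fc" for fa fb fc
      unfolding pol by (intro continuous_intros that cP)+
    have cm: "continuous_on U (\<lambda>z. polar_matrix (fa z) (fb z) (fc z) z)"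
      if "continuous_on U fa" "continuous_on U fb" "continuous_on U fc" for fa fb fc
      unfolding polar_matrix_def
    proof (intro continuous_on_vec_lambda)
      fix i j :: 2
      show "continuous_on U (\<lambda>z. if i = 1 \<and> j = 1 then polar11 (fa z) (fb z) (fc z) z
         else if i = 2 \<and> j = 2 then polar22 (fa z) (fb z) (fc z) z else polar12 (fa z) (fb z) (fc z) z)"
      proof (cases "i = 1 \<and> j = 1")
        case True show ?thesis unfolding if_P[OF True] by (rule ck(1)[OF that])
      next
        case F: False
        show ?thesis
        proof (cases "i = 2 \<and> j = 2")
          case True show ?thesis unfolding if_not_P[OF F] if_P[OF True] by (rule ck(3)[OF that])
        next
          case False show ?thesis unfolding if_not_P[OF F] if_not_P[OF False] by (rule ck(2)[OF that])
        qed
      qed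
    qed
    show ?thesis
      by (rule cm; intro continuous_on_mult continuous_on_diff continuous_on_add cc)
  qed
qed

text \<open>Homogeneity of degree \<open>\<alpha>\<close> makes the Pucci operator a power of the radius times an expression in the
  angle alone. The power is written with the exponential because the radial factor has to be a smooth
  function of \<open>ln r\<close>.\<close>

lemma power_times_profile:
  fixes \<alpha> k :: real
  assumes h: "\<And>t. t \<in> I \<Longrightarrow> (h has_real_derivative h1 t) (at t)"
      "\<And>t. t \<in> I \<Longrightarrow> (h1 has_real_derivative h2 t) (at t)" "continuous_on I h2"
    and U: "U \<subseteq> slit" "\<And>z. z \<in> U \<Longrightarrow> ang z \<in> I" and k: "0 < k"
  obtains G H where "C2_on U (\<lambda>z. k * exp (\<alpha> * ln (norm z)) * h (ang z)) G H"
    "\<And>z. z \<in> U \<Longrightarrow> pucci_minus l L (H z) = k * norm z powr (\<alpha> - 2) *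
       homog_pucci l L \<alpha> (h (ang z)) (h1 (ang z)) (h2 (ang z))"
proof -
  define f where "f t = k * exp (\<alpha> * t)" for t
  have f: "(f has_real_derivative \<alpha> * f t) (at t)" "((\<lambda>t. \<alpha> * f t) has_real_derivative \<alpha>\<^sup>2 * f t) (at t)" for t
    unfolding f_def by (auto intro!: derivative_eq_intros simp: power2_eq_square)
  have cf: "continuous_on UNIV (\<lambda>t. \<alpha>\<^sup>2 * f t)" unfolding f_def by (intro continuous_intros)
  define H where "H y = polar_matrix ((\<alpha>\<^sup>2 * f (ln (norm y)) - \<alpha> * f (ln (norm y))) * h (ang y))
       ((\<alpha> * f (ln (norm y)) - f (ln (norm y))) * h1 (ang y))
        (f (ln (norm y)) * h2 (ang y) + \<alpha> * f (ln (norm y)) * h (ang y)) y" for y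
  have "\<exists>G. C2_on U (\<lambda>z. f (ln (norm z)) * h (ang z)) G H"
    unfolding H_def[abs_def] by (rule exI, rule C2_on_separated_polar[OF f cf h U])
  moreover have "pucci_minus l L (H z) = k * norm z powr (\<alpha> - 2) *
       homog_pucci l L \<alpha> (h (ang z)) (h1 (ang z)) (h2 (ang z))"
    if z: "z \<in> U" for z
  proof -
    have nz: "z \<noteq> 0" using U(1) z slit_nz by blast
    define F t where "F = f (ln (norm z))" and "t = ang z"
    have F: "F \<ge> 0" "F / (norm z)\<^sup>2 = k * norm z powr (\<alpha> - 2)"
      
      using nz k by (simp_all add: F_def f_def powr_diff powr_numeral) (simp add: powr_def)
    have e: "(\<alpha>\<^sup>2 * F - \<alpha> * F) * h t = F * (\<alpha> * (\<alpha> - 1) * h t)" "(\<alpha> * F - F) * h1 t = F * ((\<alpha> - 1) * h1 t)"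
      "F * h2 t + \<alpha> * F * h t = F * (\<alpha> * h t + h2 t)" by algebra+
    have "pucci_minus l L (H z) = F / (norm z)\<^sup>2 * homog_pucci l L \<alpha> (h t) (h1 t) (h2 t)"
      unfolding H_def pucci_polar_matrix[OF nz] F_def[symmetric] t_def[symmetric] e pucci2_scale[OF F(1)] by simp
    then show ?thesis unfolding F(2) t_def .
  qed
  ultimately show thesis using that unfolding f_def by blast
qed

section \<open>Viscosity supersolutions: comparison and classical solutions\<close>

lemma lsc_onD:
  assumes "lsc_on S u" "x \<in> S" "a < u x"
  obtains W where "open W" "x \<in> W" "\<And>y. y \<in> W \<inter> S \<Longrightarrow> a < u y"
proof -
  have "eventually (\<lambda>y. a < u y) (at x within S)" using assms unfolding lsc_on_def by blast
  then obtain W where W: "open W" "x \<in> W" "\<And>y. y \<in> W \<Longrightarrow> y \<noteq> x \<Longrightarrow> y \<in> S \<Longrightarrow> a < u y"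
    unfolding eventually_at_topological by blast
  show ?thesis by (rule that[OF W(1,2)]) (use W(3) assms(3) in blast)
qed

lemma lsc_on_subset: "lsc_on S u \<Longrightarrow> T \<subseteq> S \<Longrightarrow> lsc_on T u"
  unfolding lsc_on_def by (blast intro: filter_leD[OF at_le])

lemma continuous_on_imp_lsc_on: "continuous_on S u \<Longrightarrow> lsc_on S u"
  unfolding lsc_on_def continuous_on_def by (auto intro: order_tendstoD(1))

lemma lsc_on_diff:
  assumes "lsc_on S u" "continuous_on S w"
  shows "lsc_on S (\<lambda>z. u z - w z)"
  unfolding lsc_on_def
proof (intro ballI allI impI)
  fix x a assume x: "x \<in> S" and a: "a < u x - w x"
  define e where "e = (u x - w x - a) / 2"
  have e: "e > 0" using a by (simp add: e_def)
  have "eventually (\<lambda>y. u x - e < u y) (at x within S)"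
    using assms(1) x e unfolding lsc_on_def by simp
  moreover have "eventually (\<lambda>y. w y < w x + e) (at x within S)"
    using assms(2) x e unfolding continuous_on_def by (intro order_tendstoD(2)[of w "w x"]) auto
  ultimately show "eventually (\<lambda>y. a < u y - w y) (at x within S)"
    by eventually_elim (use e in \<open>auto simp: e_def field_simps\<close>)
qed

lemma lsc_on_attains_inf:
  fixes u :: "'a::topological_space \<Rightarrow> real"
  assumes "compact K" "K \<noteq> {}" "lsc_on K u"
  obtains x where "x \<in> K" "\<And>y. y \<in> K \<Longrightarrow> u x \<le> u y"
proof (rule ccontr)
  assume "\<not> thesis"
  then have "\<forall>x\<in>K. \<exists>y\<in>K. u y < u x" using that by (meson not_le)
  then obtain Y where Y: "\<And>x. x \<in> K \<Longrightarrow> Y x \<in> K \<and> u (Y x) < u x" by metis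
  have "\<forall>x\<in>K. \<exists>W. open W \<and> x \<in> W \<and> (\<forall>y\<in>W \<inter> K. u (Y x) < u y)"
    using lsc_onD[OF assms(3)] Y by metis
  then obtain W where W: "\<And>x. x \<in> K \<Longrightarrow> open (W x) \<and> x \<in> W x \<and> (\<forall>y\<in>W x \<inter> K. u (Y x) < u y)"
    by metis
  obtain T where T: "T \<subseteq> K" "finite T" "K \<subseteq> (\<Union>x\<in>T. W x)"
    using compactE_image[OF assms(1), of K W] W by blast
  have "T \<noteq> {}" using T(3) assms(2) by auto
  then obtain m where m: "m \<in> T" "\<And>x. x \<in> T \<Longrightarrow> u (Y m) \<le> u (Y x)"
    using arg_min_if_finite[OF T(2), of "\<lambda>x. u (Y x)"] by (metis not_le)
  have "Y m \<in> K" using m(1) T(1) Y by blast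
  then obtain x where "x \<in> T" "Y m \<in> W x" using T(3) by blast
  then have "u (Y x) < u (Y m)" using W T(1) \<open>Y m \<in> K\<close> by blast
  with m(2)[OF \<open>x \<in> T\<close>] show False by simp
qed

lemma C2_on_subset: "C2_on U w G H \<Longrightarrow> V \<subseteq> U \<Longrightarrow> C2_on V w G H"
  unfolding C2_on_def using continuous_on_subset by blast

lemma C2_on_diff_const:
  assumes "C2_on U w G H"
  shows "C2_on U (\<lambda>z. w z - c) G H"
  using assms unfolding C2_on_def by (auto intro!: derivative_eq_intros)

lemma C2_on_scaleR:
  assumes "C2_on U w G H"
  shows "C2_on U (\<lambda>z. k * w z) (\<lambda>z. k *\<^sub>R G z) (\<lambda>z. k *\<^sub>R H z)"
  unfolding C2_on_def
proof (intro conjI ballI)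
  fix x assume "x \<in> U"
  then have d: "(w has_derivative (\<lambda>h. G x \<bullet> h)) (at x)" "(G has_derivative (\<lambda>h. H x *v h)) (at x)"
    using assms unfolding C2_on_def by auto
  show "((\<lambda>z. k * w z) has_derivative (\<lambda>h. k *\<^sub>R G x \<bullet> h)) (at x)"
    using has_derivative_mult_right[OF d(1), of k] by simp
  show "((\<lambda>z. k *\<^sub>R G z) has_derivative (*v) (k *\<^sub>R H x)) (at x)"
    using has_derivative_scaleR_right[OF d(2), of k] by (simp add: scaleR_matrix_vector_assoc)
next
  show "continuous_on U (\<lambda>z. k *\<^sub>R H z)"
    using assms unfolding C2_on_def by (intro continuous_intros) auto
qed

lemma C2_on_continuous: "C2_on U w G H \<Longrightarrow> continuous_on U w"
  unfolding C2_on_def by (blast intro: continuous_at_imp_continuous_on has_derivative_continuous)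

lemma viscosity_restrict:
  "viscosity_supersolution F f \<Omega> u \<Longrightarrow> \<Omega>' \<subseteq> \<Omega> \<Longrightarrow> viscosity_supersolution F f \<Omega>' u"
  unfolding viscosity_supersolution_def by (meson order_trans)

lemma viscosityD:
  assumes "viscosity_supersolution F f \<Omega> u" "open U" "x \<in> U" "U \<subseteq> \<Omega>" "C2_on U w G H"
    "\<And>y. y \<in> U \<Longrightarrow> u x - w x \<le> u y - w y"
  shows "F (H x) + f (u x) \<le> 0"
  using assms unfolding viscosity_supersolution_def by blast

text \<open>At a negative minimum of \<open>u - w\<close> the function \<open>w\<close> itself is an admissible test function. The
  strict inequality is demanded only where \<open>u < w\<close>, which is what lets upper bounds on \<open>u\<close> enter the
  source term.\<close>

lemma viscosity_compare:
  assumes visc: "viscosity_supersolution F f \<Omega> u" and lsc: "lsc_on \<Omega> u"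
    and U: "open U" "U \<subseteq> K" and K: "K \<subseteq> \<Omega>" "compact K"
    and w: "continuous_on K w" "C2_on U w G H"
    and bd: "\<And>z. z \<in> K \<Longrightarrow> z \<notin> U \<Longrightarrow> w z \<le> u z"
    and strict: "\<And>z. z \<in> U \<Longrightarrow> u z < w z \<Longrightarrow> F (H z) + f (u z) > 0"
    and z: "z \<in> K"
  shows "w z \<le> u z"
proof (rule ccontr)
  assume neg: "\<not> w z \<le> u z"
  have "lsc_on K (\<lambda>z. u z - w z)"
    using lsc_on_diff[OF lsc_on_subset[OF lsc K(1)] w(1)] .
  then obtain x where x: "x \<in> K" "\<And>y. y \<in> K \<Longrightarrow> u x - w x \<le> u y - w y"
    using lsc_on_attains_inf[OF K(2), of "\<lambda>z. u z - w z"] z by blast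
  have ux: "u x < w x" using x(2)[OF z] neg by simp
  then have xU: "x \<in> U" using bd[OF x(1)] by fastforce
  have "F (H x) + f (u x) \<le> 0"
    by (rule viscosityD[OF visc U(1) xU _ w(2)]) (use U(2) K(1) x(2) in auto)
  with strict[OF xU ux] show False by simp
qed

lemma C2_on_diff:
  assumes "C2_on U v G H" "C2_on U w G' H'"
  shows "C2_on U (\<lambda>z. v z - w z) (\<lambda>z. G z - G' z) (\<lambda>z. H z - H' z)"
  using assms unfolding C2_on_def
  by (auto intro!: derivative_eq_intros continuous_intros simp: inner_diff_left matrix_vector_mult_diff_rdistrib)

text \<open>The left-hand side is symmetric in the two directions while the right-hand side is the mixed
  derivative in one fixed order; this yields Schwarz' theorem.\<close>

lemma C2_second_difference:
  fixes v :: "real^'n \<Rightarrow> real"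
  assumes C: "C2_on (ball x d) v G H" and s: "0 < s" "2 * s < d"
  shows "\<exists>p. dist x p \<le> 2 * s \<and>
    v (x + s *\<^sub>R axis i 1 + s *\<^sub>R axis j 1) - v (x + s *\<^sub>R axis i 1) - v (x + s *\<^sub>R axis j 1) + v x
      = s * s * H p $ i $ j"
proof -
  let ?ei = "axis i 1 :: real^'n" and ?ej = "axis j 1 :: real^'n"
  have inb: "x + a *\<^sub>R ?ei + b *\<^sub>R ?ej \<in> ball x d" "dist x (x + a *\<^sub>R ?ei + b *\<^sub>R ?ej) \<le> 2 * s"
    if "0 \<le> a" "a \<le> s" "0 \<le> b" "b \<le> s" for a b
  proof -
    have "norm (a *\<^sub>R ?ei + b *\<^sub>R ?ej) \<le> norm (a *\<^sub>R ?ei) + norm (b *\<^sub>R ?ej)" by (rule norm_triangle_ineq)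
    also have "\<dots> \<le> 2 * s" using that by simp
    finally have "norm (a *\<^sub>R ?ei + b *\<^sub>R ?ej) \<le> 2 * s" .
    moreover have "x + a *\<^sub>R ?ei + b *\<^sub>R ?ej - x = a *\<^sub>R ?ei + b *\<^sub>R ?ej" by simp
    ultimately show "dist x (x + a *\<^sub>R ?ei + b *\<^sub>R ?ej) \<le> 2 * s"
      by (metis dist_commute dist_norm)
    then show "x + a *\<^sub>R ?ei + b *\<^sub>R ?ej \<in> ball x d" using s by auto
  qed
  have dv: "(v has_derivative (\<lambda>h. G y \<bullet> h)) (at y)" "(G has_derivative (\<lambda>h. H y *v h)) (at y)" if "y \<in> ball x d" for y
    using C that unfolding C2_on_def by auto
  define g where "g a = v (x + a *\<^sub>R ?ei + s *\<^sub>R ?ej) - v (x + a *\<^sub>R ?ei)" for a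
  have dg: "(g has_real_derivative (G (x + a *\<^sub>R ?ei + s *\<^sub>R ?ej) $ i - G (x + a *\<^sub>R ?ei) $ i)) (at a)"
    if "0 \<le> a" "a \<le> s" for a
  proof -
    have 1: "((\<lambda>a. x + a *\<^sub>R ?ei + b *\<^sub>R ?ej) has_derivative (\<lambda>h. h *\<^sub>R ?ei)) (at a)" for b
      by (auto intro!: derivative_eq_intros)
    have 2: "((\<lambda>a. v (x + a *\<^sub>R ?ei + b *\<^sub>R ?ej)) has_derivative (\<lambda>h. G (x + a *\<^sub>R ?ei + b *\<^sub>R ?ej) \<bullet> (h *\<^sub>R ?ei))) (at a)"
      if "0 \<le> b" "b \<le> s" for b
      using has_derivative_compose[OF 1 dv(1)[OF inb(1)[OF \<open>0 \<le> a\<close> \<open>a \<le> s\<close> that]]] .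
    have "(g has_derivative (\<lambda>h. G (x + a *\<^sub>R ?ei + s *\<^sub>R ?ej) \<bullet> (h *\<^sub>R ?ei) - G (x + a *\<^sub>R ?ei) \<bullet> (h *\<^sub>R ?ei))) (at a)"
      using has_derivative_diff[OF 2[of s] 2[of 0]] s unfolding g_def by simp
    then show ?thesis unfolding has_field_derivative_def
      by (rule has_derivative_eq_rhs) (simp add: fun_eq_iff inner_axis algebra_simps)
  qed
  obtain a where a: "0 < a" "a < s" "g s - g 0 = (s - 0) * (G (x + a *\<^sub>R ?ei + s *\<^sub>R ?ej) $ i - G (x + a *\<^sub>R ?ei) $ i)"
    using MVT2[of 0 s g "\<lambda>a. G (x + a *\<^sub>R ?ei + s *\<^sub>R ?ej) $ i - G (x + a *\<^sub>R ?ei) $ i"] s dg by blast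
  define k where "k b = G (x + a *\<^sub>R ?ei + b *\<^sub>R ?ej) $ i" for b
  have dk: "(k has_real_derivative (H (x + a *\<^sub>R ?ei + b *\<^sub>R ?ej) $ i $ j)) (at b)" if "0 \<le> b" "b \<le> s" for b
  proof -
    have 1: "((\<lambda>b. x + a *\<^sub>R ?ei + b *\<^sub>R ?ej) has_derivative (\<lambda>h. h *\<^sub>R ?ej)) (at b)"
      by (auto intro!: derivative_eq_intros)
    have "((\<lambda>b. G (x + a *\<^sub>R ?ei + b *\<^sub>R ?ej)) has_derivative (\<lambda>h. H (x + a *\<^sub>R ?ei + b *\<^sub>R ?ej) *v (h *\<^sub>R ?ej))) (at b)"
      using has_derivative_compose[OF 1 dv(2)[OF inb(1)]] a that by simp
    from bounded_linear.has_derivative[OF bounded_linear_vec_nth this, of i]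
    show ?thesis unfolding has_field_derivative_def k_def
      by (rule has_derivative_eq_rhs) (simp add: fun_eq_iff matrix_vector_mult_scaleR matrix_vector_mult_basis column_def mult.commute)
  qed
  obtain b where b: "0 < b" "b < s" "k s - k 0 = (s - 0) * H (x + a *\<^sub>R ?ei + b *\<^sub>R ?ej) $ i $ j"
    using MVT2[of 0 s k "\<lambda>b. H (x + a *\<^sub>R ?ei + b *\<^sub>R ?ej) $ i $ j"] s dk by blast
  have "g s - g 0 = s * s * H (x + a *\<^sub>R ?ei + b *\<^sub>R ?ej) $ i $ j"
    using a(3) b(3) unfolding k_def by simp
  then show ?thesis unfolding g_def
    using inb(2)[of a b] a b by (intro exI[of _ "x + a *\<^sub>R ?ei + b *\<^sub>R ?ej"]) (auto simp: algebra_simps)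
qed

lemma C2_on_symmetric:
  fixes v :: "real^'n \<Rightarrow> real"
  assumes C: "C2_on U v G H" and U: "open U" "x \<in> U"
  shows "H x $ i $ j = H x $ j $ i"
proof (rule ccontr)
  assume ne: "H x $ i $ j \<noteq> H x $ j $ i"
  define e where "e = \<bar>H x $ i $ j - H x $ j $ i\<bar> / 2"
  have e: "e > 0" "2 * e = \<bar>H x $ i $ j - H x $ j $ i\<bar>" using ne by (simp_all add: e_def)
  have cH: "continuous_on U (\<lambda>y. H y $ i $ j)" for i j
    using C unfolding C2_on_def by (intro continuous_intros) auto
  have "\<exists>d>0. \<forall>y\<in>U. dist y x < d \<longrightarrow> dist (H y $ i $ j) (H x $ i $ j) < e" for i j
    using cH[of i j, unfolded continuous_on_iff] U(2) e(1) by blast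
  then obtain d1 d2 where d1: "d1 > 0" "\<And>y. y \<in> U \<Longrightarrow> dist y x < d1 \<Longrightarrow> dist (H y $ i $ j) (H x $ i $ j) < e"
    and d2: "d2 > 0" "\<And>y. y \<in> U \<Longrightarrow> dist y x < d2 \<Longrightarrow> dist (H y $ j $ i) (H x $ j $ i) < e"
    by meson
  obtain d0 where d0: "d0 > 0" "ball x d0 \<subseteq> U" using U open_contains_ball by blast
  define d where "d = min d0 (min d1 d2)"
  have d: "d > 0" "ball x d \<subseteq> U" using d0 d1 d2 by (auto simp: d_def)
  define s where "s = d / 3"
  have s: "0 < s" "2 * s < d" using d by (auto simp: s_def)
  note sd = C2_second_difference[OF C2_on_subset[OF C d(2)] s]
  from sd[of i j] obtain p where p: "dist x p \<le> 2 * s"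
    "v (x + s *\<^sub>R axis i 1 + s *\<^sub>R axis j 1) - v (x + s *\<^sub>R axis i 1) - v (x + s *\<^sub>R axis j 1) + v x
      = s * s * H p $ i $ j" by blast
  from sd[of j i] obtain q where q: "dist x q \<le> 2 * s"
    "v (x + s *\<^sub>R axis j 1 + s *\<^sub>R axis i 1) - v (x + s *\<^sub>R axis j 1) - v (x + s *\<^sub>R axis i 1) + v x
      = s * s * H q $ j $ i" by blast
  have "s * s * H p $ i $ j = s * s * H q $ j $ i"
  proof -
    have "x + s *\<^sub>R axis j 1 + s *\<^sub>R axis i 1 = x + s *\<^sub>R axis i 1 + s *\<^sub>R axis j 1" by (simp add: add_ac)
    from q(2)[unfolded this] p(2) show ?thesis by linarith
  qed
  then have eq: "H p $ i $ j = H q $ j $ i" using s by simp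
  have "dist p x < d" "dist q x < d" using p(1) q(1) s by (auto simp: dist_commute)
  then have "dist (H p $ i $ j) (H x $ i $ j) < e" "dist (H q $ j $ i) (H x $ j $ i) < e"
    using d1(2)[of p] d2(2)[of q] d(2) by (auto simp: d_def dist_commute subset_iff)
  then show False unfolding eq dist_real_def using e(2) by linarith
qed

lemma C2_local_min_psd:
  fixes v :: "real^'n \<Rightarrow> real"
  assumes C: "C2_on U v G H" and U: "open U" "x \<in> U" and mn: "\<And>y. y \<in> U \<Longrightarrow> v x \<le> v y"
  shows "0 \<le> h \<bullet> (H x *v h)"
proof (rule ccontr)
  assume neg: "\<not> ?thesis"
  define g where "g t = v (x + t *\<^sub>R h)" for t
  have line: "((\<lambda>t. x + t *\<^sub>R h) has_derivative (\<lambda>s. s *\<^sub>R h)) (at t)" for t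
    by (auto intro!: derivative_eq_intros)
  have cont: "isCont (\<lambda>t. x + t *\<^sub>R h) 0" by (intro continuous_intros)
  then have "eventually (\<lambda>t. x + t *\<^sub>R h \<in> U) (nhds 0)"
    using U unfolding continuous_at_imp_continuous_within continuous_within
    using topological_tendstoD[of "\<lambda>t. x + t *\<^sub>R h" x "at 0" U]
    by (auto simp: isCont_def eventually_nhds_conv_at)
  then obtain d where d: "d > 0" "\<And>t. \<bar>t\<bar> < d \<Longrightarrow> x + t *\<^sub>R h \<in> U"
    unfolding eventually_nhds_metric by (auto simp: dist_real_def)
  have dg: "(g has_real_derivative G (x + t *\<^sub>R h) \<bullet> h) (at t)" if "\<bar>t\<bar> < d" for t
  proof -
    have "(v has_derivative (\<lambda>k. G (x + t *\<^sub>R h) \<bullet> k)) (at (x + t *\<^sub>R h))"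
      using C d(2)[OF that] unfolding C2_on_def by blast
    from has_derivative_compose[OF line this] show ?thesis
      unfolding g_def has_field_derivative_def by (rule has_derivative_eq_rhs) (simp add: fun_eq_iff mult.commute)
  qed
  have g0: "G x \<bullet> h = 0"
    using DERIV_local_min[OF dg[of 0], of d] d mn by (simp add: g_def)
  have "(G has_derivative (\<lambda>k. H x *v k)) (at (x + 0 *\<^sub>R h))" using C U(2) unfolding C2_on_def by simp
  from has_derivative_inner_left[OF has_derivative_compose[OF line this], of h]
  have "((\<lambda>t. G (x + t *\<^sub>R h) \<bullet> h) has_real_derivative (h \<bullet> (H x *v h))) (at 0)"
    unfolding has_field_derivative_def
    by (rule has_derivative_eq_rhs) (simp add: fun_eq_iff matrix_vector_mult_scaleR inner_commute)
  from DERIV_neg_dec_right[OF this] neg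
  obtain d' where d': "d' > 0" "\<And>t. 0 < t \<Longrightarrow> t < d' \<Longrightarrow> G (x + t *\<^sub>R h) \<bullet> h < 0"
    using g0 by (auto simp: not_le)
  define t where "t = min d d' / 2"
  have t: "0 < t" "t < d" "t < d'" using d d' by (auto simp: t_def)
  have "\<exists>z>0. z < t \<and> g t - g 0 = (t - 0) * (G (x + z *\<^sub>R h) \<bullet> h)"
    by (rule MVT2) (use t dg in auto)
  then obtain z where z: "0 < z" "z < t" "g t - g 0 = t * (G (x + z *\<^sub>R h) \<bullet> h)" by auto
  have "t * (G (x + z *\<^sub>R h) \<bullet> h) < 0"
    using d'(2)[of z] z t by (simp add: mult_pos_neg)
  then have "g t < g 0" using z(3) by simp
  moreover have "g 0 \<le> g t" using mn[OF d(2)[of t]] t by (simp add: g_def)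
  ultimately show False by simp
qed

lemma psd_2:
  fixes a b c :: real
  assumes "\<And>s t. 0 \<le> a * s\<^sup>2 + 2 * b * (s * t) + c * t\<^sup>2"
  shows "0 \<le> a" "0 \<le> c" "b\<^sup>2 \<le> a * c"
proof -
  show a: "0 \<le> a" using assms[of 1 0] by simp
  show "0 \<le> c" using assms[of 0 1] by simp
  show "b\<^sup>2 \<le> a * c"
  proof (cases "a = 0")
    case False
    have "0 \<le> a * (a * c - b\<^sup>2)" using assms[of "- b" a] by (simp add: power2_eq_square algebra_simps)
    then show ?thesis using False a by (simp add: zero_le_mult_iff)
  next
    case True
    have "b = 0"
    proof (rule ccontr)
      assume "b \<noteq> 0"
      then show False using assms[of "- (c + 1) / (2 * b)" 1] True by simp
    qed
    then show ?thesis using True by simp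
  qed
qed

text \<open>At a touching point the difference of the Hessians is positive semidefinite, and it is symmetric
  by Schwarz' theorem, so superadditivity of the Pucci operator compares the two.\<close>

lemma classical_imp_viscosity:
  fixes v :: "real^2 \<Rightarrow> real"
  assumes l: "0 < l" "l \<le> L" and C: "C2_on \<Omega> v G H" and "open \<Omega>"
    and ineq: "\<And>z. z \<in> \<Omega> \<Longrightarrow> pucci_minus l L (H z) + f (v z) \<le> 0"
  shows "viscosity_supersolution (pucci_minus l L) f \<Omega> v"
  unfolding viscosity_supersolution_def
proof (intro allI impI, elim conjE)
  fix x U \<phi> G' H'
  assume U: "open U" "x \<in> U" "U \<subseteq> \<Omega>" and C': "C2_on U \<phi> G' H'" and mn: "\<forall>y\<in>U. v x - \<phi> x \<le> v y - \<phi> y"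
  note CU = C2_on_subset[OF C U(3)]
  define D where "D = H x - H' x"
  have sH: "H x $ 1 $ 2 = H x $ 2 $ 1" "H' x $ 1 $ 2 = H' x $ 2 $ 1"
    using C2_on_symmetric[OF CU U(1,2)] C2_on_symmetric[OF C' U(1,2)] by blast+
  have psd: "0 \<le> h \<bullet> (D *v h)" for h
    using C2_local_min_psd[OF C2_on_diff[OF CU C'] U(1,2)] mn unfolding D_def by blast
  have q: "0 \<le> D$1$1 * s\<^sup>2 + 2 * D$1$2 * (s * t) + D$2$2 * t\<^sup>2" for s t
    using psd[of "\<chi> i. if i = 1 then s else t"] sH
    by (simp add: inner_2 matrix_vector_mult_def UNIV_2 D_def power2_eq_square algebra_simps)
  note p = psd_2[OF q]
  have "0 \<le> pucci2 l L (D$1$1) (D$1$2) (D$2$2)"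
    using pucci2_psd[OF l p(1,2,3)] p l by simp
  moreover have "pucci2 l L (H' x$1$1) (H' x$1$2) (H' x$2$2) + pucci2 l L (D$1$1) (D$1$2) (D$2$2)
     \<le> pucci2 l L (H x$1$1) (H x$1$2) (H x$2$2)"
    using pucci2_superadd[OF l, of "H' x$1$1" "H' x$1$2" "H' x$2$2" "D$1$1" "D$1$2" "D$2$2"] by (simp add: D_def)
  ultimately have "pucci_minus l L (H' x) \<le> pucci_minus l L (H x)"
    using sH by (simp add: pucci_minus_symmetric)
  then show "pucci_minus l L (H' x) + f (v x) \<le> 0" using ineq[of x] U by force
qed

section \<open>The homogeneous solutions of the Pucci equation\<close>

text \<open>The matrix is \<open>k\<close> times one with eigenvalues \<open>q (1 + s\<^sup>2)\<close> and \<open>- (1 + s\<^sup>2)\<close>. The Pucci operator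
  vanishes when the positive eigenvalue is \<open>L / l\<close> times the modulus of the negative one, which
  fixes \<open>q\<close> according to the sign of \<open>k\<close>.\<close>

lemma pucci2_profile_zero:
  assumes l: "0 < l" "l \<le> L"
    and q: "q = L / l \<and> 0 \<le> k \<or> q = l / L \<and> k \<le> 0" and b: "b\<^sup>2 = (k * ((1 + q) * s))\<^sup>2"
  shows "pucci2 l L (k * (q - s\<^sup>2)) b (k * (q * s\<^sup>2 - 1)) = 0"
proof -
  have q0: "q > 0" using l q by auto
  define w where "w = 1 + s\<^sup>2"
  have w: "w > 0" unfolding w_def by (simp add: add_pos_nonneg)
  have t: "k * (q - s\<^sup>2) + k * (q * s\<^sup>2 - 1) = k * (q - 1) * w" unfolding w_def by algebra
  have "(k * (q - s\<^sup>2) - k * (q * s\<^sup>2 - 1))\<^sup>2 + (2 * b)\<^sup>2 = (k * (q - s\<^sup>2) - k * (q * s\<^sup>2 - 1))\<^sup>2 + 4 * (k * ((1 + q) * s))\<^sup>2"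
    using b by (simp add: power_mult_distrib)
  also have "\<dots> = (\<bar>k\<bar> * (1 + q) * w)\<^sup>2" unfolding w_def power_mult_distrib power2_abs by algebra
  finally have d: "sqrt ((k * (q - s\<^sup>2) - k * (q * s\<^sup>2 - 1))\<^sup>2 + (2 * b)\<^sup>2) = \<bar>k\<bar> * (1 + q) * w"
    using w q0 by simp
  have "\<bar>k * (q - 1) * w\<bar> \<le> \<bar>k\<bar> * (1 + q) * w"
  proof -
    have "\<bar>w\<bar> = w" "\<bar>q - 1\<bar> \<le> 1 + q" using w q0 by auto
    then show ?thesis using w unfolding abs_mult by (metis abs_ge_zero less_imp_le mult_left_mono mult_right_mono)
  qed
  then have "pucci2 l L (k * (q - s\<^sup>2)) b (k * (q * s\<^sup>2 - 1))
      = ((l + L) * (k * (q - 1)) - (L - l) * (\<bar>k\<bar> * (1 + q))) * w / 2"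
    unfolding pucci2_def t d by (simp add: max_def algebra_simps)
  also have "(l + L) * (k * (q - 1)) - (L - l) * (\<bar>k\<bar> * (1 + q)) = 0"
    using q
  proof
    assume "q = L / l \<and> 0 \<le> k"
    then show ?thesis using l by (simp add: field_simps)
  next
    assume "q = l / L \<and> k \<le> 0"
    then show ?thesis using l by (simp add: field_simps)
  qed
  finally show ?thesis by simp
qed

text \<open>The polynomial identities behind the explicit solution: the derivative of the angle with respect
  to the parameter \<open>s\<close>, and the first and second derivative of the profile, with \<open>S = s\<^sup>2\<close>.\<close>

lemma profile_algebra:
  fixes \<sigma> q \<alpha> A B D S :: real
  assumes s: "\<sigma> * \<sigma> = 1" and A: "q * A = q * (\<alpha> - 1) + 1" and B: "B = \<alpha> - 1 + q" and D: "D = \<sigma> * (A * S + B)"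
  shows "q * (\<sigma> * D + (2 - \<alpha>) * (1 + S)) = (1 + q) * (q + S)"
    and "q * (- 2 * (1 + S) * D + (q - S) * (- \<alpha> * D + (\<alpha> - 2) * (\<sigma> * A) * (1 + S))) = - \<sigma> * \<alpha> * (1 + q)\<^sup>2 * (q + S)"
    and "q * (- \<sigma> * ((1 + S) * D + S * (- \<alpha> * D + (\<alpha> - 2) * (\<sigma> * A) * (1 + S)))) = ((\<alpha> - 1) * (q * S - 1) - (q - S)) * (q + S)"
  using assms by algebra+

lemma arctan_scaled_deriv:
  assumes "A * B > 0"
  shows "((\<lambda>s. c / sqrt (A * B) * arctan (s * sqrt (A / B))) has_real_derivative c / (\<bar>A\<bar> * s\<^sup>2 + \<bar>B\<bar>)) (at s)"
proof -
  have nz: "A \<noteq> 0" "B \<noteq> 0" using assms by auto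
  have ab: "A / B > 0" using assms by (simp add: zero_less_divide_iff zero_less_mult_iff)
  have e1: "sqrt (A / B) / sqrt (A * B) = 1 / \<bar>B\<bar>"
  proof -
    have "sqrt (A / B) / sqrt (A * B) = sqrt ((A / B) / (A * B))" by (rule real_sqrt_divide[symmetric])
    also have "(A / B) / (A * B) = (1 / B)\<^sup>2" using nz by (simp add: power2_eq_square)
    finally show ?thesis by simp
  qed
  have e2: "1 + (s * sqrt (A / B))\<^sup>2 = (\<bar>A\<bar> * s\<^sup>2 + \<bar>B\<bar>) / \<bar>B\<bar>"
  proof -
    have "A / B = \<bar>A\<bar> / \<bar>B\<bar>" using ab by (metis abs_divide abs_of_pos)
    then show ?thesis using ab nz by (simp add: power_mult_distrib add_divide_distrib)
  qed
  have pos: "\<bar>A\<bar> * s\<^sup>2 + \<bar>B\<bar> > 0" using nz by (simp add: add_nonneg_pos)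
  have "((\<lambda>s. c / sqrt (A * B) * arctan (s * sqrt (A / B))) has_real_derivative
      c / sqrt (A * B) * (sqrt (A / B) * inverse (1 + (s * sqrt (A / B))\<^sup>2))) (at s)"
    by (rule derivative_eq_intros refl)+ simp
  also have "c / sqrt (A * B) * (sqrt (A / B) * inverse (1 + (s * sqrt (A / B))\<^sup>2))
      = c * (sqrt (A / B) / sqrt (A * B)) * inverse ((\<bar>A\<bar> * s\<^sup>2 + \<bar>B\<bar>) / \<bar>B\<bar>)"
    unfolding e2 by simp
  also have "\<dots> = c / (\<bar>A\<bar> * s\<^sup>2 + \<bar>B\<bar>)" unfolding e1 using nz pos by (simp add: field_simps)
  finally show ?thesis .
qed

lemma global_inverse:
  fixes T T' :: "real \<Rightarrow> real"
  assumes dT: "\<And>x. (T has_real_derivative T' x) (at x)" and pos: "\<And>x. T' x > 0" and ab: "a < b"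
  defines "s \<equiv> inv T"
  shows "strict_mono T" "\<And>x. s (T x) = x"
    "\<And>t. T a < t \<Longrightarrow> t < T b \<Longrightarrow> T (s t) = t \<and> a < s t \<and> s t < b"
    "\<And>t. T a < t \<Longrightarrow> t < T b \<Longrightarrow> (s has_real_derivative inverse (T' (s t))) (at t)"
proof -
  show sm: "strict_mono T"
    by (rule strict_monoI) (use dT pos DERIV_pos_imp_increasing in blast)
  then have inj: "inj T" by (rule strict_mono_imp_inj_on)
  then show inv: "s (T x) = x" for x unfolding s_def by simp
  have cont: "isCont T x" for x using dT DERIV_isCont by blast
  show range: "T (s t) = t \<and> a < s t \<and> s t < b" if t: "T a < t" "t < T b" for t
  proof -
    obtain x where x: "a \<le> x" "x \<le> b" "T x = t"
      using IVT[of T a t b] t ab cont by auto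
    then have "x \<noteq> a" "x \<noteq> b" using t by auto
    then show ?thesis using x inv[of x] by auto
  qed
  show "(s has_real_derivative inverse (T' (s t))) (at t)" if t: "T a < t" "t < T b" for t
  proof (rule DERIV_inverse_function[OF dT _ t])
    show "T' (s t) \<noteq> 0" using pos[of "s t"] by simp
    show "T (s y) = y" if "T a < y" "y < T b" for y using range that by blast
    have "isCont s (T (s t))"
      by (rule isCont_inverse_function[where d = 1]) (use inv cont in auto)
    then show "isCont s t" using range[OF t] by simp
  qed
qed

text \<open>\<open>\<phi>\<close> with its derivatives \<open>\<phi>1\<close>, \<open>\<phi>2\<close>. The larger interval \<open>(-g', g')\<close> makes \<open>r\<^sup>\<alpha> \<phi>\<close> of class \<open>C\<^sup>2\<close> across
  the lateral boundary of the cone of half-opening \<open>g\<close>, so that closed sectors can be used in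
  comparisons.\<close>

definition angular_profile ::
  "real \<Rightarrow> real \<Rightarrow> real \<Rightarrow> real \<Rightarrow> real \<Rightarrow> (real \<Rightarrow> real) \<Rightarrow> (real \<Rightarrow> real) \<Rightarrow> (real \<Rightarrow> real) \<Rightarrow> bool" where
  "angular_profile l L \<alpha> g g' \<phi> \<phi>1 \<phi>2 \<longleftrightarrow> 0 < g \<and> g < g' \<and>
     (\<forall>t\<in>{-g'<..<g'}. (\<phi> has_real_derivative \<phi>1 t) (at t) \<and> (\<phi>1 has_real_derivative \<phi>2 t) (at t) \<and>
        homog_pucci l L \<alpha> (\<phi> t) (\<phi>1 t) (\<phi>2 t) = 0) \<and>
     continuous_on {-g'<..<g'} \<phi>2 \<and> (\<forall>t\<in>{-g<..<g}. 0 < \<phi> t) \<and> \<phi> g = 0 \<and> \<phi> (-g) = 0"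

text \<open>Along a solution with the eigenvalue ratio required by \<open>pucci2_profile_zero\<close> the Hessian is, in the
  polar frame, proportional to the matrix with entries \<open>q - s\<^sup>2\<close>, \<open>\<plusminus> (1 + q) s\<close>, \<open>q s\<^sup>2 - 1\<close>, where \<open>s\<close>
  is the slope of an eigenvector. Comparing entries gives \<open>\<phi>' / \<phi>\<close> as a rational function of \<open>s\<close>, and
  then the equation becomes \<open>dt / ds = (1 + q) (q + s\<^sup>2) / (q (1 + s\<^sup>2) D)\<close> with \<open>D = \<sigma> (A s\<^sup>2 + B)\<close>.
  Partial fractions integrate this to the two arctangents of \<open>T\<close>, and integrating \<open>\<phi>' / \<phi>\<close> gives
  \<open>\<phi> = (q - s\<^sup>2) (1 + s\<^sup>2)\<^sup>-\<^sup>\<alpha>\<^sup>/\<^sup>2 D\<^sup>\<alpha>\<^sup>/\<^sup>2\<^sup>-\<^sup>1\<close>, which vanishes at \<open>s = \<plusminus> sqrt q\<close>. The case \<open>q = l / L\<close> serves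
  \<open>0 \<le> \<alpha> \<le> 1\<close>, where the radial second derivative is negative; the sign \<open>\<sigma>\<close> makes \<open>D\<close> positive.\<close>

lemma angular_profile_exists:
  fixes \<alpha> q \<sigma> :: real
  assumes l: "0 < l" "l \<le> L" and \<sigma>: "\<sigma> = 1 \<or> \<sigma> = -1"
    and q: "q = L / l \<and> 0 \<le> \<alpha> * (\<alpha> - 1) \<or> q = l / L \<and> \<alpha> * (\<alpha> - 1) \<le> 0"
  defines "A \<equiv> \<alpha> - 1 + 1 / q" and "B \<equiv> \<alpha> - 1 + q"
  assumes pos: "\<sigma> * A > 0" "\<sigma> * B > 0"
  shows "\<exists>g' \<phi> \<phi>1 \<phi>2. angular_profile l L \<alpha>
     (\<sigma> * arctan (sqrt q) + (2 - \<alpha>) / sqrt (A * B) * arctan (sqrt q * sqrt (A / B))) g' \<phi> \<phi>1 \<phi>2"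
proof -
  have q0: "q > 0" using l q by auto
  have ss: "\<sigma> * \<sigma> = 1" using \<sigma> by auto
  have qA: "q * A = q * (\<alpha> - 1) + 1" unfolding A_def using q0 by (simp add: field_simps)
  have AB: "A * B > 0"
  proof -
    have "(\<sigma> * A) * (\<sigma> * B) > 0" using pos by (rule mult_pos_pos)
    then show ?thesis using ss by (metis mult.assoc mult.left_commute mult_1)
  qed
  have abs: "\<bar>A\<bar> = \<sigma> * A" "\<bar>B\<bar> = \<sigma> * B" using pos \<sigma> by auto
  define T where "T s = \<sigma> * arctan s + (2 - \<alpha>) / sqrt (A * B) * arctan (s * sqrt (A / B))" for s
  define D where "D s = \<sigma> * (A * s\<^sup>2 + B)" for s
  have D: "D s > 0" for s
  proof -
    have "D s = (\<sigma> * A) * s\<^sup>2 + \<sigma> * B" by (simp add: D_def algebra_simps)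
    also have "\<dots> > 0" using pos by (simp add: add_nonneg_pos)
    finally show ?thesis .
  qed
  have w: "1 + s\<^sup>2 > 0" for s :: real by (simp add: add_pos_nonneg)
  define T' where "T' s = (1 + q) * (q + s\<^sup>2) / (q * ((1 + s\<^sup>2) * D s))" for s
  have T'pos: "T' s > 0" for s
    unfolding T'_def using q0 D[of s] w[of s] by (intro divide_pos_pos mult_pos_pos add_pos_nonneg) auto
  note alg = profile_algebra[OF ss qA B_def[THEN meta_eq_to_obj_eq] D_def]
  have dT: "(T has_real_derivative T' s) (at s)" for s
  proof -
    have "(T has_real_derivative \<sigma> * inverse (1 + s\<^sup>2) + (2 - \<alpha>) / (\<bar>A\<bar> * s\<^sup>2 + \<bar>B\<bar>)) (at s)"
      unfolding T_def by (intro DERIV_add arctan_scaled_deriv[OF AB] DERIV_cmult DERIV_arctan)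
    moreover have "\<sigma> * inverse (1 + s\<^sup>2) + (2 - \<alpha>) / (\<bar>A\<bar> * s\<^sup>2 + \<bar>B\<bar>) = T' s"
    proof -
      have "\<bar>A\<bar> * s\<^sup>2 + \<bar>B\<bar> = D s" unfolding abs D_def by (simp add: algebra_simps)
      then have "\<sigma> * inverse (1 + s\<^sup>2) + (2 - \<alpha>) / (\<bar>A\<bar> * s\<^sup>2 + \<bar>B\<bar>) = (\<sigma> * D s + (2 - \<alpha>) * (1 + s\<^sup>2)) / ((1 + s\<^sup>2) * D s)"
        using D[of s] w[of s] by (simp add: field_simps)
      also have "\<dots> = (q * (\<sigma> * D s + (2 - \<alpha>) * (1 + s\<^sup>2))) / (q * ((1 + s\<^sup>2) * D s))" using q0 by simp
      finally show ?thesis unfolding T'_def alg(1) .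
    qed
    ultimately show ?thesis by simp
  qed
  (* any \<open>S > sqrt q\<close> would do: the profile extends beyond its zeros *)
  define S where "S = sqrt q + 1"
  have S: "-S < S" "sqrt q < S" "- S < - sqrt q" using q0 by (auto simp: S_def intro: add_pos_pos)
  have T_odd: "T (- s) = - T s" for s by (simp add: T_def arctan_minus)
  define g g' where "g = T (sqrt q)" and "g' = T S"
  define s where "s = inv T"
  note inv = global_inverse[OF dT T'pos S(1), folded s_def, unfolded T_odd, folded g'_def]
  have g: "0 < g" "g < g'"
    using strict_monoD[OF inv(1), of 0 "sqrt q"] strict_monoD[OF inv(1) S(2)] q0 by (auto simp: g_def g'_def T_def)
  define J where "J s = exp (- (\<alpha> / 2) * ln (1 + s\<^sup>2) + (\<alpha> / 2 - 1) * ln (D s))" for s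
  have J: "J s > 0" for s by (simp add: J_def)
  define J' where "J' s = - \<alpha> / (1 + s\<^sup>2) + (\<alpha> - 2) * (\<sigma> * A) / D s" for s
  have dJ: "(J has_real_derivative J s * (s * J' s)) (at s)" for s
  proof -
    have dD: "(D has_real_derivative 2 * (\<sigma> * A) * s) (at s)"
      unfolding D_def by (auto intro!: derivative_eq_intros)
    have d1: "((\<lambda>s. ln (1 + s\<^sup>2)) has_real_derivative 2 * s / (1 + s\<^sup>2)) (at s)"
      using w[of s] by (auto intro!: derivative_eq_intros)
    have d2: "((\<lambda>s. ln (D s)) has_real_derivative 2 * (\<sigma> * A) * s / D s) (at s)"
      using D[of s] dD by (auto intro!: derivative_eq_intros)
    have "(J has_real_derivative J s * (- (\<alpha> / 2) * (2 * s / (1 + s\<^sup>2)) + (\<alpha> / 2 - 1) * (2 * (\<sigma> * A) * s / D s))) (at s)"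
      unfolding J_def by (intro DERIV_fun_exp DERIV_add DERIV_cmult d1 d2)
    moreover have "- (\<alpha> / 2) * (2 * s / (1 + s\<^sup>2)) + (\<alpha> / 2 - 1) * (2 * (\<sigma> * A) * s / D s) = s * J' s"
    proof -
      have h: "- (a / 2) * (2 * x) + (a / 2 - 1) * (2 * y) = - a * x + (a - 2) * y" for a x y :: real
        by (simp add: algebra_simps)
      show ?thesis using h[of \<alpha> "s / (1 + s\<^sup>2)" "\<sigma> * A * s / D s"] unfolding J'_def by (simp add: distrib_left right_diff_distrib mult_ac)
    qed
    ultimately show ?thesis by simp
  qed
  have J'eq: "((1 + x\<^sup>2) * D x) * J' x = - \<alpha> * D x + (\<alpha> - 2) * (\<sigma> * A) * (1 + x\<^sup>2)" for x
  proof -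
    have "(v * d) * (- a / v + c / d) = - a * d + c * v" if "v > 0" "d > 0" for v d a c :: real
      using that by (simp add: field_simps)
    from this[OF w[of x] D[of x]] show ?thesis unfolding J'_def .
  qed
  define E P Q where "E s = (q - s\<^sup>2) * J s" and "P s = (- \<sigma> * \<alpha> * (1 + q)) * (s * J s)"
    and "Q s = (\<alpha> * (\<alpha> - 1) * (q * s\<^sup>2 - 1) - \<alpha> * (q - s\<^sup>2)) * J s" for s
  have dE: "(E has_real_derivative P s * T' s) (at s)" for s
  proof -
    have d: "((\<lambda>s. q - s\<^sup>2) has_real_derivative - 2 * s) (at s)" by (auto intro!: derivative_eq_intros)
    have "(E has_real_derivative (- 2 * s) * J s + J s * (s * J' s) * (q - s\<^sup>2)) (at s)"
      unfolding E_def by (rule DERIV_mult[OF d dJ])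
    moreover have "(- 2 * s) * J s + J s * (s * J' s) * (q - s\<^sup>2) = P s * T' s"
    proof -
      define W where "W = q * ((1 + s\<^sup>2) * D s)"
      have W: "W > 0" unfolding W_def using q0 D[of s] w[of s] by auto
      have "((- 2 * s) * J s + J s * (s * J' s) * (q - s\<^sup>2)) * W
         = s * J s * (q * (- 2 * (1 + s\<^sup>2) * D s + (q - s\<^sup>2) * (((1 + s\<^sup>2) * D s) * J' s)))"
        unfolding W_def by algebra
      also have "\<dots> = s * J s * (- \<sigma> * \<alpha> * (1 + q)\<^sup>2 * (q + s\<^sup>2))" unfolding J'eq alg(2) ..
      also have "\<dots> = P s * ((1 + q) * (q + s\<^sup>2))" unfolding P_def by algebra
      also have "(1 + q) * (q + s\<^sup>2) = T' s * W" unfolding T'_def W_def[symmetric] using W by simp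
      finally show ?thesis using W by (metis mult.assoc mult_right_cancel less_irrefl)
    qed
    ultimately show ?thesis by simp
  qed
  have dP: "(P has_real_derivative Q s * T' s) (at s)" for s
  proof -
    have "((\<lambda>s. s * J s) has_real_derivative 1 * J s + J s * (s * J' s) * s) (at s)"
      by (rule DERIV_mult[OF DERIV_ident dJ])
    from DERIV_cmult[OF this, of "- \<sigma> * \<alpha> * (1 + q)"]
    have "(P has_real_derivative (- \<sigma> * \<alpha> * (1 + q)) * (1 * J s + J s * (s * J' s) * s)) (at s)"
      unfolding P_def .
    moreover have "(- \<sigma> * \<alpha> * (1 + q)) * (1 * J s + J s * (s * J' s) * s) = Q s * T' s"
    proof -
      define W where "W = q * ((1 + s\<^sup>2) * D s)"
      have W: "W > 0" unfolding W_def using q0 D[of s] w[of s] by auto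
      have "(- \<sigma> * \<alpha> * (1 + q)) * (1 * J s + J s * (s * J' s) * s) * W
         = \<alpha> * (1 + q) * J s * (q * (- \<sigma> * ((1 + s\<^sup>2) * D s + s\<^sup>2 * (((1 + s\<^sup>2) * D s) * J' s))))"
        unfolding W_def by algebra
      also have "\<dots> = \<alpha> * (1 + q) * J s * (((\<alpha> - 1) * (q * s\<^sup>2 - 1) - (q - s\<^sup>2)) * (q + s\<^sup>2))" unfolding J'eq alg(3) ..
      also have "\<dots> = Q s * ((1 + q) * (q + s\<^sup>2))" unfolding Q_def by algebra
      also have "(1 + q) * (q + s\<^sup>2) = T' s * W" unfolding T'_def W_def[symmetric] using W by simp
      finally show ?thesis using W by (metis mult.assoc mult_right_cancel less_irrefl)
    qed
    ultimately show ?thesis by simp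
  qed
  have ds: "(s has_real_derivative inverse (T' (s t))) (at t)" if "t \<in> {-g'<..<g'}" for t
    using inv(4)[of t] that by auto
  have dcomp: "((\<lambda>t. F (s t)) has_real_derivative R (s t)) (at t)"
    if "t \<in> {-g'<..<g'}" "\<And>x. (F has_real_derivative R x * T' x) (at x)" for F R t
  proof -
    have "R (s t) * T' (s t) * inverse (T' (s t)) = R (s t)" using T'pos[of "s t"] by simp
    then show ?thesis using DERIV_chain2[OF that(2) ds[OF that(1)]] by metis
  qed
  have cs: "continuous_on {-g'<..<g'} s"
    by (rule DERIV_continuous_on) (use ds has_field_derivative_at_within in blast)
  have cQ: "continuous_on UNIV Q"
  proof -
    have "continuous_on UNIV J" by (rule DERIV_continuous_on) (use dJ has_field_derivative_at_within in blast)
    then show ?thesis unfolding Q_def by (intro continuous_intros)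
  qed
  have s_g: "s g = sqrt q" "s (- g) = - sqrt q"
    using inv(2)[of "sqrt q"] inv(2)[of "- sqrt q"] by (simp_all add: g_def T_odd)
  have pmz: "homog_pucci l L \<alpha> (E x) (P x) (Q x) = 0" for x
  proof -
    define k where "k = \<alpha> * (\<alpha> - 1) * J x"
    have "q = L / l \<and> 0 \<le> k \<or> q = l / L \<and> k \<le> 0"
      using q J[of x] unfolding k_def by (auto intro: mult_nonneg_nonneg mult_nonpos_nonneg)
    moreover have "((\<alpha> - 1) * P x)\<^sup>2 = (k * ((1 + q) * x))\<^sup>2"
    proof -
      have "((\<alpha> - 1) * P x)\<^sup>2 = (\<sigma> * \<sigma>) * (k * ((1 + q) * x))\<^sup>2" unfolding P_def k_def by algebra
      then show ?thesis using ss by simp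
    qed
    ultimately have "pucci2 l L (k * (q - x\<^sup>2)) ((\<alpha> - 1) * P x) (k * (q * x\<^sup>2 - 1)) = 0"
      by (rule pucci2_profile_zero[OF l])
    moreover have "k * (q - x\<^sup>2) = \<alpha> * (\<alpha> - 1) * E x" unfolding k_def E_def by simp
    moreover have "k * (q * x\<^sup>2 - 1) = \<alpha> * E x + Q x" unfolding k_def E_def Q_def by algebra
    ultimately show ?thesis by simp
  qed
  have Epos: "E (s t) > 0" if "t \<in> {-g<..<g}" for t
  proof -
    have t: "t \<in> {-g'<..<g'}" using that g by auto
    then have Ts: "T (s t) = t" using inv(3)[of t] by auto
    have "s t < sqrt q" "- sqrt q < s t"
      using that Ts strict_mono_less[OF inv(1), of "s t" "sqrt q"] strict_mono_less[OF inv(1), of "- sqrt q" "s t"]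
      by (auto simp: g_def T_odd)
    then have "\<bar>s t\<bar> < sqrt q" by simp
    then have "(s t)\<^sup>2 < q" using q0 by (metis abs_ge_zero power2_abs power_strict_mono real_sqrt_pow2 less_imp_le zero_less_numeral)
    then show ?thesis unfolding E_def using J by simp
  qed
  have E0: "E (s g) = 0" "E (s (- g)) = 0" unfolding s_g E_def using q0 by simp_all
  have "angular_profile l L \<alpha> g g' (\<lambda>t. E (s t)) (\<lambda>t. P (s t)) (\<lambda>t. Q (s t))"
    unfolding angular_profile_def
  proof (intro conjI ballI)
    show "continuous_on {-g'<..<g'} (\<lambda>t. Q (s t))" by (rule continuous_on_compose2[OF cQ cs]) simp
    fix t assume t: "t \<in> {-g'<..<g'}"
    show "((\<lambda>t. E (s t)) has_real_derivative P (s t)) (at t)" by (rule dcomp[OF t dE])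
    show "((\<lambda>t. P (s t)) has_real_derivative Q (s t)) (at t)" by (rule dcomp[OF t dP])
  qed (use g pmz Epos E0 in auto)
  then show ?thesis unfolding g_def T_def by blast
qed

section \<open>Cones and sectors\<close>

lemma cone_C_iff: "z \<in> cone_C \<theta> \<longleftrightarrow> cos \<theta> * norm z < z$2"
  unfolding cone_C_def by (simp add: norm2_sq[symmetric])

lemma sector_slit:
  assumes "0 \<le> \<theta>" "\<theta> < pi" "z \<noteq> 0" "cos \<theta> * norm z \<le> z$2"
  shows "z \<in> slit"
proof -
  have "cos pi < cos \<theta>" using assms by (intro cos_monotone_0_pi) auto
  then have "-1 * norm z < cos \<theta> * norm z" using assms(3) by (intro mult_strict_right_mono) auto
  then show ?thesis using assms(4) unfolding slit_def by simp
qed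

lemma cone_nz: "z \<in> cone_C \<theta> \<Longrightarrow> z \<noteq> 0"
  by (auto simp: cone_C_iff)

lemma cone_slit: "0 \<le> \<theta> \<Longrightarrow> \<theta> < pi \<Longrightarrow> cone_C \<theta> \<subseteq> slit"
  using sector_slit cone_nz by (force simp: cone_C_iff)

text \<open>This turns conditions on the angle into the linear-in-\<open>norm\<close> inequalities that define the cones.\<close>

lemma cos_ang:
  assumes "z \<in> slit"
  shows "cos (ang z) = z$2 / norm z"
proof -
  define x y r where "x = z$1" and "y = z$2" and "r = norm z"
  have r: "r > 0" "r + y > 0" and r2: "r\<^sup>2 = x\<^sup>2 + y\<^sup>2"
    using assms slit_nz[OF assms] by (auto simp: slit_def r_def x_def y_def norm2_sq)
  define t where "t = x / (r + y)"
  have xx: "x * x = (r - y) * (r + y)" using r2 by (simp add: algebra_simps power2_eq_square)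
  have t2: "t\<^sup>2 = (r - y) / (r + y)" using xx r(2) by (simp add: t_def power2_eq_square)
  have "cos (ang z) = 2 * (cos (arctan t))\<^sup>2 - 1"
    unfolding ang_def t_def x_def y_def r_def by (rule cos_double_cos)
  also have "(cos (arctan t))\<^sup>2 = 1 / (1 + t\<^sup>2)"
    unfolding cos_arctan by (simp add: power_divide)
  also have "1 + t\<^sup>2 = 2 * r / (r + y)" unfolding t2 using r by (simp add: field_simps)
  also have "2 * (1 / (2 * r / (r + y))) - 1 = y / r" using r by (simp add: field_simps)
  finally show ?thesis by (simp add: y_def r_def)
qed

lemma ang_bound: "\<bar>ang z\<bar> < pi"
  unfolding ang_def using arctan_bounded[of "z$1 / (norm z + z$2)"] by (auto simp: abs_if)

lemma ang_less_iff:
  assumes "z \<in> slit" "0 \<le> \<theta>" "\<theta> \<le> pi"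
  shows "\<bar>ang z\<bar> < \<theta> \<longleftrightarrow> cos \<theta> * norm z < z$2"
proof -
  have n: "norm z > 0" using slit_nz[OF assms(1)] by simp
  have "\<bar>ang z\<bar> < \<theta> \<longleftrightarrow> cos \<theta> < cos \<bar>ang z\<bar>"
    using cos_mono_less_eq[of \<theta> "\<bar>ang z\<bar>"] assms ang_bound[of z] by simp
  also have "cos \<bar>ang z\<bar> = z$2 / norm z" using cos_ang[OF assms(1)] by simp
  also have "cos \<theta> < z$2 / norm z \<longleftrightarrow> cos \<theta> * norm z < z$2" using n by (simp add: pos_less_divide_eq)
  finally show ?thesis .
qed

lemma ang_le_iff:
  assumes "z \<in> slit" "0 \<le> \<theta>" "\<theta> \<le> pi"
  shows "\<bar>ang z\<bar> \<le> \<theta> \<longleftrightarrow> cos \<theta> * norm z \<le> z$2"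
proof -
  have n: "norm z > 0" using slit_nz[OF assms(1)] by simp
  have "\<bar>ang z\<bar> \<le> \<theta> \<longleftrightarrow> cos \<theta> \<le> cos \<bar>ang z\<bar>"
    using cos_mono_le_eq[of \<theta> "\<bar>ang z\<bar>"] assms ang_bound[of z] by simp
  also have "cos \<bar>ang z\<bar> = z$2 / norm z" using cos_ang[OF assms(1)] by simp
  also have "cos \<theta> \<le> z$2 / norm z \<longleftrightarrow> cos \<theta> * norm z \<le> z$2" using n by (simp add: pos_le_divide_eq)
  finally show ?thesis .
qed

lemma cone_ang:
  assumes "0 \<le> \<theta>" "\<theta> < pi"
  shows "z \<in> cone_C \<theta> \<longleftrightarrow> z \<in> slit \<and> \<bar>ang z\<bar> < \<theta>"
  using assms cone_slit[OF assms] ang_less_iff[of z \<theta>] by (auto simp: cone_C_iff)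

definition sector :: "real \<Rightarrow> (real^2) set" where
  "sector \<theta> = {z. cos \<theta> * norm z \<le> z$2}"

lemma sector_ang:
  assumes "0 \<le> \<theta>" "\<theta> < pi"
  shows "z \<in> sector \<theta> \<longleftrightarrow> z = 0 \<or> z \<in> slit \<and> \<bar>ang z\<bar> \<le> \<theta>"
  using assms sector_slit[OF assms, of z] ang_le_iff[of z \<theta>] by (auto simp: sector_def)

lemma sector_subset_cone:
  assumes "0 \<le> \<theta>" "\<theta> < \<theta>'" "\<theta>' \<le> pi" "z \<in> sector \<theta>" "z \<noteq> 0"
  shows "z \<in> cone_C \<theta>'"
proof -
  have "cos \<theta>' < cos \<theta>" using assms by (intro cos_monotone_0_pi) auto
  then have "cos \<theta>' * norm z < cos \<theta> * norm z" using assms(5) by simp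
  then show ?thesis using assms(4) by (simp add: sector_def cone_C_iff)
qed

lemma cone_mono:
  assumes "0 \<le> \<theta>" "\<theta> \<le> \<theta>'" "\<theta>' \<le> pi"
  shows "cone_C \<theta> \<subseteq> cone_C \<theta>'"
proof
  fix z assume z: "z \<in> cone_C \<theta>"
  have "cos \<theta>' \<le> cos \<theta>" using assms by (intro cos_monotone_0_pi_le) auto
  then have "cos \<theta>' * norm z \<le> cos \<theta> * norm z" by (simp add: mult_right_mono)
  then show "z \<in> cone_C \<theta>'" using z by (simp add: cone_C_iff)
qed

lemma cone_subset_sector: "cone_C \<theta> \<subseteq> sector \<theta>"
  by (auto simp: cone_C_iff sector_def)

lemma open_cone: "open (cone_C \<theta>)"
proof -
  have "cone_C \<theta> = {z. cos \<theta> * norm z < z$2}" by (auto simp: cone_C_iff)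
  moreover have "open {z::real^2. cos \<theta> * norm z < z$2}" by (intro open_Collect_less continuous_intros)
  ultimately show ?thesis by simp
qed

lemma compact_annular_sector: "compact {z \<in> sector \<theta>. a \<le> norm z \<and> norm z \<le> b}"
proof -
  have "closed {z::real^2. cos \<theta> * norm z \<le> z$2}" "closed {z::real^2. a \<le> norm z}" "closed {z::real^2. norm z \<le> b}"
    by (intro closed_Collect_le continuous_intros)+
  then have "closed ({z::real^2. cos \<theta> * norm z \<le> z$2} \<inter> {z. a \<le> norm z} \<inter> {z. norm z \<le> b})"
    by (intro closed_Int)
  moreover have "bounded ({z::real^2. cos \<theta> * norm z \<le> z$2} \<inter> {z. a \<le> norm z} \<inter> {z. norm z \<le> b})"
    unfolding bounded_iff by blast
  ultimately have "compact ({z::real^2. cos \<theta> * norm z \<le> z$2} \<inter> {z. a \<le> norm z} \<inter> {z. norm z \<le> b})"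
    using compact_eq_bounded_closed by blast
  then show ?thesis by (rule back_subst[of compact]) (auto simp: sector_def)
qed

lemma open_annular_cone: "open {z \<in> cone_C \<theta>. a < norm z \<and> norm z < b}"
proof -
  have "open (cone_C \<theta> \<inter> {z. a < norm z} \<inter> {z. norm z < b})"
    by (intro open_Int open_cone open_Collect_less continuous_intros)
  then show ?thesis by (rule back_subst[of "open"]) auto
qed

lemma scale_cone: "k > 0 \<Longrightarrow> k *\<^sub>R z \<in> cone_C \<theta> \<longleftrightarrow> z \<in> cone_C \<theta>"
  by (simp add: cone_C_iff mult.left_commute[of _ k])

lemma scale_sector: "k > 0 \<Longrightarrow> k *\<^sub>R z \<in> sector \<theta> \<longleftrightarrow> z \<in> sector \<theta>"
  by (simp add: sector_def mult.left_commute[of _ k])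

definition e2 :: "real^2" where "e2 = axis 2 1"

lemma e2: "e2$1 = 0" "e2$2 = 1" "norm e2 = 1" "ang e2 = 0"
proof -
  show 12: "e2$1 = 0" "e2$2 = 1" by (simp_all add: e2_def axis_def)
  show "norm e2 = 1" by (simp add: e2_def)
  show "ang e2 = 0" by (simp add: ang_def 12)
qed

lemma e2_cone: "0 < \<theta> \<Longrightarrow> \<theta> \<le> pi \<Longrightarrow> e2 \<in> cone_C \<theta>"
  using cos_monotone_0_pi[of 0 \<theta>] by (simp add: cone_C_iff e2)

text \<open>Translation along the axis moves the closed cone, vertex included, into the open one. A translated
  supersolution is therefore positive up to the lateral boundary, which replaces a Hopf lemma when
  the cone of positivity of \<open>\<Phi>\<close> is all of \<open>\<C>\<^sub>0\<close>.\<close>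

lemma shift_sector_cone:
  assumes "0 < \<theta>" "\<theta> < pi" "z \<in> sector \<theta>"
  shows "z + e2 \<in> cone_C \<theta>"
proof -
  have c: "cos \<theta> < 1" "-1 < cos \<theta>"
    using assms cos_monotone_0_pi[of 0 \<theta>] cos_monotone_0_pi[of \<theta> pi] by auto
  have n: "norm (z + e2) \<le> norm z + 1" "norm z - 1 \<le> norm (z + e2)"
    using norm_triangle_ineq[of z e2] norm_triangle_ineq2[of z "- e2"] by (auto simp: e2)
  have z: "cos \<theta> * norm z \<le> z$2" using assms(3) by (simp add: sector_def)
  have "cos \<theta> * norm (z + e2) < z$2 + 1"
  proof (cases "cos \<theta> \<ge> 0")
    case True
    then have "cos \<theta> * norm (z + e2) \<le> cos \<theta> * (norm z + 1)" using n by (intro mult_left_mono) auto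
    also have "\<dots> < z$2 + 1" using z c by (simp add: distrib_left)
    finally show ?thesis .
  next
    case False
    then have "cos \<theta> * norm (z + e2) \<le> cos \<theta> * (norm z - 1)" using n by (intro mult_left_mono_neg) auto
    also have "\<dots> < z$2 + 1" using z c by (simp add: right_diff_distrib)
    finally show ?thesis .
  qed
  then show ?thesis by (simp add: cone_C_iff e2)
qed

lemma sector_uniform_ball:
  assumes "0 \<le> \<theta>" "\<theta> < \<theta>'" "\<theta>' \<le> pi"
  obtains \<rho> where "0 < \<rho>" "\<rho> < 1" "\<And>z. z \<in> sector \<theta> \<Longrightarrow> z \<noteq> 0 \<Longrightarrow> cball z (\<rho> * norm z) \<subseteq> cone_C \<theta>'"
proof -
  define K where "K = {z \<in> sector \<theta>. 1 \<le> norm z \<and> norm z \<le> 1}"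
  have "K \<subseteq> cone_C \<theta>'"
  proof
    fix x assume "x \<in> K"
    then have "x \<in> sector \<theta>" "x \<noteq> 0" by (auto simp: K_def)
    then show "x \<in> cone_C \<theta>'" by (rule sector_subset_cone[OF assms])
  qed
  moreover have "compact K" unfolding K_def by (rule compact_annular_sector)
  ultimately obtain e where e: "e > 0" "(\<Union>x\<in>K. ball x e) \<subseteq> cone_C \<theta>'"
    using compact_subset_open_imp_ball_epsilon_subset[of K "cone_C \<theta>'"] open_cone by blast
  define \<rho> where "\<rho> = min (e / 2) (1 / 2)"
  have \<rho>: "0 < \<rho>" "\<rho> < 1" "\<rho> < e" using e by (auto simp: \<rho>_def)
  have "cball z (\<rho> * norm z) \<subseteq> cone_C \<theta>'" if z: "z \<in> sector \<theta>" "z \<noteq> 0" for z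
  proof
    fix y assume "y \<in> cball z (\<rho> * norm z)"
    then have y: "norm (z - y) \<le> \<rho> * norm z" by (simp add: dist_norm)
    define k where "k = inverse (norm z)"
    have k: "k > 0" "k * norm z = 1" using z by (auto simp: k_def)
    have "norm (k *\<^sub>R z - k *\<^sub>R y) = k * norm (z - y)" using k by (simp flip: scaleR_diff_right)
    also have "\<dots> \<le> k * (\<rho> * norm z)" using y k by (intro mult_left_mono) auto
    also have "\<dots> = \<rho>" using k(2) by (simp add: mult.left_commute)
    finally have "k *\<^sub>R y \<in> ball (k *\<^sub>R z) e" using \<rho> by (simp add: dist_norm)
    moreover have "k *\<^sub>R z \<in> K" unfolding K_def using z k scale_sector[of k z] by simp
    ultimately have "k *\<^sub>R y \<in> cone_C \<theta>'" using e(2) by blast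
    then show "y \<in> cone_C \<theta>'" using scale_cone k by blast
  qed
  then show thesis using that \<rho> by blast
qed


section \<open>Bump functions in balls\<close>

lemma bump_C2:
  fixes z :: "real^2"
  assumes "\<rho> > 0"
  defines "\<eta> \<equiv> \<lambda>y. 1 - (y - z) \<bullet> (y - z) / \<rho>\<^sup>2"
  defines "H \<equiv> \<lambda>y. (8 / \<rho>^4) *\<^sub>R (\<chi> i j. (y - z)$i * (y - z)$j) - (4 * \<eta> y / \<rho>\<^sup>2) *\<^sub>R mat 1"
  shows "C2_on UNIV (\<lambda>y. (\<eta> y)\<^sup>2) (\<lambda>y. (- 4 * \<eta> y / \<rho>\<^sup>2) *\<^sub>R (y - z)) H"
  unfolding C2_on_def
proof (intro conjI ballI)
  fix y
  have d\<eta>: "(\<eta> has_derivative (\<lambda>h. - (2 * ((y - z) \<bullet> h)) / \<rho>\<^sup>2)) (at y)"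
  proof -
    have d: "((\<lambda>y. y - z) has_derivative (\<lambda>h. h)) (at y)" by (auto intro!: derivative_eq_intros)
    have "((\<lambda>y. (- 1 / \<rho>\<^sup>2) * ((y - z) \<bullet> (y - z))) has_derivative
        (\<lambda>h. (- 1 / \<rho>\<^sup>2) * ((y - z) \<bullet> h + h \<bullet> (y - z)))) (at y)"
      by (rule has_derivative_mult_right[OF has_derivative_inner[OF d d]])
    from has_derivative_add[OF has_derivative_const[of 1] this]
    have "(\<eta> has_derivative (\<lambda>h. 0 + (- 1 / \<rho>\<^sup>2) * ((y - z) \<bullet> h + h \<bullet> (y - z)))) (at y)"
      unfolding \<eta>_def by simp
    then show ?thesis by (rule has_derivative_eq_rhs) (simp add: fun_eq_iff inner_commute)
  qed
  have "((\<lambda>y. \<eta> y * \<eta> y) has_derivative (\<lambda>h. \<eta> y * (- (2 * ((y - z) \<bullet> h)) / \<rho>\<^sup>2) + (- (2 * ((y - z) \<bullet> h)) / \<rho>\<^sup>2) * \<eta> y)) (at y)"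
    by (rule has_derivative_mult[OF d\<eta> d\<eta>])
  then show "((\<lambda>y. (\<eta> y)\<^sup>2) has_derivative (\<lambda>h. (- 4 * \<eta> y / \<rho>\<^sup>2) *\<^sub>R (y - z) \<bullet> h)) (at y)"
    unfolding power2_eq_square[of "\<eta> _"] by (rule has_derivative_eq_rhs) (simp add: fun_eq_iff)
  have d1: "((\<lambda>y. - 4 * \<eta> y / \<rho>\<^sup>2) has_derivative (\<lambda>h. (8 / \<rho>^4) * ((y - z) \<bullet> h))) (at y)"
  proof -
    have "((\<lambda>y. (- 4 / \<rho>\<^sup>2) * \<eta> y) has_derivative (\<lambda>h. (- 4 / \<rho>\<^sup>2) * (- (2 * ((y - z) \<bullet> h)) / \<rho>\<^sup>2))) (at y)"
      by (rule has_derivative_mult_right[OF d\<eta>])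
    moreover have "(- 4 / \<rho>\<^sup>2) * (- (2 * x) / \<rho>\<^sup>2) = 8 / \<rho>^4 * x" for x :: real by (simp flip: power_add)
    ultimately show ?thesis by simp
  qed
  have d2: "((\<lambda>y. y - z) has_derivative (\<lambda>h. h)) (at y)" by (auto intro!: derivative_eq_intros)
  have outer: "(\<chi> i j. (y - z)$i * (y - z)$j) *v h = ((y - z) \<bullet> h) *\<^sub>R (y - z)" for h
    by (simp add: vec_eq_iff matrix_vector_mult_def inner_vec_def sum_distrib_left sum_distrib_right mult_ac)
  have "((\<lambda>y. (- 4 * \<eta> y / \<rho>\<^sup>2) *\<^sub>R (y - z)) has_derivative
      (\<lambda>h. (- 4 * \<eta> y / \<rho>\<^sup>2) *\<^sub>R h + ((8 / \<rho>^4) * ((y - z) \<bullet> h)) *\<^sub>R (y - z))) (at y)"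
    by (rule has_derivative_scaleR[OF d1 d2])
  then show "((\<lambda>y. (- 4 * \<eta> y / \<rho>\<^sup>2) *\<^sub>R (y - z)) has_derivative (\<lambda>h. H y *v h)) (at y)"
  proof (rule has_derivative_eq_rhs, intro ext)
    fix h
    have "H y *v h = (8 / \<rho>^4) *\<^sub>R ((\<chi> i j. (y - z)$i * (y - z)$j) *v h) - (4 * \<eta> y / \<rho>\<^sup>2) *\<^sub>R (mat 1 *v h)"
      unfolding H_def matrix_vector_mult_diff_rdistrib scaleR_matrix_vector_assoc[symmetric] ..
    then show "(- 4 * \<eta> y / \<rho>\<^sup>2) *\<^sub>R h + ((8 / \<rho>^4) * ((y - z) \<bullet> h)) *\<^sub>R (y - z) = H y *v h"
      unfolding outer by simp
  qed
next
  show "continuous_on UNIV H" unfolding H_def \<eta>_def by (intro continuous_intros) (use assms in auto)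
qed

text \<open>Near the boundary of the ball, where \<open>\<eta>\<close> is small, the squared bump is convex enough in the
  radial direction to be a subsolution; an interior touching point is thus kept away from the
  boundary.\<close>

lemma bump_pucci:
  fixes z y :: "real^2"
  assumes l: "0 < l" "l \<le> L" and \<rho>: "\<rho> > 0" and k: "k \<ge> 0"
  defines "\<eta> \<equiv> 1 - (y - z) \<bullet> (y - z) / \<rho>\<^sup>2"
  defines "H \<equiv> (8 / \<rho>^4) *\<^sub>R (\<chi> i j. (y - z)$i * (y - z)$j) - (4 * \<eta> / \<rho>\<^sup>2) *\<^sub>R mat 1"
  assumes \<eta>: "\<eta> \<ge> 0"
  shows "pucci_minus l L (k *\<^sub>R H) \<ge> 8 * k / \<rho>\<^sup>2 * (l * (1 - \<eta>) - L * \<eta>)"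
proof -
  define x1 x2 where "x1 = (y - z)$1" and "x2 = (y - z)$2"
  define a where "a = 8 / \<rho>^4"
  define b where "b = 4 * \<eta> / \<rho>\<^sup>2"
  have a: "a \<ge> 0" and b: "b \<ge> 0" using \<rho> \<eta> by (auto simp: a_def b_def)
  have H: "H$1$1 = a * x1\<^sup>2 - b" "H$1$2 = a * (x1 * x2)" "H$2$1 = a * (x1 * x2)" "H$2$2 = a * x2\<^sup>2 - b"
    unfolding H_def a_def b_def x1_def x2_def by (simp_all add: mat_def power2_eq_square)
  have "pucci_minus l L (k *\<^sub>R H) = pucci2 l L (k * (a * x1\<^sup>2 - b)) (k * (a * (x1 * x2))) (k * (a * x2\<^sup>2 - b))"
    by (subst pucci_minus_symmetric) (simp_all add: H)
  also have "\<dots> = k * pucci2 l L (a * x1\<^sup>2 - b) (a * (x1 * x2)) (a * x2\<^sup>2 - b)" by (rule pucci2_scale[OF k])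
  finally have eq: "pucci_minus l L (k *\<^sub>R H) = k * pucci2 l L (a * x1\<^sup>2 - b) (a * (x1 * x2)) (a * x2\<^sup>2 - b)" .
  have p1: "pucci2 l L (a * x1\<^sup>2) (a * (x1 * x2)) (a * x2\<^sup>2) = l * (a * x1\<^sup>2 + a * x2\<^sup>2)"
    by (rule pucci2_psd[OF l]) (use a in \<open>auto simp: power2_eq_square\<close>)
  have p2: "pucci2 l L (- b) 0 (- b) = L * (- b + - b)"
    by (rule pucci2_nsd[OF l]) (use b in auto)
  have "l * (a * x1\<^sup>2 + a * x2\<^sup>2) + L * (- b + - b) \<le> pucci2 l L (a * x1\<^sup>2 - b) (a * (x1 * x2)) (a * x2\<^sup>2 - b)"
    using pucci2_superadd[OF l, of "a * x1\<^sup>2" "a * (x1 * x2)" "a * x2\<^sup>2" "- b" 0 "- b"] unfolding p1 p2 by simp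
  from mult_left_mono[OF this k] have ge: "k * (l * (a * x1\<^sup>2 + a * x2\<^sup>2) + L * (- b + - b)) \<le> pucci_minus l L (k *\<^sub>R H)"
    unfolding eq .
  have e: "1 - \<eta> = (x1\<^sup>2 + x2\<^sup>2) / \<rho>\<^sup>2" unfolding \<eta>_def inner_2 x1_def x2_def by (simp add: power2_eq_square)
  have "a * x1\<^sup>2 + a * x2\<^sup>2 = 8 / \<rho>\<^sup>2 * (1 - \<eta>)"
    unfolding a_def e by (simp add: distrib_left add_divide_distrib flip: power_add)
  then have "k * (l * (a * x1\<^sup>2 + a * x2\<^sup>2) + L * (- b + - b)) = 8 * k / \<rho>\<^sup>2 * (l * (1 - \<eta>) - L * \<eta>)"
    unfolding b_def by (simp add: right_diff_distrib mult_ac diff_divide_distrib)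
  then show ?thesis using ge by simp
qed

text \<open>Touch \<open>u\<close> from below by the largest multiple \<open>k \<eta>\<^sup>2\<close> of the bump. At the contact point \<open>y\<close> the
  inequality forces \<open>\<eta> \<ge> l / (l + L)\<close>, so \<open>k\<close> and \<open>u y\<close> are comparable. For the three ranges of \<open>p\<close> the
  conclusion reads as a lower bound, an upper bound, or a contradiction in large balls.\<close>

lemma bump_bound:
  fixes u :: "real^2 \<Rightarrow> real"
  assumes l: "0 < l" "l \<le> L" and visc: "viscosity_supersolution (pucci_minus l L) (\<lambda>s. s powr p) \<Omega> u"
    and lsc: "lsc_on \<Omega> u" and pos: "\<And>z. z \<in> \<Omega> \<Longrightarrow> 0 < u z"
    and \<rho>: "\<rho> > 0" and sub: "cball z \<rho> \<subseteq> \<Omega>"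
  shows "\<exists>y\<in>ball z \<rho>. u y \<le> u z \<and> u y powr p \<le> 8 * L * ((l + L) / l)\<^sup>2 / \<rho>\<^sup>2 * u y"
proof -
  define \<eta> where "\<eta> y = 1 - (y - z) \<bullet> (y - z) / \<rho>\<^sup>2" for y
  define w where "w y = (\<eta> y)\<^sup>2" for y
  note C2 = bump_C2[OF \<rho>, of z, folded \<eta>_def, folded w_def]
  have \<eta>b: "\<eta> y \<le> 1" for y unfolding \<eta>_def by simp
  have \<eta>c: "0 \<le> \<eta> y" if "y \<in> cball z \<rho>" for y
  proof -
    have "(norm (y - z))\<^sup>2 \<le> \<rho>\<^sup>2" using that by (intro power_mono) (auto simp: dist_norm norm_minus_commute)
    then show ?thesis unfolding \<eta>_def power2_norm_eq_inner[symmetric] using \<rho> by simp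
  qed
  have w: "0 \<le> w y" "w y \<le> 1" if "y \<in> cball z \<rho>" for y
    using \<eta>b[of y] \<eta>c[OF that] by (auto simp: w_def power_le_one)
  have wz: "w z = 1" by (simp add: w_def \<eta>_def)
  have z: "z \<in> cball z \<rho>" using \<rho> by simp
  define S where "S = {k. 0 \<le> k \<and> (\<forall>y\<in>cball z \<rho>. k * w y \<le> u y)}"
  have S0: "0 \<in> S" unfolding S_def using pos sub by (auto simp: less_imp_le subset_iff)
  have Sb: "k \<le> u z" if "k \<in> S" for k using that z wz unfolding S_def by fastforce
  have bdd: "bdd_above S" using Sb by (meson bdd_aboveI)
  define k where "k = Sup S"
  have k0: "0 \<le> k" unfolding k_def using cSup_upper[OF S0 bdd] .
  have kS: "k * w y \<le> u y" if y: "y \<in> cball z \<rho>" for y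
  proof (cases "w y = 0")
    case True
    then show ?thesis using pos sub y by (simp add: less_imp_le subset_iff)
  next
    case False
    then have wy: "w y > 0" using w[OF y] by simp
    have "k \<le> u y / w y" unfolding k_def
      by (rule cSup_least) (use S0 y wy in \<open>auto simp: S_def pos_le_divide_eq\<close>)
    then show ?thesis using wy by (simp add: pos_le_divide_eq)
  qed
  then have kS': "k \<in> S" using k0 by (simp add: S_def)
  have cw: "continuous_on (cball z \<rho>) (\<lambda>y. k * w y)"
    using C2_on_continuous[OF C2_on_scaleR[OF C2_on_subset[OF C2]]] by blast
  obtain y0 where y0: "y0 \<in> cball z \<rho>" "\<And>y. y \<in> cball z \<rho> \<Longrightarrow> u y0 - k * w y0 \<le> u y - k * w y"
    using lsc_on_attains_inf[OF compact_cball _ lsc_on_diff[OF lsc_on_subset[OF lsc sub] cw]] z by blast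
  (* a positive gap would allow a larger multiple, because \<open>w \<le> 1\<close> *)
  have touch: "u y0 = k * w y0"
  proof (rule ccontr)
    assume "u y0 \<noteq> k * w y0"
    then have d: "u y0 - k * w y0 > 0" (is "?d > 0") using kS[OF y0(1)] by simp
    have "(k + ?d) * w y \<le> u y" if y: "y \<in> cball z \<rho>" for y
    proof -
      have "?d * w y \<le> ?d * 1" using w[OF y] d by (intro mult_left_mono) auto
      then show ?thesis using y0(2)[OF y] by (simp add: distrib_right)
    qed
    then have "k + ?d \<in> S" using k0 d by (simp add: S_def)
    then have "k + ?d \<le> k" unfolding k_def using cSup_upper[OF _ bdd] k_def by metis
    then show False using d by simp
  qed
  have u0: "u y0 > 0" using pos sub y0(1) by blast
  have k: "k > 0" using touch u0 w[OF y0(1)] k0 by (metis less_eq_real_def mult_zero_left)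
  have y0b: "y0 \<in> ball z \<rho>"
  proof (rule ccontr)
    assume "y0 \<notin> ball z \<rho>"
    then have "norm (y0 - z) = \<rho>" using y0(1) by (auto simp: dist_norm norm_minus_commute)
    then have "\<eta> y0 = 0" unfolding \<eta>_def power2_norm_eq_inner[symmetric] using \<rho> by simp
    then show False using touch u0 by (simp add: w_def)
  qed
  have "pucci_minus l L (k *\<^sub>R ((8 / \<rho>^4) *\<^sub>R (\<chi> i j. (y0 - z)$i * (y0 - z)$j) - (4 * \<eta> y0 / \<rho>\<^sup>2) *\<^sub>R mat 1)) + u y0 powr p \<le> 0"
    by (rule viscosityD[OF visc open_ball y0b _ C2_on_scaleR[OF C2_on_subset[OF C2]]])
       (use sub y0(2) in auto)
  moreover have "pucci_minus l L (k *\<^sub>R ((8 / \<rho>^4) *\<^sub>R (\<chi> i j. (y0 - z)$i * (y0 - z)$j) - (4 * \<eta> y0 / \<rho>\<^sup>2) *\<^sub>R mat 1))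
     \<ge> 8 * k / \<rho>\<^sup>2 * (l * (1 - \<eta> y0) - L * \<eta> y0)"
    unfolding \<eta>_def by (rule bump_pucci[OF l \<rho> k0]) (use \<eta>c[OF y0(1)] in \<open>simp add: \<eta>_def\<close>)
  ultimately have main: "u y0 powr p \<le> 8 * k / \<rho>\<^sup>2 * (L * \<eta> y0 - l * (1 - \<eta> y0))"
    by (simp add: right_diff_distrib)
  have up: "u y0 powr p > 0" using u0 by simp
  have K: "8 * k / \<rho>\<^sup>2 > 0" using k \<rho> by simp
  have "0 < 8 * k / \<rho>\<^sup>2 * (L * \<eta> y0 - l * (1 - \<eta> y0))" using main up by linarith
  then have "0 < L * \<eta> y0 - l * (1 - \<eta> y0)" using K zero_less_mult_pos by blast
  then have \<eta>0: "l \<le> (l + L) * \<eta> y0" by (simp add: algebra_simps)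
  then have "1 \<le> (l + L) / l * \<eta> y0" using l by (simp add: field_simps)
  then have "1 \<le> ((l + L) / l * \<eta> y0)\<^sup>2" by (simp add: one_le_power)
  then have "1 \<le> ((l + L) / l)\<^sup>2 * w y0" unfolding w_def power_mult_distrib .
  then have ku: "k \<le> ((l + L) / l)\<^sup>2 * u y0"
    using mult_left_mono[of 1 "((l + L) / l)\<^sup>2 * w y0" k] k0 unfolding touch by (simp add: mult_ac)
  have "L * \<eta> y0 - l * (1 - \<eta> y0) \<le> L"
  proof -
    have "L * \<eta> y0 \<le> L * 1" "0 \<le> l * (1 - \<eta> y0)" using \<eta>b[of y0] l by (auto intro: mult_left_mono)
    then show ?thesis by simp
  qed
  then have "u y0 powr p \<le> 8 * k / \<rho>\<^sup>2 * L" using main K by (smt (verit) mult_left_mono)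
  also have "\<dots> = (8 * L / \<rho>\<^sup>2) * k" by simp
  also have "\<dots> \<le> (8 * L / \<rho>\<^sup>2) * (((l + L) / l)\<^sup>2 * u y0)"
    using ku l by (intro mult_left_mono) auto
  also have "\<dots> = 8 * L * ((l + L) / l)\<^sup>2 / \<rho>\<^sup>2 * u y0" by simp
  finally have "u y0 powr p \<le> 8 * L * ((l + L) / l)\<^sup>2 / \<rho>\<^sup>2 * u y0" .
  moreover have "u y0 \<le> u z"
  proof -
    have "u y0 \<le> k * 1" unfolding touch using w[OF y0(1)] k0 by (intro mult_left_mono) auto
    then show ?thesis using Sb[OF kS'] by simp
  qed
  ultimately show ?thesis using y0b by blast
qed

section \<open>Correctors and slowly modulated powers\<close>

text \<open>A second derivative that is large compared with the function and its first derivative dominates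
  the whole differential expression.\<close>

lemma exists_large_curvature:
  assumes l: "0 < l" "l \<le> L"
  obtains K :: real where "K \<ge> 1"
    "\<And>M s s1. M \<ge> 1 \<Longrightarrow> \<bar>s\<bar> \<le> 2 * M \<Longrightarrow> \<bar>s1\<bar> \<le> K * M \<Longrightarrow>
       1 \<le> homog_pucci l L \<alpha> s s1 (K\<^sup>2 * M)"
proof -
  define C1 C2 where "C1 = \<bar>\<alpha> - 1\<bar>" and "C2 = \<bar>\<alpha> * (\<alpha> - 1)\<bar> + \<bar>\<alpha>\<bar>"
  have C: "C1 \<ge> 0" "C2 \<ge> 0" by (auto simp: C1_def C2_def)
  define R where "R = 1 + 2 * L * C1 + 2 * L * C2"
  have LC: "0 \<le> L * C1" "0 \<le> L * C2" using C l by auto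
  define K where "K = 1 + R / l"
  have R1: "R \<ge> 1" using LC by (simp add: R_def)
  have K1: "K \<ge> 1" using R1 l by (simp add: K_def)
  have lK: "l * K \<ge> R" using l by (simp add: K_def distrib_left)
  have "1 \<le> homog_pucci l L \<alpha> s s1 (K\<^sup>2 * M)"
    if M: "M \<ge> 1" and s: "\<bar>s\<bar> \<le> 2 * M" "\<bar>s1\<bar> \<le> K * M" for M s s1
  proof -
    have "pucci2 l L 0 0 (K\<^sup>2 * M) = l * (0 + K\<^sup>2 * M)" by (rule pucci2_psd[OF l]) (use M in auto)
    then have 1: "pucci2 l L 0 0 (K\<^sup>2 * M) = l * K\<^sup>2 * M" by simp
    have "\<bar>pucci2 l L (\<alpha> * (\<alpha> - 1) * s) ((\<alpha> - 1) * s1) (\<alpha> * s)\<bar>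
        \<le> L * (\<bar>\<alpha> * (\<alpha> - 1) * s\<bar> + 2 * \<bar>(\<alpha> - 1) * s1\<bar> + \<bar>\<alpha> * s\<bar>)"
      by (rule pucci2_abs_le[OF l])
    also have "\<bar>\<alpha> * (\<alpha> - 1) * s\<bar> + 2 * \<bar>(\<alpha> - 1) * s1\<bar> + \<bar>\<alpha> * s\<bar> = C2 * \<bar>s\<bar> + 2 * C1 * \<bar>s1\<bar>"
      unfolding C1_def C2_def abs_mult by (simp add: algebra_simps)
    also have "L * \<dots> \<le> L * (C2 * (2 * M) + 2 * C1 * (K * M))"
      using s C l by (intro mult_left_mono add_mono) auto
    finally have 2: "pucci2 l L (\<alpha> * (\<alpha> - 1) * s) ((\<alpha> - 1) * s1) (\<alpha> * s) \<ge> - (2 * L * C2 * M + 2 * L * C1 * K * M)"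
      by (simp add: algebra_simps)
    have "homog_pucci l L \<alpha> s s1 (K\<^sup>2 * M) \<ge> l * K\<^sup>2 * M - (2 * L * C2 * M + 2 * L * C1 * K * M)"
      using pucci2_superadd[OF l, of "\<alpha> * (\<alpha> - 1) * s" "(\<alpha> - 1) * s1" "\<alpha> * s" 0 0 "K\<^sup>2 * M"] 1 2 by simp
    moreover have "l * K\<^sup>2 * M - (2 * L * C2 * M + 2 * L * C1 * K * M) \<ge> 1"
    proof -
      have "R * (K * M) \<le> (l * K) * (K * M)" using lK K1 M by (intro mult_right_mono) auto
      moreover have "R * (K * M) = K * M + 2 * L * C1 * K * M + (2 * L * C2 * M) * K"
        unfolding R_def by algebra
      moreover have "(2 * L * C2 * M) * 1 \<le> (2 * L * C2 * M) * K" using K1 LC M l C by (intro mult_left_mono) auto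
      moreover have "1 \<le> K * M" using mult_mono[OF K1 M] K1 by simp
      moreover have "(l * K) * (K * M) = l * K\<^sup>2 * M" by algebra
      ultimately show ?thesis by linarith
    qed
    ultimately show ?thesis by linarith
  qed
  then show thesis using that K1 by blast
qed

lemma abs_sinh_le_cosh: "\<bar>sinh (x::real)\<bar> \<le> cosh x"
  by (simp add: sinh_def cosh_def abs_if field_simps add_pos_pos less_imp_le)

text \<open>Take \<open>\<sigma>(t) = cosh (K t) - cosh (K g) - 1\<close>. It is negative at \<open>\<plusminus> g\<close>, so that adding it to a profile
  moves the zeros inwards, and for large \<open>K\<close> it is strictly convex enough near the ends.\<close>

lemma profile_corrector:
  fixes l L g \<alpha> :: real
  assumes l: "0 < l" "l \<le> L" and g: "0 < g"
  obtains \<sigma> \<sigma>1 \<sigma>2 and \<theta>1 C :: real where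
    "\<And>t. (\<sigma> has_real_derivative \<sigma>1 t) (at t)" "\<And>t. (\<sigma>1 has_real_derivative \<sigma>2 t) (at t)"
    "continuous_on UNIV \<sigma>2" "\<sigma> g < 0" "\<sigma> (- g) < 0" "0 \<le> \<theta>1" "\<theta>1 < g" "0 \<le> C"
    "\<And>t. \<theta>1 \<le> \<bar>t\<bar> \<Longrightarrow> \<bar>t\<bar> \<le> g \<Longrightarrow> 1 \<le> homog_pucci l L \<alpha> (\<sigma> t) (\<sigma>1 t) (\<sigma>2 t)"
    "\<And>t. \<bar>t\<bar> \<le> g \<Longrightarrow> - C \<le> homog_pucci l L \<alpha> (\<sigma> t) (\<sigma>1 t) (\<sigma>2 t)"
proof -
  obtain K where K: "K \<ge> 1"
    "\<And>M s s1. M \<ge> 1 \<Longrightarrow> \<bar>s\<bar> \<le> 2 * M \<Longrightarrow> \<bar>s1\<bar> \<le> K * M \<Longrightarrow>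
       1 \<le> homog_pucci l L \<alpha> s s1 (K\<^sup>2 * M)"
    using exists_large_curvature[OF l, of \<alpha>] by blast
  define c where "c t = cosh (K * t)" for t
  define \<sigma> \<sigma>1 \<sigma>2 where "\<sigma> t = c t - c g - 1" and "\<sigma>1 t = K * sinh (K * t)" and "\<sigma>2 t = K\<^sup>2 * c t" for t
  have d1: "(\<sigma> has_real_derivative \<sigma>1 t) (at t)" for t
    unfolding \<sigma>_def \<sigma>1_def c_def by (auto intro!: derivative_eq_intros)
  have d2: "(\<sigma>1 has_real_derivative \<sigma>2 t) (at t)" for t
    unfolding \<sigma>2_def \<sigma>1_def c_def by (auto intro!: derivative_eq_intros simp: power2_eq_square)
  have cont_c: "continuous_on UNIV c" unfolding c_def by (intro continuous_intros)
  have c_abs: "c \<bar>t\<bar> = c t" for t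
    using cosh_real_abs[of "K * t"] K(1) by (simp add: c_def abs_mult)
  have c1: "c t \<ge> 1" for t unfolding c_def by (rule cosh_real_ge_1)
  have cmono: "c s \<le> c t" if "0 \<le> s" "s \<le> t" for s t
    unfolding c_def using that K(1) by (subst cosh_real_nonneg_le_iff) (auto intro: mult_left_mono)
  obtain d where d: "d > 0" "\<And>t. \<bar>t - g\<bar> < d \<Longrightarrow> \<bar>c t - c g\<bar> < c g / 2"
  proof -
    have "c g / 2 > 0" using c1[of g] by simp
    then have "\<exists>d>0. \<forall>t\<in>UNIV. dist t g < d \<longrightarrow> dist (c t) (c g) < c g / 2"
      using cont_c unfolding continuous_on_iff by blast
    then show thesis using that by (auto simp: dist_real_def)
  qed
  define \<theta>1 where "\<theta>1 = max 0 (g - d / 2)"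
  have \<theta>1: "0 \<le> \<theta>1" "\<theta>1 < g" "\<bar>\<theta>1 - g\<bar> < d" using d(1) g by (auto simp: \<theta>1_def)
  have cg: "c g < 2 * c \<theta>1" using d(2)[OF \<theta>1(3)] by (simp add: abs_if field_simps split: if_splits)
  have main: "1 \<le> homog_pucci l L \<alpha> (\<sigma> t) (\<sigma>1 t) (\<sigma>2 t)"
    if t: "\<theta>1 \<le> \<bar>t\<bar>" "\<bar>t\<bar> \<le> g" for t
    unfolding \<sigma>2_def
  proof (rule K(2)[OF c1])
    have "c \<theta>1 \<le> c t" "c t \<le> c g" using cmono[OF \<theta>1(1) t(1)] cmono[OF abs_ge_zero t(2)] c_abs by auto
    then show "\<bar>\<sigma> t\<bar> \<le> 2 * c t" unfolding \<sigma>_def using cg c1[of t] by (simp add: abs_if)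
    show "\<bar>\<sigma>1 t\<bar> \<le> K * c t" unfolding \<sigma>1_def c_def abs_mult using K(1) abs_sinh_le_cosh
      by (simp add: mult_left_mono)
  qed
  define F where "F t = L * (\<bar>\<alpha> * (\<alpha> - 1) * \<sigma> t\<bar> + 2 * \<bar>(\<alpha> - 1) * \<sigma>1 t\<bar> + \<bar>\<alpha> * \<sigma> t + \<sigma>2 t\<bar>)" for t
  have "continuous_on {-g..g} F"
    unfolding F_def \<sigma>_def \<sigma>1_def \<sigma>2_def c_def by (intro continuous_intros)
  then obtain m where m: "\<And>t. t \<in> {-g..g} \<Longrightarrow> F t \<le> F m"
    using continuous_attains_sup[of "{-g..g}" F] g by (auto simp: Ball_def)
  have "- \<bar>F m\<bar> \<le> homog_pucci l L \<alpha> (\<sigma> t) (\<sigma>1 t) (\<sigma>2 t)" if "\<bar>t\<bar> \<le> g" for t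
    using pucci2_abs_le[OF l, of "\<alpha> * (\<alpha> - 1) * \<sigma> t" "(\<alpha> - 1) * \<sigma>1 t" "\<alpha> * \<sigma> t + \<sigma>2 t"] m[of t] that
    unfolding F_def[symmetric] by (auto simp: abs_le_iff)
  moreover have "continuous_on UNIV \<sigma>2" unfolding \<sigma>2_def by (intro continuous_intros cont_c)
  moreover have "\<sigma> g < 0" "\<sigma> (- g) < 0" using c_abs[of g] c_abs[of "-g"] by (auto simp: \<sigma>_def)
  ultimately show thesis
    using that[of \<sigma> \<sigma>1 \<sigma>2 \<theta>1 "\<bar>F m\<bar>"] d1 d2 \<theta>1 main by auto
qed

text \<open>Effect of replacing \<open>r\<^sup>\<alpha>\<close> by a radial factor \<open>f(ln r)\<close> with \<open>f' = (\<alpha> + m1) f\<close> and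
  \<open>f'' = (\<alpha>\<^sup>2 + 2 \<alpha> m1 + m2) f\<close>: the loss involves only \<open>h\<close> and \<open>h1\<close>, not \<open>h2\<close>, and is linear in \<open>\<nu>\<close>.\<close>

lemma pucci2_slow_modulation:
  assumes l: "0 < l" "l \<le> L" and \<nu>: "\<bar>m1\<bar> \<le> \<nu>" "\<bar>m2\<bar> \<le> \<nu>"
    and M: "\<bar>h\<bar> \<le> M" "\<bar>h1\<bar> \<le> M"
  shows "homog_pucci l L \<alpha> h h1 h2 - L * (2 * \<bar>\<alpha>\<bar> + 5) * M * \<nu>
     \<le> pucci2 l L ((\<alpha> * (\<alpha> - 1) + 2 * \<alpha> * m1 + m2 - m1) * h) ((\<alpha> - 1 + m1) * h1) (h2 + (\<alpha> + m1) * h)"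
proof -
  have n0: "0 \<le> \<nu>" "0 \<le> M" using \<nu> M by auto
  have a: "\<bar>(2 * \<alpha> * m1 + m2 - m1) * h\<bar> \<le> ((2 * \<bar>\<alpha>\<bar> + 2) * \<nu>) * M"
    unfolding abs_mult
  proof (rule mult_mono)
    have "\<bar>2 * \<alpha> * m1\<bar> \<le> 2 * \<bar>\<alpha>\<bar> * \<nu>" using \<nu> by (simp add: abs_mult mult_left_mono)
    then show "\<bar>2 * \<alpha> * m1 + m2 - m1\<bar> \<le> (2 * \<bar>\<alpha>\<bar> + 2) * \<nu>" using \<nu> by (simp add: algebra_simps abs_le_iff)
  qed (use M n0 in auto)
  have b: "\<bar>m1 * h1\<bar> \<le> \<nu> * M" and c: "\<bar>m1 * h\<bar> \<le> \<nu> * M"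
    unfolding abs_mult using \<nu> M n0 by (auto intro: mult_mono)
  have "\<bar>pucci2 l L ((2 * \<alpha> * m1 + m2 - m1) * h) (m1 * h1) (m1 * h)\<bar>
     \<le> L * (\<bar>(2 * \<alpha> * m1 + m2 - m1) * h\<bar> + 2 * \<bar>m1 * h1\<bar> + \<bar>m1 * h\<bar>)"
    by (rule pucci2_abs_le[OF l])
  also have "\<dots> \<le> L * (((2 * \<bar>\<alpha>\<bar> + 2) * \<nu>) * M + 2 * (\<nu> * M) + \<nu> * M)"
    using a b c l by (intro mult_left_mono add_mono) auto
  also have "\<dots> = L * (2 * \<bar>\<alpha>\<bar> + 5) * M * \<nu>" by algebra
  finally have "- (L * (2 * \<bar>\<alpha>\<bar> + 5) * M * \<nu>) \<le> pucci2 l L ((2 * \<alpha> * m1 + m2 - m1) * h) (m1 * h1) (m1 * h)" by simp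
  moreover have "homog_pucci l L \<alpha> h h1 h2 + pucci2 l L ((2 * \<alpha> * m1 + m2 - m1) * h) (m1 * h1) (m1 * h)
     \<le> pucci2 l L ((\<alpha> * (\<alpha> - 1) + 2 * \<alpha> * m1 + m2 - m1) * h) ((\<alpha> - 1 + m1) * h1) (h2 + (\<alpha> + m1) * h)"
  proof -
    have e: "\<alpha> * (\<alpha> - 1) * h + (2 * \<alpha> * m1 + m2 - m1) * h = (\<alpha> * (\<alpha> - 1) + 2 * \<alpha> * m1 + m2 - m1) * h"
      "(\<alpha> - 1) * h1 + m1 * h1 = (\<alpha> - 1 + m1) * h1" "\<alpha> * h + h2 + m1 * h = h2 + (\<alpha> + m1) * h" by algebra+
    show ?thesis using pucci2_superadd[OF l, of "\<alpha> * (\<alpha> - 1) * h" "(\<alpha> - 1) * h1" "\<alpha> * h + h2" "(2 * \<alpha> * m1 + m2 - m1) * h" "m1 * h1" "m1 * h"]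
      unfolding e .
  qed
  ultimately show ?thesis by linarith
qed

text \<open>As a function of \<open>t = ln r\<close> this is \<open>A r\<^sup>\<alpha>\<close> with a cut-off that is slow (rate \<open>\<nu>\<close>) and still
  infinitely small against \<open>r\<^sup>\<alpha>\<close> at both ends, which is where comparison needs an inequality.\<close>

definition hump :: "real \<Rightarrow> real \<Rightarrow> real \<Rightarrow> real \<Rightarrow> real \<Rightarrow> real" where
  "hump A \<alpha> \<nu> T t = A * exp (\<alpha> * t) / cosh (\<nu> * (t - T))"

lemma hump_derivs:
  fixes A \<alpha> \<nu> T :: real
  assumes \<nu>: "0 \<le> \<nu>" "\<nu> \<le> 1"
  obtains m1 m2 where
    "\<And>t. (hump A \<alpha> \<nu> T has_real_derivative (\<alpha> + m1 t) * hump A \<alpha> \<nu> T t) (at t)"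
    "\<And>t. ((\<lambda>t. (\<alpha> + m1 t) * hump A \<alpha> \<nu> T t) has_real_derivative (\<alpha>\<^sup>2 + 2 * \<alpha> * m1 t + m2 t) * hump A \<alpha> \<nu> T t) (at t)"
    "continuous_on UNIV (\<lambda>t. (\<alpha>\<^sup>2 + 2 * \<alpha> * m1 t + m2 t) * hump A \<alpha> \<nu> T t)"
    "\<And>t. \<bar>m1 t\<bar> \<le> \<nu>" "\<And>t. \<bar>m2 t\<bar> \<le> \<nu>"
proof -
  define th where "th t = tanh (\<nu> * (t - T))" for t
  define m1 m2 where "m1 t = - \<nu> * th t" and "m2 t = \<nu>\<^sup>2 * (2 * (th t)\<^sup>2 - 1)" for t
  have th1: "\<bar>th t\<bar> \<le> 1" for t
    unfolding th_def using tanh_real_bounds[of "\<nu> * (t - T)"] by auto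
  have dth: "(th has_real_derivative (1 - (th t)\<^sup>2) * \<nu>) (at t)" for t
    unfolding th_def by (auto intro!: derivative_eq_intros simp: cosh_real_pos[THEN less_imp_neq, symmetric])
  have dh: "(hump A \<alpha> \<nu> T has_real_derivative (\<alpha> + m1 t) * hump A \<alpha> \<nu> T t) (at t)" for t
  proof -
    have c: "cosh (\<nu> * (t - T)) > 0" by (rule cosh_real_pos)
    have dn: "((\<lambda>t. A * exp (\<alpha> * t)) has_real_derivative A * (exp (\<alpha> * t) * \<alpha>)) (at t)"
      by (auto intro!: derivative_eq_intros)
    have dd: "((\<lambda>t. cosh (\<nu> * (t - T))) has_real_derivative sinh (\<nu> * (t - T)) * \<nu>) (at t)"
      by (auto intro!: derivative_eq_intros)
    have "((\<lambda>t. A * exp (\<alpha> * t) / cosh (\<nu> * (t - T))) has_real_derivative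
       ((A * (exp (\<alpha> * t) * \<alpha>)) * cosh (\<nu> * (t - T)) - A * exp (\<alpha> * t) * (sinh (\<nu> * (t - T)) * \<nu>)) / (cosh (\<nu> * (t - T)) * cosh (\<nu> * (t - T)))) (at t)"
      by (rule DERIV_divide[OF dn dd]) (use c in simp)
    moreover have "((X * \<alpha>) * c - X * (s * \<nu>)) / (c * c) = (\<alpha> + - \<nu> * (s / c)) * (X / c)" if "c > 0" for X c s :: real
      using that by (simp add: field_simps)
    from this[OF c, of "A * exp (\<alpha> * t)" "sinh (\<nu> * (t - T))"]
    have "((A * (exp (\<alpha> * t) * \<alpha>)) * cosh (\<nu> * (t - T)) - A * exp (\<alpha> * t) * (sinh (\<nu> * (t - T)) * \<nu>)) / (cosh (\<nu> * (t - T)) * cosh (\<nu> * (t - T)))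
       = (\<alpha> + m1 t) * hump A \<alpha> \<nu> T t"
      unfolding m1_def th_def tanh_def hump_def by (simp add: mult.assoc)
    ultimately show ?thesis unfolding hump_def[abs_def] by simp
  qed
  have d2: "((\<lambda>t. (\<alpha> + m1 t) * hump A \<alpha> \<nu> T t) has_real_derivative (\<alpha>\<^sup>2 + 2 * \<alpha> * m1 t + m2 t) * hump A \<alpha> \<nu> T t) (at t)" for t
  proof -
    have "((\<lambda>t. \<alpha> + m1 t) has_real_derivative (0 + - \<nu> * ((1 - (th t)\<^sup>2) * \<nu>))) (at t)"
      unfolding m1_def by (intro DERIV_add DERIV_const DERIV_cmult dth)
    from DERIV_mult[OF this dh]
    have "((\<lambda>t. (\<alpha> + m1 t) * hump A \<alpha> \<nu> T t) has_real_derivative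
       (0 + - \<nu> * ((1 - (th t)\<^sup>2) * \<nu>)) * hump A \<alpha> \<nu> T t + (\<alpha> + m1 t) * hump A \<alpha> \<nu> T t * (\<alpha> + m1 t)) (at t)" .
    moreover have "(0 + - \<nu> * ((1 - (th t)\<^sup>2) * \<nu>)) * hump A \<alpha> \<nu> T t + (\<alpha> + m1 t) * hump A \<alpha> \<nu> T t * (\<alpha> + m1 t)
      = (\<alpha>\<^sup>2 + 2 * \<alpha> * m1 t + m2 t) * hump A \<alpha> \<nu> T t" unfolding m1_def m2_def by algebra
    ultimately show ?thesis by simp
  qed
  have cth: "continuous_on UNIV th"
    by (rule continuous_at_imp_continuous_on) (use dth DERIV_isCont in blast)
  have ch: "continuous_on UNIV (hump A \<alpha> \<nu> T)"
    by (rule continuous_at_imp_continuous_on) (use dh DERIV_isCont in blast)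
  have "continuous_on UNIV (\<lambda>t. (\<alpha>\<^sup>2 + 2 * \<alpha> * m1 t + m2 t) * hump A \<alpha> \<nu> T t)"
    unfolding m1_def m2_def by (intro continuous_intros cth ch)
  moreover have "\<bar>m1 t\<bar> \<le> \<nu>" for t
    using mult_left_mono[OF th1[of t] \<nu>(1)] \<nu> by (simp add: m1_def abs_mult)
  moreover have "\<bar>m2 t\<bar> \<le> \<nu>" for t
  proof -
    have "(th t)\<^sup>2 \<le> 1" using th1[of t] by (simp add: abs_square_le_1)
    then have b: "\<bar>2 * (th t)\<^sup>2 - 1\<bar> \<le> 1" by (simp add: abs_le_iff)
    have "\<bar>m2 t\<bar> \<le> \<nu>\<^sup>2 * 1" unfolding m2_def abs_mult using mult_left_mono[OF b, of "\<nu>\<^sup>2"] by simp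
    also have "\<dots> \<le> \<nu>" using \<nu> by (simp add: power2_eq_square mult_left_le_one_le)
    finally show ?thesis .
  qed
  ultimately show thesis using that dh d2 by blast
qed

section \<open>The lower bound by modulated homogeneous solutions\<close>

lemma angular_profileD:
  assumes "angular_profile l L \<alpha> g g' \<phi> \<phi>1 \<phi>2"
  shows "0 < g" "g < g'"
    "\<And>t. t \<in> {-g'<..<g'} \<Longrightarrow> (\<phi> has_real_derivative \<phi>1 t) (at t)"
    "\<And>t. t \<in> {-g'<..<g'} \<Longrightarrow> (\<phi>1 has_real_derivative \<phi>2 t) (at t)"
    "\<And>t. t \<in> {-g'<..<g'} \<Longrightarrow> homog_pucci l L \<alpha> (\<phi> t) (\<phi>1 t) (\<phi>2 t) = 0"
    "continuous_on {-g'<..<g'} \<phi>2" "\<And>t. t \<in> {-g<..<g} \<Longrightarrow> 0 < \<phi> t" "\<phi> g = 0" "\<phi> (-g) = 0"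
  using assms unfolding angular_profile_def by blast+

lemma DERIV_imp_continuous_on:
  "(\<And>t. t \<in> S \<Longrightarrow> (f has_real_derivative f' t) (at t)) \<Longrightarrow> continuous_on S f"
  by (rule continuous_at_imp_continuous_on) (blast intro: DERIV_isCont)

lemma bounded_pair_on_interval:
  fixes f f1 :: "real \<Rightarrow> real"
  assumes "continuous_on {-g..g} f" "continuous_on {-g..g} f1"
  obtains M where "M > 0" "\<And>t. \<bar>t\<bar> \<le> g \<Longrightarrow> \<bar>f t\<bar> \<le> M" "\<And>t. \<bar>t\<bar> \<le> g \<Longrightarrow> \<bar>f1 t\<bar> \<le> M"
proof -
  have "compact (f ` {-g..g})" "compact (f1 ` {-g..g})"
    using assms compact_continuous_image compact_Icc by blast+
  then have "bounded (f ` {-g..g})" "bounded (f1 ` {-g..g})" by (auto intro: compact_imp_bounded)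
  then obtain a b where ab: "\<forall>x\<in>f ` {-g..g}. norm x \<le> a" "\<forall>x\<in>f1 ` {-g..g}. norm x \<le> b"
    unfolding bounded_iff by blast
  have "\<bar>f t\<bar> \<le> \<bar>a\<bar> + \<bar>b\<bar> + 1 \<and> \<bar>f1 t\<bar> \<le> \<bar>a\<bar> + \<bar>b\<bar> + 1" if "\<bar>t\<bar> \<le> g" for t
  proof -
    have "t \<in> {-g..g}" using that by auto
    then have "norm (f t) \<le> a" "norm (f1 t) \<le> b" using ab by blast+
    then show ?thesis unfolding real_norm_def by linarith
  qed
  then show thesis using that[of "\<bar>a\<bar> + \<bar>b\<bar> + 1"] by force
qed

lemma negative_near_ends:
  fixes h :: "real \<Rightarrow> real"
  assumes "continuous_on {-g..g} h" "h g < 0" "h (-g) < 0" "0 < g"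
  obtains \<theta> where "0 < \<theta>" "\<theta> < g" "\<And>t. \<theta> \<le> \<bar>t\<bar> \<Longrightarrow> \<bar>t\<bar> \<le> g \<Longrightarrow> h t < 0"
proof -
  have "\<exists>d>0. \<forall>t\<in>{-g..g}. dist t g < d \<longrightarrow> dist (h t) (h g) < - h g"
    "\<exists>d>0. \<forall>t\<in>{-g..g}. dist t (-g) < d \<longrightarrow> dist (h t) (h (-g)) < - h (-g)"
    using assms unfolding continuous_on_iff by auto
  then obtain d1 d2 where d: "d1 > 0" "d2 > 0"
    "\<And>t. t \<in> {-g..g} \<Longrightarrow> dist t g < d1 \<Longrightarrow> dist (h t) (h g) < - h g"
    "\<And>t. t \<in> {-g..g} \<Longrightarrow> dist t (-g) < d2 \<Longrightarrow> dist (h t) (h (-g)) < - h (-g)" by metis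
  define \<theta> where "\<theta> = max (g / 2) (g - min d1 d2 / 2)"
  have \<theta>: "0 < \<theta>" "\<theta> < g" using d assms(4) by (auto simp: \<theta>_def)
  have "h t < 0" if t: "\<theta> \<le> \<bar>t\<bar>" "\<bar>t\<bar> \<le> g" and tI: "t \<in> {-g..g}" for t
  proof (cases "0 \<le> t")
    case True
    have "g - t < d1" using t True d unfolding \<theta>_def by (auto simp: min_def split: if_splits)
    then have "dist t g < d1" using t by (simp add: dist_real_def)
    then have "dist (h t) (h g) < - h g" using d(3)[OF tI] by blast
    then show ?thesis by (simp add: dist_real_def abs_if split: if_splits)
  next
    case False
    have "g + t < d2" using t False d unfolding \<theta>_def by (auto simp: min_def split: if_splits)
    then have "dist t (-g) < d2" using t by (simp add: dist_real_def)
    then have "dist (h t) (h (-g)) < - h (-g)" using d(4)[OF tI] by blast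
    then show ?thesis by (simp add: dist_real_def abs_if split: if_splits)
  qed
  moreover have "t \<in> {-g..g}" if "\<bar>t\<bar> \<le> g" for t using that by auto
  ultimately show thesis using that \<theta> by blast
qed

lemma cosh_scaled_large:
  assumes "\<nu> > 0"
  shows "\<exists>t\<ge>b. (B::real) \<le> cosh (\<nu> * (t - T))" "\<exists>t\<le>b. B \<le> cosh (\<nu> * (t - T))"
proof -
  have up: "\<exists>t\<ge>b. B \<le> cosh (\<nu> * (t - T))" for b T
  proof -
    have "filterlim (\<lambda>t::real. \<nu> * (t - T)) at_top at_top"
      by (rule filterlim_tendsto_pos_mult_at_top[OF tendsto_const assms])
         (use filterlim_tendsto_add_at_top[OF tendsto_const[of "-T"] filterlim_ident] in simp)
    then have "filterlim (\<lambda>t. cosh (\<nu> * (t - T))) at_top (at_top :: real filter)"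
      by (rule filterlim_compose[OF cosh_real_at_top])
    then have "eventually (\<lambda>t. B \<le> cosh (\<nu> * (t - T))) at_top" by (simp add: filterlim_at_top)
    then have "eventually (\<lambda>t. b \<le> t \<and> B \<le> cosh (\<nu> * (t - T))) at_top"
      using eventually_ge_at_top by (rule eventually_conj[rotated])
    then show ?thesis using eventually_happens by fastforce
  qed
  then show "\<exists>t\<ge>b. B \<le> cosh (\<nu> * (t - T))" .
  obtain t where t: "t \<ge> - b" "B \<le> cosh (\<nu> * (t - (- T)))" using up[of "- b" "- T"] by blast
  have e: "\<nu> * (- t - T) = - (\<nu> * (t - (- T)))" by (simp add: algebra_simps)
  have "B \<le> cosh (\<nu> * (- t - T))" unfolding e cosh_minus by (rule t(2))
  then show "\<exists>t\<le>b. B \<le> cosh (\<nu> * (t - T))" using t(1) by (intro exI[of _ "- t"]) simp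
qed

text \<open>The amplification step. \<open>lower\<close> may hold with any constant, however small and depending on the
  sector; the conclusion has an arbitrary \<open>A\<close>. The order of the choices matters: \<open>A\<close> and the source
  constant \<open>s\<close> in the sector outside which the corrector helps come first, then \<open>\<epsilon>\<close>, then \<open>\<nu>\<close>, and only
  then the sector \<open>\<theta>\<close> that contains the zeros of the corrected profile, whose constant \<open>c\<close> decides how
  far the cut-off has to reach. On the smaller cone that contains the positive part of the barrier
  the solution is bounded below by \<open>c r\<^sup>\<alpha>\<close>, so the comparison also works if \<open>u\<close> vanishes at the
  lateral boundary.\<close>

lemma hump_lower_bound:
  fixes u :: "real^2 \<Rightarrow> real"
  assumes l: "0 < l" "l \<le> L" and prof: "angular_profile l L \<alpha> g g' \<phi> \<phi>1 \<phi>2" and g\<pi>: "g < pi"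
    and visc: "viscosity_supersolution (pucci_minus l L) (\<lambda>s. s powr p) (cone_C g) u"
    and lsc: "lsc_on (cone_C g) u" and pos: "\<And>z. z \<in> cone_C g \<Longrightarrow> 0 < u z"
    and lower: "\<And>\<theta>. 0 \<le> \<theta> \<Longrightarrow> \<theta> < g \<Longrightarrow> \<exists>c>0. \<forall>z\<in>sector \<theta>. z \<noteq> 0 \<longrightarrow> a \<le> norm z \<longrightarrow> c * norm z powr \<alpha> \<le> u z"
    and source: "\<And>A \<theta>. A > 0 \<Longrightarrow> 0 \<le> \<theta> \<Longrightarrow> \<theta> < g \<Longrightarrow> \<exists>s>0. \<forall>z\<in>sector \<theta>. z \<noteq> 0 \<longrightarrow> a \<le> norm z \<longrightarrow>
       u z < A * norm z powr \<alpha> \<longrightarrow> s * norm z powr (\<alpha> - 2) \<le> u z powr p"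
    and A: "A > 0" and e: "e > 0"
  shows "\<exists>\<nu>>0. \<nu> \<le> 1 \<and> (\<exists>B. \<forall>T a1. 0 < a1 \<longrightarrow> a \<le> a1 \<longrightarrow> B \<le> cosh (\<nu> * (ln a1 - T)) \<longrightarrow>
     (\<forall>z\<in>cone_C g. a1 \<le> norm z \<longrightarrow> hump A \<alpha> \<nu> T (ln (norm z)) * (\<phi> (ang z) - e) \<le> u z))"
proof -
  note P = angular_profileD[OF prof]
  obtain \<sigma> \<sigma>1 \<sigma>2 \<theta>1 C where \<sigma>:
    "\<And>t. (\<sigma> has_real_derivative \<sigma>1 t) (at t)" "\<And>t. (\<sigma>1 has_real_derivative \<sigma>2 t) (at t)"
    "continuous_on UNIV \<sigma>2" "\<sigma> g < 0" "\<sigma> (- g) < 0" and \<theta>1: "0 \<le> \<theta>1" "\<theta>1 < g" and C: "0 \<le> C"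
    and \<sigma>out: "\<And>t. \<theta>1 \<le> \<bar>t\<bar> \<Longrightarrow> \<bar>t\<bar> \<le> g \<Longrightarrow> 1 \<le> homog_pucci l L \<alpha> (\<sigma> t) (\<sigma>1 t) (\<sigma>2 t)"
    and \<sigma>in: "\<And>t. \<bar>t\<bar> \<le> g \<Longrightarrow> - C \<le> homog_pucci l L \<alpha> (\<sigma> t) (\<sigma>1 t) (\<sigma>2 t)"
    using profile_corrector[OF l P(1), of \<alpha>] by blast
  have sub: "{-g..g} \<subseteq> {-g'<..<g'}" using P(1,2) by auto
  have c\<phi>: "continuous_on {-g..g} \<phi>" "continuous_on {-g..g} \<phi>1"
    by (rule DERIV_imp_continuous_on, rule P(3), use sub in blast)
       (rule DERIV_imp_continuous_on, rule P(4), use sub in blast)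
  have c\<sigma>: "continuous_on {-g..g} \<sigma>" "continuous_on {-g..g} \<sigma>1"
    by (rule DERIV_imp_continuous_on, rule \<sigma>(1,2))+
  obtain M0 where M0: "M0 > 0" "\<And>t. \<bar>t\<bar> \<le> g \<Longrightarrow> \<bar>\<phi> t\<bar> \<le> M0" "\<And>t. \<bar>t\<bar> \<le> g \<Longrightarrow> \<bar>\<phi>1 t\<bar> \<le> M0"
    using bounded_pair_on_interval[OF c\<phi>] by blast
  obtain M1 where M1: "M1 > 0" "\<And>t. \<bar>t\<bar> \<le> g \<Longrightarrow> \<bar>\<sigma> t\<bar> \<le> M1" "\<And>t. \<bar>t\<bar> \<le> g \<Longrightarrow> \<bar>\<sigma>1 t\<bar> \<le> M1"
    using bounded_pair_on_interval[OF c\<sigma>] by blast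
  define M where "M = M0 + M1"
  have M: "M > 0" using M0 M1 by (simp add: M_def)
  have AM: "A * M > 0" using A M by simp
  obtain s where s: "s > 0" "\<And>z. z \<in> sector \<theta>1 \<Longrightarrow> z \<noteq> 0 \<Longrightarrow> a \<le> norm z \<Longrightarrow>
       u z < A * M * norm z powr \<alpha> \<Longrightarrow> s * norm z powr (\<alpha> - 2) \<le> u z powr p"
    using source[OF AM \<theta>1] by blast
  (* small against \<open>e\<close>, and such that \<open>A\<close> times the loss \<open>\<epsilon> (C + 1)\<close> in the middle is at most half of the source *)
  define \<epsilon> where "\<epsilon> = min 1 (min (e / M1) (s / (2 * A * (C + 1))))"
  have \<epsilon>: "0 < \<epsilon>" "\<epsilon> \<le> 1" using e M1 s A C by (auto simp: \<epsilon>_def)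
  have \<epsilon>e: "\<epsilon> * M1 \<le> e"
  proof -
    have "\<epsilon> \<le> e / M1" by (simp add: \<epsilon>_def)
    then show ?thesis using M1(1) by (simp add: pos_le_divide_eq)
  qed
  have \<epsilon>s: "2 * (A * (\<epsilon> * (C + 1))) \<le> s"
  proof -
    have "\<epsilon> \<le> s / (2 * A * (C + 1))" by (simp add: \<epsilon>_def)
    then have "\<epsilon> * (2 * A * (C + 1)) \<le> s" using A C by (subst (asm) pos_le_divide_eq) auto
    then show ?thesis by (simp add: mult_ac)
  qed
  define Q where "Q = L * (2 * \<bar>\<alpha>\<bar> + 5) * M"
  have Q: "Q > 0" using l M by (simp add: Q_def add_nonneg_pos)
  (* the modulation then costs at most half of the gain \<open>\<epsilon>\<close> near the lateral boundary *)
  define \<nu> where "\<nu> = min 1 (\<epsilon> / (2 * Q))"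
  have \<nu>: "0 < \<nu>" "\<nu> \<le> 1" using \<epsilon> Q by (auto simp: \<nu>_def)
  have Q\<nu>: "2 * (Q * \<nu>) \<le> \<epsilon>"
  proof -
    have "\<nu> \<le> \<epsilon> / (2 * Q)" by (simp add: \<nu>_def)
    then have "\<nu> * (2 * Q) \<le> \<epsilon>" using Q by (subst (asm) pos_le_divide_eq) auto
    then show ?thesis by (simp add: mult_ac)
  qed
  define h h1 h2 where "h t = \<phi> t + \<epsilon> * \<sigma> t" and "h1 t = \<phi>1 t + \<epsilon> * \<sigma>1 t" and "h2 t = \<phi>2 t + \<epsilon> * \<sigma>2 t" for t
  have dh: "(h has_real_derivative h1 t) (at t)" "(h1 has_real_derivative h2 t) (at t)" if "t \<in> {-g'<..<g'}" for t
    unfolding h_def h1_def h2_def using P(3,4)[OF that] \<sigma>(1,2) by (auto intro!: DERIV_add DERIV_cmult)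
  have ch2: "continuous_on {-g'<..<g'} h2"
    unfolding h2_def using P(6) continuous_on_subset[OF \<sigma>(3)] by (auto intro!: continuous_intros)
  have hM: "\<bar>h t\<bar> \<le> M" "\<bar>h1 t\<bar> \<le> M" if "\<bar>t\<bar> \<le> g" for t
  proof -
    have "\<bar>\<epsilon> * x\<bar> \<le> M1" if "\<bar>x\<bar> \<le> M1" for x
      using mult_mono[of \<epsilon> 1 "\<bar>x\<bar>" M1] \<epsilon> that by (simp add: abs_mult)
    then have "\<bar>\<epsilon> * \<sigma> t\<bar> \<le> M1" "\<bar>\<epsilon> * \<sigma>1 t\<bar> \<le> M1" using M1 that by auto
    then show "\<bar>h t\<bar> \<le> M" "\<bar>h1 t\<bar> \<le> M" unfolding h_def h1_def M_def
      using M0(2,3)[OF that] by linarith+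
  qed
  have hg: "h g < 0" "h (-g) < 0" unfolding h_def using P(8,9) \<sigma>(4,5) \<epsilon> by (auto simp: mult_pos_neg)
  have ch: "continuous_on {-g..g} h" unfolding h_def by (intro continuous_intros c\<phi> c\<sigma>)
  obtain \<theta> where \<theta>: "0 < \<theta>" "\<theta> < g" "\<And>t. \<theta> \<le> \<bar>t\<bar> \<Longrightarrow> \<bar>t\<bar> \<le> g \<Longrightarrow> h t < 0"
    using negative_near_ends[OF ch hg P(1)] by blast
  obtain c where c: "c > 0" "\<And>z. z \<in> sector \<theta> \<Longrightarrow> z \<noteq> 0 \<Longrightarrow> a \<le> norm z \<Longrightarrow> c * norm z powr \<alpha> \<le> u z"
    using lower[of \<theta>] \<theta> by auto
  (* where the cut-off has fallen to \<open>1 / B\<close>, the barrier is below the initial bound \<open>c r\<^sup>\<alpha>\<close> *)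
  define B where "B = A * M / c"
  show ?thesis
  proof (rule exI[of _ \<nu>], intro conjI \<nu>, rule exI[of _ B], intro allI impI ballI)
    fix T a1 z
    assume a1: "0 < a1" "a \<le> a1" and B: "B \<le> cosh (\<nu> * (ln a1 - T))" and z: "z \<in> cone_C g" "a1 \<le> norm z"
    define f where "f = hump A \<alpha> \<nu> T"
    obtain m1 m2 where df:
      "\<And>t. (f has_real_derivative (\<alpha> + m1 t) * f t) (at t)"
      "\<And>t. ((\<lambda>t. (\<alpha> + m1 t) * f t) has_real_derivative (\<alpha>\<^sup>2 + 2 * \<alpha> * m1 t + m2 t) * f t) (at t)"
      "continuous_on UNIV (\<lambda>t. (\<alpha>\<^sup>2 + 2 * \<alpha> * m1 t + m2 t) * f t)"
      and m: "\<And>t. \<bar>m1 t\<bar> \<le> \<nu>" "\<And>t. \<bar>m2 t\<bar> \<le> \<nu>"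
      using hump_derivs[OF less_imp_le[OF \<nu>(1)] \<nu>(2), of A \<alpha> T, folded f_def] by blast
    have fpos: "f t > 0" for t unfolding f_def hump_def using A cosh_real_pos by auto
    have fpow: "f (ln (norm y)) = A * norm y powr \<alpha> / cosh (\<nu> * (ln (norm y) - T))" if "y \<noteq> 0" for y :: "real^2"
      using that unfolding f_def hump_def by (simp add: powr_def)
    have fle: "f (ln (norm y)) \<le> A * norm y powr \<alpha>" if "y \<noteq> 0" for y :: "real^2"
    proof -
      have "A * norm y powr \<alpha> / cosh (\<nu> * (ln (norm y) - T)) \<le> A * norm y powr \<alpha> / 1"
        by (rule divide_left_mono) (use A cosh_real_ge_1 in auto)
      then show ?thesis unfolding fpow[OF that] by simp
    qed
    obtain t1 where t1: "ln (norm z) \<le> t1" "B \<le> cosh (\<nu> * (t1 - T))"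
      using cosh_scaled_large(1)[OF \<nu>(1)] by blast
    define R where "R = exp t1"
    have znz: "z \<noteq> 0" using z a1 by auto
    have "exp (ln (norm z)) \<le> exp t1" using t1(1) by simp
    then have R: "norm z \<le> R" "B \<le> cosh (\<nu> * (ln R - T))"
      using t1(2) znz by (simp_all add: R_def)
    define w where "w y = f (ln (norm y)) * h (ang y)" for y
    define V where "V = {y \<in> slit. \<bar>ang y\<bar> < g'}"
    define H where "H y = polar_matrix (((\<alpha>\<^sup>2 + 2 * \<alpha> * m1 (ln (norm y)) + m2 (ln (norm y))) * f (ln (norm y)) - (\<alpha> + m1 (ln (norm y))) * f (ln (norm y))) * h (ang y))
       (((\<alpha> + m1 (ln (norm y))) * f (ln (norm y)) - f (ln (norm y))) * h1 (ang y))
        (f (ln (norm y)) * h2 (ang y) + (\<alpha> + m1 (ln (norm y))) * f (ln (norm y)) * h (ang y)) y" for y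
    have CV: "\<exists>G. C2_on V w G H"
      unfolding w_def[abs_def] H_def[abs_def]
      by (rule exI, rule C2_on_separated_polar[OF df dh ch2]) (auto simp: V_def abs_less_iff)
    then obtain G where CV: "C2_on V w G H" by blast
    define K U where "K = {y \<in> sector \<theta>. a1 \<le> norm y \<and> norm y \<le> R}"
      and "U = {y \<in> cone_C \<theta>. a1 < norm y \<and> norm y < R}"
    have Kang: "y \<noteq> 0 \<and> y \<in> slit \<and> \<bar>ang y\<bar> \<le> \<theta>" if "y \<in> K" for y
      using that a1 sector_ang[of \<theta> y] \<theta> g\<pi> by (auto simp: K_def)
    have KV: "K \<subseteq> V" using Kang \<theta> P(2) unfolding V_def by force
    have UK: "U \<subseteq> K" unfolding U_def K_def using cone_subset_sector by auto
    have Kcone: "K \<subseteq> cone_C g" using Kang \<theta> g\<pi> cone_ang[of g] P(1) by force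
    have comp: "w y \<le> u y" if yK: "y \<in> K" for y
    proof (rule viscosity_compare[OF visc lsc _ UK Kcone _ _ C2_on_subset[OF CV] _ _ yK])
      show "open U" unfolding U_def by (rule open_annular_cone)
      show "compact K" unfolding K_def by (rule compact_annular_sector)
      show "continuous_on K w" using C2_on_continuous[OF CV] KV continuous_on_subset by blast
      show "U \<subseteq> V" using UK KV by blast
    next
      fix y assume y: "y \<in> K" "y \<notin> U"
      note yK = Kang[OF y(1)]
      have upos: "u y > 0" using pos Kcone y(1) by blast
      have yR: "a1 \<le> norm y" "norm y \<le> R" "y \<in> sector \<theta>" using y(1) by (auto simp: K_def)
      show "w y \<le> u y"
      proof (cases "y \<in> cone_C \<theta>")
        case False
        then have "\<not> \<bar>ang y\<bar> < \<theta>" using yK cone_ang[of \<theta> y] \<theta> g\<pi> by auto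
        then have "h (ang y) < 0" using \<theta>(2) yK by (intro \<theta>(3)) auto
        then have "w y < 0" unfolding w_def using fpos by (simp add: mult_pos_neg)
        then show ?thesis using upos by simp
      next
        case True
        then have "norm y = a1 \<or> norm y = R" using y yR unfolding U_def by auto
        then have Bc: "B \<le> cosh (\<nu> * (ln (norm y) - T))" using B R(2) by auto
        have n: "norm y powr \<alpha> > 0" using yK by simp
        have ch: "cosh (\<nu> * (ln (norm y) - T)) > 0" by (rule cosh_real_pos)
        have "w y \<le> f (ln (norm y)) * M"
          unfolding w_def using hM(1)[of "ang y"] yK \<theta>(2) fpos[of "ln (norm y)"] by (intro mult_left_mono) auto
        also have "\<dots> = (A * M) * norm y powr \<alpha> / cosh (\<nu> * (ln (norm y) - T))"
          using fpow yK by simp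
        also have "A * M = c * B" using c by (simp add: B_def)
        also have "c * B * norm y powr \<alpha> / cosh (\<nu> * (ln (norm y) - T)) \<le> c * norm y powr \<alpha>"
        proof -
          have "c * B * norm y powr \<alpha> \<le> c * cosh (\<nu> * (ln (norm y) - T)) * norm y powr \<alpha>"
            using Bc c n by (intro mult_right_mono mult_left_mono) auto
          then show ?thesis using ch by (simp add: pos_divide_le_eq mult_ac)
        qed
        also have "\<dots> \<le> u y" using c(2)[OF yR(3)] yK yR(1) a1 by simp
        finally show ?thesis .
      qed
    next
      fix y assume y: "y \<in> U" and uw: "u y < w y"
      then have yKK: "y \<in> K" using UK by blast
      note yK = Kang[OF yKK]
      have upos: "u y > 0" using pos Kcone yKK by blast
      have ya: "a \<le> norm y" using yKK a1 by (auto simp: K_def)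
      define t where "t = ang y"
      define F where "F = f (ln (norm y))"
      have F: "F > 0" unfolding F_def by (rule fpos)
      have t: "\<bar>t\<bar> \<le> g" "t \<in> {-g'<..<g'}" using yK \<theta>(2) P(2) by (auto simp: t_def)
      have n: "norm y > 0" using yK by simp
      define X where "X = pucci2 l L ((\<alpha> * (\<alpha> - 1) + 2 * \<alpha> * m1 (ln (norm y)) + m2 (ln (norm y)) - m1 (ln (norm y))) * h t)
          ((\<alpha> - 1 + m1 (ln (norm y))) * h1 t) (h2 t + (\<alpha> + m1 (ln (norm y))) * h t)"
      have "pucci_minus l L (H y) = pucci2 l L (F * ((\<alpha> * (\<alpha> - 1) + 2 * \<alpha> * m1 (ln (norm y)) + m2 (ln (norm y)) - m1 (ln (norm y))) * h t))
          (F * ((\<alpha> - 1 + m1 (ln (norm y))) * h1 t)) (F * (h2 t + (\<alpha> + m1 (ln (norm y))) * h t)) / (norm y)\<^sup>2"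
        unfolding H_def pucci_polar_matrix[OF conjunct1[OF yK]] F_def[symmetric] t_def[symmetric]
        by (rule arg_cong2[of _ _ _ _ "\<lambda>x y. x / y"], rule arg_cong3[of _ _ _ _ _ _ "pucci2 l L"]) (simp_all add: algebra_simps power2_eq_square)
      then have puc: "pucci_minus l L (H y) = F * X / (norm y)\<^sup>2"
        unfolding X_def using pucci2_scale[of F] F by simp
      have hz: "homog_pucci l L \<alpha> (h t) (h1 t) (h2 t) \<ge> \<epsilon> * homog_pucci l L \<alpha> (\<sigma> t) (\<sigma>1 t) (\<sigma>2 t)"
      proof -
        have "pucci2 l L (\<epsilon> * (\<alpha> * (\<alpha> - 1) * \<sigma> t)) (\<epsilon> * ((\<alpha> - 1) * \<sigma>1 t)) (\<epsilon> * (\<alpha> * \<sigma> t + \<sigma>2 t))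
          = \<epsilon> * homog_pucci l L \<alpha> (\<sigma> t) (\<sigma>1 t) (\<sigma>2 t)"
          by (rule pucci2_scale) (use \<epsilon> in simp)
        moreover have "\<alpha> * (\<alpha> - 1) * \<phi> t + \<epsilon> * (\<alpha> * (\<alpha> - 1) * \<sigma> t) = \<alpha> * (\<alpha> - 1) * h t"
          "(\<alpha> - 1) * \<phi>1 t + \<epsilon> * ((\<alpha> - 1) * \<sigma>1 t) = (\<alpha> - 1) * h1 t"
          "\<alpha> * \<phi> t + \<phi>2 t + \<epsilon> * (\<alpha> * \<sigma> t + \<sigma>2 t) = \<alpha> * h t + h2 t"
          unfolding h_def h1_def h2_def by algebra+
        ultimately show ?thesis
          using pucci2_superadd[OF l, of "\<alpha> * (\<alpha> - 1) * \<phi> t" "(\<alpha> - 1) * \<phi>1 t" "\<alpha> * \<phi> t + \<phi>2 t"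
            "\<epsilon> * (\<alpha> * (\<alpha> - 1) * \<sigma> t)" "\<epsilon> * ((\<alpha> - 1) * \<sigma>1 t)" "\<epsilon> * (\<alpha> * \<sigma> t + \<sigma>2 t)"] P(5)[OF t(2)] by simp
      qed
      have Xge: "X \<ge> \<epsilon> * homog_pucci l L \<alpha> (\<sigma> t) (\<sigma>1 t) (\<sigma>2 t) - Q * \<nu>"
        using pucci2_slow_modulation[OF l m(1) m(2) hM[OF t(1)], of \<alpha> "h2 t"] hz
        unfolding X_def Q_def by (meson diff_right_mono order_trans)
      show "pucci_minus l L (H y) + u y powr p > 0"
      proof (cases "\<theta>1 \<le> \<bar>t\<bar>")
        case True
        have "\<epsilon> * 1 \<le> \<epsilon> * homog_pucci l L \<alpha> (\<sigma> t) (\<sigma>1 t) (\<sigma>2 t)"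
          using \<sigma>out[OF True t(1)] \<epsilon> by (intro mult_left_mono) auto
        then have "X > 0" using Xge Q\<nu> \<epsilon> by linarith
        then have "pucci_minus l L (H y) > 0" unfolding puc using F n by simp
        moreover have "u y powr p > 0" using upos by simp
        ultimately show ?thesis by linarith
      next
        case False
        have "\<epsilon> * (- C) \<le> \<epsilon> * homog_pucci l L \<alpha> (\<sigma> t) (\<sigma>1 t) (\<sigma>2 t)"
          using \<sigma>in[OF t(1)] \<epsilon> by (intro mult_left_mono) auto
        then have "X \<ge> - (\<epsilon> * (C + 1))" using Xge Q\<nu> \<epsilon> by (simp add: distrib_left)
        then have "F * X \<ge> F * (- (\<epsilon> * (C + 1)))" using F by (intro mult_left_mono) auto
        moreover have "F * (\<epsilon> * (C + 1)) \<le> (A * norm y powr \<alpha>) * (\<epsilon> * (C + 1))"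
          using fle[of y] yK \<epsilon> C unfolding F_def by (intro mult_right_mono) auto
        moreover have "2 * ((A * norm y powr \<alpha>) * (\<epsilon> * (C + 1))) \<le> s * norm y powr \<alpha>"
        proof -
          have e: "2 * ((A * N) * (\<epsilon> * (C + 1))) = (2 * (A * (\<epsilon> * (C + 1)))) * N" for N by (simp only: mult_ac)
          show ?thesis unfolding e using mult_right_mono[OF \<epsilon>s, of "norm y powr \<alpha>"] by simp
        qed
        moreover have "s * norm y powr \<alpha> > 0" using s(1) n by simp
        ultimately have "F * X > - (s * norm y powr \<alpha>)" by linarith
        then have "F * X / (norm y)\<^sup>2 > - (s * norm y powr \<alpha>) / (norm y)\<^sup>2"
          using n by (intro divide_strict_right_mono) auto
        moreover have "norm y powr (\<alpha> - 2) = norm y powr \<alpha> / (norm y)\<^sup>2"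
          using n by (simp add: powr_diff powr_numeral)
        moreover have "s * norm y powr (\<alpha> - 2) \<le> u y powr p"
        proof (rule s(2))
          show "y \<in> sector \<theta>1" using False yK sector_ang[of \<theta>1 y] \<theta>1 g\<pi> unfolding t_def by auto
          show "y \<noteq> 0" "a \<le> norm y" using yK ya by auto
          have "w y \<le> F * M" unfolding w_def F_def[symmetric] t_def[symmetric]
            using hM(1)[OF t(1)] F by (intro mult_left_mono) auto
          also have "\<dots> \<le> (A * norm y powr \<alpha>) * M" unfolding F_def using fle[of y] yK M by (intro mult_right_mono) auto
          finally show "u y < A * M * norm y powr \<alpha>" using uw by (simp add: mult_ac)
        qed
        ultimately show ?thesis unfolding puc by (simp add: field_simps)
      qed
    qed
    have za: "z \<in> slit" "\<bar>ang z\<bar> < g" using z(1) cone_ang[of g z] P(1) g\<pi> by auto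
    have "\<phi> (ang z) - e \<le> h (ang z)"
    proof -
      have "\<epsilon> * \<bar>\<sigma> (ang z)\<bar> \<le> \<epsilon> * M1" using M1(2)[of "ang z"] za \<epsilon> by (intro mult_left_mono) auto
      also note \<epsilon>e
      finally have "\<bar>\<epsilon> * \<sigma> (ang z)\<bar> \<le> e" using \<epsilon> by (simp add: abs_mult)
      then show ?thesis unfolding h_def by linarith
    qed
    then have le: "f (ln (norm z)) * (\<phi> (ang z) - e) \<le> w z"
      unfolding w_def using fpos by (intro mult_left_mono) (auto simp: less_imp_le)
    have "w z \<le> u z"
    proof (cases "\<bar>ang z\<bar> \<le> \<theta>")
      case True
      then have "z \<in> K" using za z R sector_ang[of \<theta> z] \<theta> g\<pi> by (auto simp: K_def)
      then show ?thesis by (rule comp)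
    next
      case False
      then have "h (ang z) < 0" using \<theta>(3)[of "ang z"] za by auto
      then have "w z < 0" unfolding w_def using fpos by (simp add: mult_pos_neg)
      then show ?thesis using pos[OF z(1)] by simp
    qed
    then show "hump A \<alpha> \<nu> T (ln (norm z)) * (\<phi> (ang z) - e) \<le> u z" using le unfolding f_def by simp
  qed
qed

section \<open>Nonexistence\<close>

locale cone_supersolution =
  fixes l L p g :: real and u :: "real^2 \<Rightarrow> real"
  assumes l: "0 < l" "l \<le> L" and g: "0 < g" "g < pi"
    and visc: "viscosity_supersolution (pucci_minus l L) (\<lambda>s. s powr p) (cone_C g) u"
    and lsc: "lsc_on (cone_C g) u" and pos: "\<And>z. z \<in> cone_C g \<Longrightarrow> 0 < u z"
begin

definition "bumpC = 8 * L * ((l + L) / l)\<^sup>2"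

lemma bumpC_pos: "bumpC > 0"
  using l by (simp add: bumpC_def)

lemma bump_cone:
  assumes "\<rho> > 0" "cball z \<rho> \<subseteq> cone_C g"
  obtains y where "y \<in> ball z \<rho>" "u y \<le> u z" "u y powr p \<le> bumpC / \<rho>\<^sup>2 * u y" "u y > 0"
proof -
  obtain y where y: "y \<in> ball z \<rho>" "u y \<le> u z" "u y powr p \<le> bumpC / \<rho>\<^sup>2 * u y"
    using bump_bound[OF l visc lsc pos assms] unfolding bumpC_def by blast
  moreover have "y \<in> cone_C g" using y(1) assms(2) by auto
  ultimately show thesis using that pos by blast
qed

lemma powr_superlinear: "u y > 0 \<Longrightarrow> u y powr p \<le> K * u y \<Longrightarrow> u y powr (p - 1) \<le> K"
  by (simp add: powr_diff divide_le_eq)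

lemma e2_nonzero: "e2 \<noteq> 0"
  using e2(3) by (metis norm_zero zero_neq_one)

lemma e2_sector: "k > 0 \<Longrightarrow> k *\<^sub>R e2 \<in> sector 0" "k > 0 \<Longrightarrow> k *\<^sub>R e2 \<noteq> 0" "k > 0 \<Longrightarrow> norm (k *\<^sub>R e2) = k"
  using e2_nonzero by (auto simp: sector_def e2)

text \<open>The principal eigenvalue of a large ball is smaller than \<open>1\<close>.\<close>

lemma p_ne_1: "p \<noteq> 1"
proof
  assume p: "p = 1"
  obtain \<rho> where \<rho>: "0 < \<rho>" "\<And>z. z \<in> sector 0 \<Longrightarrow> z \<noteq> 0 \<Longrightarrow> cball z (\<rho> * norm z) \<subseteq> cone_C g"
    using sector_uniform_ball[of 0 g] g by (metis less_imp_le order_refl)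
  define R where "R = (bumpC + 1) / \<rho>"
  have R: "R > 0" "\<rho> * R = bumpC + 1" using \<rho>(1) bumpC_pos by (auto simp: R_def)
  have sub: "cball (R *\<^sub>R e2) (\<rho> * R) \<subseteq> cone_C g"
    using \<rho>(2)[OF e2_sector(1,2)[OF R(1)]] e2_sector(3)[OF R(1)] by simp
  obtain y where y: "u y powr p \<le> bumpC / (\<rho> * R)\<^sup>2 * u y" "u y > 0"
    using bump_cone[OF _ sub] \<rho>(1) R(1) by (metis mult_pos_pos)
  have "u y powr (p - 1) \<le> bumpC / (bumpC + 1)\<^sup>2" using powr_superlinear[OF y(2,1)] R(2) by simp
  then have "(bumpC + 1)\<^sup>2 \<le> bumpC" using p y(2) bumpC_pos by (simp add: pos_le_divide_eq)
  then show False using bumpC_pos by (simp add: power2_eq_square algebra_simps) (smt (verit) mult_pos_pos)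
qed

lemma lower_bound_sublinear:
  assumes p: "p < 1" and \<theta>: "0 \<le> \<theta>" "\<theta> < g"
  shows "\<exists>c>0. \<forall>z\<in>sector \<theta>. z \<noteq> 0 \<longrightarrow> c * norm z powr (2 / (1 - p)) \<le> u z"
proof -
  obtain \<rho> where \<rho>: "0 < \<rho>" "\<And>z. z \<in> sector \<theta> \<Longrightarrow> z \<noteq> 0 \<Longrightarrow> cball z (\<rho> * norm z) \<subseteq> cone_C g"
    using sector_uniform_ball[OF \<theta>] g by (metis less_imp_le)
  define c where "c = (\<rho>\<^sup>2 / bumpC) powr (1 / (1 - p))"
  have c: "c > 0" using \<rho>(1) bumpC_pos by (simp add: c_def)
  have "c * norm z powr (2 / (1 - p)) \<le> u z" if z: "z \<in> sector \<theta>" "z \<noteq> 0" for z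
  proof -
    have n: "norm z > 0" using z by simp
    obtain y where y: "u y \<le> u z" "u y powr p \<le> bumpC / (\<rho> * norm z)\<^sup>2 * u y" "u y > 0"
      using bump_cone[OF _ \<rho>(2)[OF z]] \<rho>(1) n by (metis mult_pos_pos)
    have "u y powr (p - 1) \<le> bumpC / (\<rho> * norm z)\<^sup>2" by (rule powr_superlinear[OF y(3,2)])
    then have "inverse (bumpC / (\<rho> * norm z)\<^sup>2) \<le> inverse (u y powr (p - 1))"
      using y(3) by (intro le_imp_inverse_le) auto
    also have "inverse (u y powr (p - 1)) = u y powr (1 - p)" using powr_minus[of "u y" "p - 1"] by simp
    finally have "\<rho>\<^sup>2 / bumpC * (norm z)\<^sup>2 \<le> u y powr (1 - p)" by (simp add: power_mult_distrib)
    then have "(\<rho>\<^sup>2 / bumpC * (norm z)\<^sup>2) powr (1 / (1 - p)) \<le> (u y powr (1 - p)) powr (1 / (1 - p))"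
      using p bumpC_pos by (intro powr_mono2) auto
    also have "\<dots> = u y" using y(3) p by (simp add: powr_powr)
    also have "(\<rho>\<^sup>2 / bumpC * (norm z)\<^sup>2) powr (1 / (1 - p)) = c * (norm z powr 2) powr (1 / (1 - p))"
      unfolding c_def using n bumpC_pos by (subst powr_mult) (auto simp: powr_numeral)
    also have "(norm z powr 2) powr (1 / (1 - p)) = norm z powr (2 / (1 - p))" unfolding powr_powr by simp
    finally show ?thesis using y(1) by simp
  qed
  then show ?thesis using c by blast
qed

lemma upper_bound_superlinear:
  assumes p: "1 < p" and \<rho>: "0 < \<rho>" and n: "0 < n" and sub: "cball z (\<rho> * n) \<subseteq> cone_C g"
  obtains y where "y \<in> ball z (\<rho> * n)" "u y \<le> (bumpC / \<rho>\<^sup>2) powr (1 / (p - 1)) * n powr (2 / (1 - p))"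
proof -
  obtain y where y: "y \<in> ball z (\<rho> * n)" "u y powr p \<le> bumpC / (\<rho> * n)\<^sup>2 * u y" "u y > 0"
    using bump_cone[OF _ sub] \<rho> n by (metis mult_pos_pos)
  have "u y powr (p - 1) \<le> bumpC / (\<rho> * n)\<^sup>2" by (rule powr_superlinear[OF y(3,2)])
  also have "\<dots> = (bumpC / \<rho>\<^sup>2) * n powr (-2)"
    using n by (simp add: power_mult_distrib powr_minus powr_numeral divide_inverse)
  finally have "u y powr (p - 1) \<le> (bumpC / \<rho>\<^sup>2) * n powr (-2)" .
  then have "(u y powr (p - 1)) powr (1 / (p - 1)) \<le> ((bumpC / \<rho>\<^sup>2) * n powr (-2)) powr (1 / (p - 1))"
    using p by (intro powr_mono2) auto
  moreover have "(u y powr (p - 1)) powr (1 / (p - 1)) = u y" using y(3) p by (simp add: powr_powr)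
  moreover have "((bumpC / \<rho>\<^sup>2) * n powr (-2)) powr (1 / (p - 1)) = (bumpC / \<rho>\<^sup>2) powr (1 / (p - 1)) * n powr (2 / (1 - p))"
  proof -
    have "- 2 * (1 / (p - 1)) = 2 / (1 - p)" using p by (simp add: field_simps)
    then show ?thesis using bumpC_pos \<rho> by (subst powr_mult) (auto simp: powr_powr)
  qed
  ultimately show thesis using that y(1) by simp
qed

text \<open>For \<open>p \<ge> 0\<close> the source is controlled by the lower bound on \<open>u\<close>; for \<open>p < 0\<close> it is large where
  \<open>u\<close> is small, and the upper bound available at a touching point is used instead.\<close>

lemma source_bound:
  assumes \<alpha>: "\<alpha> * p = \<alpha> - 2" and \<theta>: "0 \<le> \<theta>" "\<theta> < g" and A: "A > 0"
    and lower: "\<exists>c>0. \<forall>z\<in>sector \<theta>. z \<noteq> 0 \<longrightarrow> a \<le> norm z \<longrightarrow> c * norm z powr \<alpha> \<le> u z"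
  shows "\<exists>s>0. \<forall>z\<in>sector \<theta>. z \<noteq> 0 \<longrightarrow> a \<le> norm z \<longrightarrow>
       u z < A * norm z powr \<alpha> \<longrightarrow> s * norm z powr (\<alpha> - 2) \<le> u z powr p"
proof -
  obtain c where c: "c > 0" "\<And>z. z \<in> sector \<theta> \<Longrightarrow> z \<noteq> 0 \<Longrightarrow> a \<le> norm z \<Longrightarrow> c * norm z powr \<alpha> \<le> u z"
    using lower by blast
  have pw: "(k * norm z powr \<alpha>) powr p = k powr p * norm z powr (\<alpha> - 2)" if "k > 0" for k and z :: "real^2"
    using that by (subst powr_mult) (auto simp: powr_powr \<alpha>)
  have up: "u z > 0" if "z \<in> sector \<theta>" "z \<noteq> 0" for z
    using pos sector_subset_cone[OF \<theta> _ that] g by simp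
  show ?thesis
  proof (cases "0 \<le> p")
    case True
    have "c powr p * norm z powr (\<alpha> - 2) \<le> u z powr p" if "z \<in> sector \<theta>" "z \<noteq> 0" "a \<le> norm z" for z
      unfolding pw[OF c(1), symmetric] by (rule powr_mono2[OF True _ c(2)[OF that]]) (use c in simp)
    then show ?thesis using c(1) by (intro exI[of _ "c powr p"]) simp
  next
    case False
    have "A powr p * norm z powr (\<alpha> - 2) \<le> u z powr p"
      if "z \<in> sector \<theta>" "z \<noteq> 0" "u z < A * norm z powr \<alpha>" for z
      unfolding pw[OF A, symmetric] by (rule powr_mono2') (use False up[OF that(1,2)] that(3) in auto)
    then show ?thesis using A by (intro exI[of _ "A powr p"]) simp
  qed
qed

text \<open>Bumps give \<open>u \<ge> c r\<^sup>\<alpha>\<close> at all scales, so the cut-off may extend to the vertex and to infinity, and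
  the amplified bound at the single point \<open>e2\<close> cannot hold for all \<open>A\<close>.\<close>

lemma no_profile_inside_sublinear:
  assumes p: "p < 1"
  shows "\<not> angular_profile l L (2 / (1 - p)) g g' \<phi> \<phi>1 \<phi>2"
proof
  define \<alpha> where "\<alpha> = 2 / (1 - p)"
  assume "angular_profile l L (2 / (1 - p)) g g' \<phi> \<phi>1 \<phi>2"
  then have prof: "angular_profile l L \<alpha> g g' \<phi> \<phi>1 \<phi>2" by (simp add: \<alpha>_def)
  have \<alpha>p: "\<alpha> * p = \<alpha> - 2" using p by (simp add: \<alpha>_def field_simps)
  have lower: "\<exists>c>0. \<forall>z\<in>sector \<theta>. z \<noteq> 0 \<longrightarrow> 0 \<le> norm z \<longrightarrow> c * norm z powr \<alpha> \<le> u z" if "0 \<le> \<theta>" "\<theta> < g" for \<theta>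
    using lower_bound_sublinear[OF p that] by (simp add: \<alpha>_def)
  have \<phi>0: "\<phi> 0 > 0" using angular_profileD(7)[OF prof, of 0] g by auto
  have ue: "u e2 > 0" using pos e2_cone g by simp
  define A where "A = (u e2 + 1) * 2 / \<phi> 0"
  have A: "A > 0" using ue \<phi>0 by (simp add: A_def add_pos_pos)
  have source: "\<exists>s>0. \<forall>z\<in>sector \<theta>. z \<noteq> 0 \<longrightarrow> 0 \<le> norm z \<longrightarrow>
       u z < A * norm z powr \<alpha> \<longrightarrow> s * norm z powr (\<alpha> - 2) \<le> u z powr p"
    if "A > 0" "0 \<le> \<theta>" "\<theta> < g" for A \<theta>
    by (rule source_bound[OF \<alpha>p that(2,3,1) lower[OF that(2,3)]])
  have "\<phi> 0 / 2 > 0" using \<phi>0 by simp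
  from hump_lower_bound[OF l prof g(2) visc lsc pos lower source A this]
  obtain \<nu> B where \<nu>: "\<nu> > 0" and B: "\<forall>T a1. 0 < a1 \<longrightarrow> 0 \<le> a1 \<longrightarrow> B \<le> cosh (\<nu> * (ln a1 - T)) \<longrightarrow>
     (\<forall>z\<in>cone_C g. a1 \<le> norm z \<longrightarrow> hump A \<alpha> \<nu> T (ln (norm z)) * (\<phi> (ang z) - \<phi> 0 / 2) \<le> u z)" by blast
  obtain t where t: "t \<le> 0" "B \<le> cosh (\<nu> * (t - 0))" using cosh_scaled_large(2)[OF \<nu>] by blast
  have "B \<le> cosh (\<nu> * (ln (exp t) - 0))" using t(2) by simp
  moreover have "exp t \<le> norm e2" "e2 \<in> cone_C g" using t(1) e2_cone g by (simp_all add: e2)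
  ultimately have "hump A \<alpha> \<nu> 0 (ln (norm e2)) * (\<phi> (ang e2) - \<phi> 0 / 2) \<le> u e2"
    using B exp_gt_zero[of t] less_imp_le by blast
  then have "A * (\<phi> 0 / 2) \<le> u e2" by (simp add: e2 hump_def)
  moreover have "A * (\<phi> 0 / 2) = u e2 + 1" using \<phi>0 by (simp add: A_def)
  ultimately show False by simp
qed

end

lemma C2_on_shift:
  fixes v :: "real^'n \<Rightarrow> real"
  assumes "C2_on U v G H"
  shows "C2_on {z. z - b \<in> U} (\<lambda>z. v (z - b)) (\<lambda>z. G (z - b)) (\<lambda>z. H (z - b))"
  unfolding C2_on_def
proof (intro conjI ballI)
  have sh: "((\<lambda>z. z - b) has_derivative (\<lambda>h. h)) (at x)" for x :: "real^'n" by (auto intro!: derivative_eq_intros)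
  fix x assume "x \<in> {z. z - b \<in> U}"
  then have d: "(v has_derivative (\<lambda>h. G (x - b) \<bullet> h)) (at (x - b))" "(G has_derivative (\<lambda>h. H (x - b) *v h)) (at (x - b))"
    using assms unfolding C2_on_def by auto
  show "((\<lambda>z. v (z - b)) has_derivative (\<lambda>h. G (x - b) \<bullet> h)) (at x)"
    using has_derivative_compose[OF sh d(1)] .
  show "((\<lambda>z. G (z - b)) has_derivative (\<lambda>h. H (x - b) *v h)) (at x)"
    using has_derivative_compose[OF sh d(2)] .
next
  have "continuous_on U H" using assms unfolding C2_on_def by blast
  then show "continuous_on {z. z - b \<in> U} (\<lambda>z. H (z - b))"
    by (rule continuous_on_compose2) (auto intro!: continuous_intros)
qed

lemma open_shift: "open U \<Longrightarrow> open {z::'a::real_normed_vector. z - b \<in> U}"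
proof -
  assume U: "open U"
  have "open ((\<lambda>z. z - b) -` U)" by (rule open_vimage[OF U]) (intro continuous_intros)
  then show ?thesis by (simp add: vimage_def)
qed

lemma viscosity_shift:
  assumes "viscosity_supersolution F f \<Omega> u"
  shows "viscosity_supersolution F f {z. z + b \<in> \<Omega>} (\<lambda>z. u (z + b))"
  unfolding viscosity_supersolution_def
proof (intro allI impI, elim conjE)
  fix x U \<phi> G H
  assume U: "open U" "x \<in> U" "U \<subseteq> {z. z + b \<in> \<Omega>}" and C: "C2_on U \<phi> G H"
    and mn: "\<forall>y\<in>U. u (x + b) - \<phi> x \<le> u (y + b) - \<phi> y"
  have "F (H ((x + b) - b)) + f (u (x + b)) \<le> 0"
  proof (rule viscosityD[OF assms open_shift[OF U(1), of b] _ _ C2_on_shift[OF C, of b]])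
    show "x + b \<in> {z. z - b \<in> U}" using U(2) by simp
    show "{z. z - b \<in> U} \<subseteq> \<Omega>" using U(3) by (auto simp: subset_iff dest: spec[of _ "_ - b"])
    show "u (x + b) - \<phi> (x + b - b) \<le> u y - \<phi> (y - b)" if "y \<in> {z. z - b \<in> U}" for y
      using mn that by (auto dest: bspec[of _ _ "y - b"])
  qed
  then show "F (H x) + f (u (x + b)) \<le> 0" by simp
qed

lemma lsc_on_shift:
  fixes u :: "'a::real_normed_vector \<Rightarrow> real"
  assumes "lsc_on \<Omega> u"
  shows "lsc_on {z. z + b \<in> \<Omega>} (\<lambda>z. u (z + b))"
  unfolding lsc_on_def
proof (intro ballI allI impI)
  fix x a assume x: "x \<in> {z. z + b \<in> \<Omega>}" "a < u (x + b)"
  then obtain W where W: "open W" "x + b \<in> W" "\<And>y. y \<in> W \<inter> \<Omega> \<Longrightarrow> a < u y"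
    using lsc_onD[OF assms, of "x + b" a] by blast
  show "eventually (\<lambda>y. a < u (y + b)) (at x within {z. z + b \<in> \<Omega>})"
    unfolding eventually_at_topological
    by (rule exI[of _ "{z. z - (- b) \<in> W}"]) (use open_shift[OF W(1), of "- b"] W(2,3) in auto)
qed

context cone_supersolution
begin

text \<open>For \<open>\<alpha> < 0\<close> a multiple of \<open>\<Phi>\<close> lies below the translated supersolution for \<open>r = 1\<close>, vanishes on the
  lateral boundary and tends to zero at infinity. Subtracting a constant \<open>\<delta>\<close> makes the last condition
  effective at a finite radius without changing the Hessian.\<close>

lemma decay_lower_bound:
  fixes \<alpha> :: real
  assumes \<alpha>: "\<alpha> < 0" and prof: "angular_profile l L \<alpha> g g' \<phi> \<phi>1 \<phi>2"
  obtains c where "c > 0" "\<And>z. z \<in> cone_C g \<Longrightarrow> 1 \<le> norm z \<Longrightarrow> c * norm z powr \<alpha> * \<phi> (ang z) \<le> u (z + e2)"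
proof -
  note P = angular_profileD[OF prof]
  define v where "v z = u (z + e2)" for z
  define \<Omega> where "\<Omega> = {z. z + e2 \<in> cone_C g}"
  have sub: "sector g \<subseteq> \<Omega>" using shift_sector_cone[OF g] by (auto simp: \<Omega>_def)
  have vv: "viscosity_supersolution (pucci_minus l L) (\<lambda>s. s powr p) \<Omega> v"
    and vl: "lsc_on \<Omega> v" and vp: "\<And>z. z \<in> \<Omega> \<Longrightarrow> 0 < v z"
    using viscosity_shift[OF visc] lsc_on_shift[OF lsc] pos unfolding v_def[abs_def] \<Omega>_def by auto
  have gsub: "{-g..g} \<subseteq> {-g'<..<g'}" using P(1,2) by auto
  have "continuous_on {-g..g} \<phi>" "continuous_on {-g..g} \<phi>1"
    by (rule DERIV_imp_continuous_on, rule P(3), use gsub in blast)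
       (rule DERIV_imp_continuous_on, rule P(4), use gsub in blast)
  then obtain M where M: "M > 0" "\<And>t. \<bar>t\<bar> \<le> g \<Longrightarrow> \<bar>\<phi> t\<bar> \<le> M"
    using bounded_pair_on_interval by metis
  define K1 where "K1 = {z \<in> sector g. 1 \<le> norm z \<and> norm z \<le> 1}"
  have K1: "compact K1" "K1 \<subseteq> \<Omega>" using sub compact_annular_sector unfolding K1_def by auto
  have "e2 \<in> K1" using e2_cone[of g] g cone_subset_sector by (auto simp: K1_def e2)
  then obtain x1 where x1: "x1 \<in> K1" "\<And>y. y \<in> K1 \<Longrightarrow> v x1 \<le> v y"
    using lsc_on_attains_inf[OF K1(1) _ lsc_on_subset[OF vl K1(2)]] by blast
  define c where "c = v x1 / M"
  have c: "c > 0" "c * M = v x1" using vp K1(2) x1(1) M(1) by (auto simp: c_def)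
  define w where "w z = c * exp (\<alpha> * ln (norm z)) * \<phi> (ang z)" for z
  have wn: "w z = c * norm z powr \<alpha> * \<phi> (ang z)" if "z \<noteq> 0" for z
    using that by (simp add: w_def powr_def)
  define V where "V = {y \<in> slit. \<bar>ang y\<bar> < g'}"
  have V: "V \<subseteq> slit" "\<And>y. y \<in> V \<Longrightarrow> ang y \<in> {-g'<..<g'}" by (auto simp: V_def abs_less_iff)
  obtain G H where CV: "C2_on V w G H" and H: "\<And>y. y \<in> V \<Longrightarrow> pucci_minus l L (H y) = c * norm y powr (\<alpha> - 2) *
       homog_pucci l L \<alpha> (\<phi> (ang y)) (\<phi>1 (ang y)) (\<phi>2 (ang y))"
    using power_times_profile[OF P(3,4,6) V c(1), of \<alpha> l L, folded w_def] by blast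
  have key: "w z - \<delta> \<le> v z" if z: "z \<in> cone_C g" "1 \<le> norm z" and \<delta>: "\<delta> > 0" for z \<delta>
  proof -
    have "((\<lambda>R. c * M * R powr \<alpha>) \<longlongrightarrow> c * M * 0) at_top"
      by (intro tendsto_intros tendsto_neg_powr \<alpha> filterlim_ident)
    then have "eventually (\<lambda>R. c * M * R powr \<alpha> < \<delta>) at_top" using \<delta> by (simp add: order_tendstoD(2))
    then have "eventually (\<lambda>R. c * M * R powr \<alpha> < \<delta> \<and> norm z \<le> R) at_top"
      using eventually_ge_at_top by (rule eventually_conj)
    then obtain R where R: "c * M * R powr \<alpha> < \<delta>" "norm z \<le> R" using eventually_happens by fastforce
    define K U where "K = {y \<in> sector g. 1 \<le> norm y \<and> norm y \<le> R}"
      and "U = {y \<in> cone_C g. 1 < norm y \<and> norm y < R}"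
    have Kang: "y \<noteq> 0 \<and> y \<in> slit \<and> \<bar>ang y\<bar> \<le> g" if "y \<in> K" for y
      using that sector_ang[of g y] g by (auto simp: K_def)
    have KV: "K \<subseteq> V" using Kang P(2) unfolding V_def by force
    have UK: "U \<subseteq> K" unfolding U_def K_def using cone_subset_sector by auto
    have K\<Omega>: "K \<subseteq> \<Omega>" using sub by (auto simp: K_def)
    show "w z - \<delta> \<le> v z"
    proof (rule viscosity_compare[OF vv vl _ UK K\<Omega> _ _ C2_on_diff_const[OF C2_on_subset[OF CV]]])
      show "open U" unfolding U_def by (rule open_annular_cone)
      show "compact K" unfolding K_def by (rule compact_annular_sector)
      show "continuous_on K (\<lambda>z. w z - \<delta>)"
        using continuous_on_subset[OF C2_on_continuous[OF CV] KV] by (intro continuous_intros)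
      show "U \<subseteq> V" using UK KV by blast
      show "z \<in> K" using z R(2) cone_subset_sector by (auto simp: K_def)
    next
      fix y assume y: "y \<in> K" "y \<notin> U"
      note yK = Kang[OF y(1)]
      have vy: "v y > 0" using vp K\<Omega> y(1) by blast
      have wM: "w y \<le> c * norm y powr \<alpha> * M"
        unfolding wn[OF conjunct1[OF yK]] using yK M(2)[of "ang y"] c(1) by (intro mult_left_mono) auto
      show "w y - \<delta> \<le> v y"
      proof (cases "y \<in> cone_C g")
        case False
        then have "\<bar>ang y\<bar> = g" using yK cone_ang[of g y] g by auto
        then have "\<phi> (ang y) = 0" using P(8,9) by (auto simp: abs_if split: if_splits)
        then show ?thesis using vy \<delta> by (simp add: w_def)
      next
        case True
        then consider "norm y = 1" | "norm y = R" using y unfolding U_def K_def by force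
        then show ?thesis
        proof cases
          case 1
          then have "y \<in> K1" using y(1) by (auto simp: K_def K1_def)
          then have "v x1 \<le> v y" by (rule x1(2))
          then show ?thesis using wM 1 c(2) \<delta> by simp
        next
          case 2
          then show ?thesis using wM R(1) vy by (simp add: mult_ac)
        qed
      qed
    next
      fix y assume "y \<in> U"
      then have yKK: "y \<in> K" using UK by blast
      note yK = Kang[OF yKK]
      have "ang y \<in> {-g'<..<g'}" "y \<in> V" using yK P(2) KV yKK by auto
      then have "pucci_minus l L (H y) = 0" using H P(5) by simp
      moreover have "v y > 0" using vp K\<Omega> yKK by blast
      ultimately show "pucci_minus l L (H y) + v y powr p > 0" by simp
    qed
  qed
  have "c * norm z powr \<alpha> * \<phi> (ang z) \<le> u (z + e2)" if z: "z \<in> cone_C g" "1 \<le> norm z" for z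
  proof -
    have "w z \<le> v z" by (rule field_le_epsilon) (use key[OF z] in \<open>simp add: algebra_simps\<close>)
    then show ?thesis unfolding wn[OF cone_nz[OF z(1)]] v_def .
  qed
  then show thesis using that c(1) by blast
qed

text \<open>The amplified bound is centred at a large radius \<open>n = exp T\<close>, where the initial bound at \<open>r = 1\<close> is
  already irrelevant because of the cut-off. There it contradicts the universal upper bound
  \<open>D n\<^sup>\<alpha>\<close> that bumps give in a ball of radius proportional to \<open>n\<close>.\<close>

lemma no_profile_inside_superlinear:
  assumes p: "1 < p"
  shows "\<not> angular_profile l L (2 / (1 - p)) g g' \<phi> \<phi>1 \<phi>2"
proof
  define \<alpha> where "\<alpha> = 2 / (1 - p)"
  assume "angular_profile l L (2 / (1 - p)) g g' \<phi> \<phi>1 \<phi>2"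
  then have prof: "angular_profile l L \<alpha> g g' \<phi> \<phi>1 \<phi>2" by (simp add: \<alpha>_def)
  note P = angular_profileD[OF prof]
  have \<alpha>p: "\<alpha> * p = \<alpha> - 2" using p by (simp add: \<alpha>_def field_simps)
  have \<alpha>: "\<alpha> < 0" using p by (simp add: \<alpha>_def divide_pos_neg)
  define v where "v z = u (z + e2)" for z
  have csub: "cone_C g \<subseteq> {z. z + e2 \<in> cone_C g}"
    using shift_sector_cone[OF g] cone_subset_sector by blast
  interpret v: cone_supersolution l L p g v
  proof
    show "viscosity_supersolution (pucci_minus l L) (\<lambda>s. s powr p) (cone_C g) v"
      unfolding v_def[abs_def] by (rule viscosity_restrict[OF viscosity_shift[OF visc] csub])
    show "lsc_on (cone_C g) v" unfolding v_def[abs_def] by (rule lsc_on_subset[OF lsc_on_shift[OF lsc] csub])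
    show "0 < v z" if "z \<in> cone_C g" for z using pos csub that by (auto simp: v_def)
  qed (use l g in auto)
  obtain c where c: "c > 0" "\<And>z. z \<in> cone_C g \<Longrightarrow> 1 \<le> norm z \<Longrightarrow> c * norm z powr \<alpha> * \<phi> (ang z) \<le> v z"
    using decay_lower_bound[OF \<alpha> prof] unfolding v_def by blast
  have \<phi>min: "\<exists>m>0. \<forall>t. \<bar>t\<bar> \<le> \<theta> \<longrightarrow> m \<le> \<phi> t" if \<theta>: "0 \<le> \<theta>" "\<theta> < g" for \<theta>
  proof -
    have s: "{-\<theta>..\<theta>} \<subseteq> {-g'<..<g'}" "{-\<theta>..\<theta>} \<subseteq> {-g<..<g}" using \<theta> P(2) by auto
    have "continuous_on {-\<theta>..\<theta>} \<phi>"
      by (rule DERIV_imp_continuous_on, rule P(3), use s in blast)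
    then obtain x where x: "x \<in> {-\<theta>..\<theta>}" "\<And>t. t \<in> {-\<theta>..\<theta>} \<Longrightarrow> \<phi> x \<le> \<phi> t"
      using continuous_attains_inf[of "{-\<theta>..\<theta>}" \<phi>] \<theta> by (auto simp: Ball_def)
    have "\<phi> x > 0" using P(7) x(1) s by blast
    moreover have "\<phi> x \<le> \<phi> t" if "\<bar>t\<bar> \<le> \<theta>" for t using x(2)[of t] that by (simp add: abs_le_iff minus_le_iff)
    ultimately show ?thesis by blast
  qed
  have lower: "\<exists>c>0. \<forall>z\<in>sector \<theta>. z \<noteq> 0 \<longrightarrow> 1 \<le> norm z \<longrightarrow> c * norm z powr \<alpha> \<le> v z" if \<theta>: "0 \<le> \<theta>" "\<theta> < g" for \<theta>
  proof -
    obtain m where m: "m > 0" "\<And>t. \<bar>t\<bar> \<le> \<theta> \<Longrightarrow> m \<le> \<phi> t" using \<phi>min[OF \<theta>] by blast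
    have "(c * m) * norm z powr \<alpha> \<le> v z" if z: "z \<in> sector \<theta>" "z \<noteq> 0" "1 \<le> norm z" for z
    proof -
      have "\<bar>ang z\<bar> \<le> \<theta>" using sector_ang[of \<theta> z] z \<theta> g by auto
      then have "c * norm z powr \<alpha> * m \<le> c * norm z powr \<alpha> * \<phi> (ang z)"
        using m(2) c(1) by (intro mult_left_mono) auto
      also have "\<dots> \<le> v z" using c(2) sector_subset_cone[OF \<theta> _ z(1,2)] g z(3) by simp
      finally show ?thesis by (simp add: mult_ac)
    qed
    then show ?thesis using c(1) m(1) by (intro exI[of _ "c * m"]) auto
  qed
  obtain m where m: "m > 0" "\<And>t. \<bar>t\<bar> \<le> g / 2 \<Longrightarrow> m \<le> \<phi> t" using \<phi>min[of "g / 2"] g by auto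
  obtain \<rho>0 where \<rho>0: "0 < \<rho>0" "\<rho>0 < 1" "\<And>z. z \<in> sector 0 \<Longrightarrow> z \<noteq> 0 \<Longrightarrow> cball z (\<rho>0 * norm z) \<subseteq> cone_C (g / 2)"
    using sector_uniform_ball[of 0 "g / 2"] g by auto
  define \<rho> where "\<rho> = \<rho>0 / 2"
  have \<rho>: "0 < \<rho>" "2 * \<rho> \<le> 1" "\<rho> \<le> \<rho>0" using \<rho>0 by (auto simp: \<rho>_def)
  define D where "D = (v.bumpC / \<rho>\<^sup>2) powr (1 / (p - 1))"
  define q where "q = (2::real) powr \<alpha>"
  have q: "q > 0" by (simp add: q_def)
  have D: "D > 0" using v.bumpC_pos \<rho>(1) by (simp add: D_def)
  define A where "A = 4 * (D + 1) / (q * m)"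
  have A: "A > 0" using D q m by (simp add: A_def)
  have source: "\<exists>s>0. \<forall>z\<in>sector \<theta>. z \<noteq> 0 \<longrightarrow> 1 \<le> norm z \<longrightarrow>
       v z < A * norm z powr \<alpha> \<longrightarrow> s * norm z powr (\<alpha> - 2) \<le> v z powr p"
    if "A > 0" "0 \<le> \<theta>" "\<theta> < g" for A \<theta>
    by (rule v.source_bound[OF \<alpha>p that(2,3,1) lower[OF that(2,3)]])
  have "m / 2 > 0" using m by simp
  from hump_lower_bound[OF l prof g(2) v.visc v.lsc v.pos lower source A this]
  obtain \<nu> B where \<nu>: "\<nu> > 0" "\<nu> \<le> 1" and B: "\<forall>T a1. 0 < a1 \<longrightarrow> 1 \<le> a1 \<longrightarrow> B \<le> cosh (\<nu> * (ln a1 - T)) \<longrightarrow>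
     (\<forall>z\<in>cone_C g. a1 \<le> norm z \<longrightarrow> hump A \<alpha> \<nu> T (ln (norm z)) * (\<phi> (ang z) - m / 2) \<le> v z)" by blast
  (* evenness of the cut-off: its value at \<open>ln 1 - T\<close> with \<open>T = - t\<close> is the one at \<open>t\<close> *)
  obtain t where t: "t \<le> - ln 2" "B \<le> cosh (\<nu> * (t - 0))" using cosh_scaled_large(2)[OF \<nu>(1)] by blast
  define T where "T = - t"
  have T: "ln 2 \<le> T" "B \<le> cosh (\<nu> * (ln 1 - T))" using t by (auto simp: T_def)
  define n where "n = exp T"
  have n2: "n \<ge> 2"
  proof -
    have "exp (ln 2) \<le> n" unfolding n_def exp_le_cancel_iff by (rule T(1))
    then show ?thesis by simp
  qed
  have n: "n > 0" "ln n = T" using n2 by (auto simp: n_def)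
  define x where "x = n *\<^sub>R e2"
  have x: "x \<in> sector 0" "x \<noteq> 0" "norm x = n" using e2_sector[OF n(1)] by (auto simp: x_def)
  have ball: "cball x (\<rho> * n) \<subseteq> cone_C (g / 2)"
  proof -
    have "cball x (\<rho> * n) \<subseteq> cball x (\<rho>0 * norm x)" unfolding x(3) using \<rho>(3) n(1) by (intro subset_cball mult_right_mono) auto
    then show ?thesis using \<rho>0(3)[OF x(1,2)] by blast
  qed
  have half: "cone_C (g / 2) \<subseteq> cone_C g" using g by (intro cone_mono) auto
  obtain y where y: "y \<in> ball x (\<rho> * n)" "v y \<le> D * n powr \<alpha>"
    using v.upper_bound_superlinear[OF p \<rho>(1) n(1), of x] ball half unfolding D_def \<alpha>_def by (metis subset_trans)
  have yc: "y \<in> cone_C (g / 2)" using y(1) ball by auto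
  have ynorm: "n \<le> 2 * norm y" "norm y \<le> 2 * n"
  proof -
    have "norm (x - y) \<le> \<rho> * n" using y(1) by (simp add: dist_norm)
    moreover have "2 * (\<rho> * n) \<le> 1 * n" using mult_right_mono[OF \<rho>(2), of n] n(1) by simp
    ultimately have "2 * norm (x - y) \<le> n" by linarith
    then show "n \<le> 2 * norm y" "norm y \<le> 2 * n"
      using norm_triangle_ineq2[of x y] norm_triangle_ineq2[of y x] x(3) by (auto simp: norm_minus_commute)
  qed
  have yn: "norm y > 0" "1 \<le> norm y" using ynorm n2 by auto
  have "\<bar>ang y\<bar> < g / 2" using yc cone_ang[of "g / 2" y] g by auto
  then have \<phi>y: "m / 2 \<le> \<phi> (ang y) - m / 2" using m(2)[of "ang y"] by simp
  have cosh2: "cosh (\<nu> * (ln (norm y) - T)) \<le> 2"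
  proof -
    have "ln n \<le> ln (2 * norm y)" "ln (norm y) \<le> ln (2 * n)" using ynorm n(1) yn by (auto simp: ln_le_cancel_iff)
    then have "\<bar>ln (norm y) - T\<bar> \<le> ln 2" using n yn by (simp add: ln_mult abs_le_iff)
    then have "\<bar>\<nu> * (ln (norm y) - T)\<bar> \<le> 1 * ln 2" unfolding abs_mult using \<nu> by (intro mult_mono) auto
    then have "cosh \<bar>\<nu> * (ln (norm y) - T)\<bar> \<le> cosh (ln 2)" by (subst cosh_real_nonneg_le_iff) auto
    also have "cosh (ln (2::real)) \<le> 2" by (simp add: cosh_ln_real)
    finally show ?thesis by simp
  qed
  have hp: "hump A \<alpha> \<nu> T (ln (norm y)) \<ge> A * (q * n powr \<alpha>) / 2"
  proof -
    have "q * n powr \<alpha> = (2 * n) powr \<alpha>" unfolding q_def using n(1) by (simp add: powr_mult)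
    also have "\<dots> \<le> norm y powr \<alpha>" using ynorm yn \<alpha> by (intro powr_mono2') auto
    finally have "A * (q * n powr \<alpha>) / 2 \<le> A * norm y powr \<alpha> / 2" using A by simp
    also have "\<dots> \<le> A * norm y powr \<alpha> / cosh (\<nu> * (ln (norm y) - T))"
      using cosh2 A cosh_real_pos by (intro divide_left_mono) auto
    also have "\<dots> = hump A \<alpha> \<nu> T (ln (norm y))" unfolding hump_def using yn by (simp add: powr_def)
    finally show ?thesis .
  qed
  have "A * (q * n powr \<alpha>) / 2 * (m / 2) \<le> hump A \<alpha> \<nu> T (ln (norm y)) * (\<phi> (ang y) - m / 2)"
  proof (rule mult_mono[OF hp \<phi>y])
    show "0 \<le> hump A \<alpha> \<nu> T (ln (norm y))" using A cosh_real_pos by (simp add: hump_def less_imp_le)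
  qed (use m(1) in simp)
  also have "\<dots> \<le> v y"
    using B[rule_format, of 1 T y] T(2) yc half yn(2) by (simp add: subset_iff)
  also have "\<dots> \<le> D * n powr \<alpha>" by (rule y(2))
  finally have "A * q * m / 4 * n powr \<alpha> \<le> D * n powr \<alpha>" by (simp add: mult_ac)
  then have "A * q * m / 4 \<le> D" using n(1) by simp
  moreover have "A * q * m / 4 = D + 1" using q m by (simp add: A_def)
  ultimately show False by simp
qed

end

section \<open>Existence\<close>

text \<open>Since the operator is concave and \<open>r\<^sup>\<alpha> cosh (K t)\<close> is a strict subsolution, subtracting a multiple of
  the latter produces a strict supersolution. Both sides of the inequality have the homogeneity
  \<open>r\<^sup>\<alpha>\<^sup>-\<^sup>2\<close>; the factor \<open>k\<close> enters them with the different powers \<open>k\<close> and \<open>k\<^sup>p\<close>, so it can be chosen to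
  balance them.\<close>

lemma supersolution_exists:
  fixes p \<theta> :: real
  assumes l: "0 < l" "l \<le> L" and \<theta>: "0 < \<theta>" "\<theta> < pi" and p: "p \<noteq> 1"
  defines "\<alpha> \<equiv> 2 / (1 - p)"
  assumes I: "{-\<theta>..\<theta>} \<subseteq> I"
    and d: "\<And>t. t \<in> I \<Longrightarrow> (\<phi> has_real_derivative \<phi>1 t) (at t)" "\<And>t. t \<in> I \<Longrightarrow> (\<phi>1 has_real_derivative \<phi>2 t) (at t)"
      "continuous_on I \<phi>2"
    and pmle: "\<And>t. t \<in> I \<Longrightarrow> homog_pucci l L \<alpha> (\<phi> t) (\<phi>1 t) (\<phi>2 t) \<le> 0"
    and pos: "\<And>t. t \<in> {-\<theta>..\<theta>} \<Longrightarrow> 0 < \<phi> t"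
  shows "\<exists>u :: real^2 \<Rightarrow> real. (\<forall>z\<in>cone_C \<theta>. u z > 0) \<and> lsc_on (cone_C \<theta>) u \<and>
            viscosity_supersolution (pucci_minus l L) (\<lambda>s. s powr p) (cone_C \<theta>) u"
proof -
  have \<alpha>p: "\<alpha> * p = \<alpha> - 2" using p by (simp add: \<alpha>_def field_simps)
  obtain K where K: "K \<ge> 1"
    "\<And>M s s1. M \<ge> 1 \<Longrightarrow> \<bar>s\<bar> \<le> 2 * M \<Longrightarrow> \<bar>s1\<bar> \<le> K * M \<Longrightarrow>
       1 \<le> homog_pucci l L \<alpha> s s1 (K\<^sup>2 * M)"
    using exists_large_curvature[OF l, of \<alpha>] by blast
  define c c1 c2 where "c t = cosh (K * t)" and "c1 t = K * sinh (K * t)" and "c2 t = K\<^sup>2 * cosh (K * t)" for t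
  have dc: "(c has_real_derivative c1 t) (at t)" "(c1 has_real_derivative c2 t) (at t)" for t
    unfolding c_def c1_def c2_def by (auto intro!: derivative_eq_intros simp: power2_eq_square)
  have cc2: "continuous_on UNIV c2" unfolding c2_def by (intro continuous_intros)
  have c_ge: "c t \<ge> 1" for t unfolding c_def by (rule cosh_real_ge_1)
  have pmc: "1 \<le> homog_pucci l L \<alpha> (c t) (c1 t) (c2 t)" for t
    unfolding c2_def c_def[symmetric]
  proof (rule K(2)[OF c_ge])
    show "\<bar>c t\<bar> \<le> 2 * c t" using c_ge[of t] by simp
    show "\<bar>c1 t\<bar> \<le> K * c t" unfolding c1_def c_def abs_mult using K(1) abs_sinh_le_cosh by (simp add: mult_left_mono)
  qed
  have c\<phi>: "continuous_on {-\<theta>..\<theta>} \<phi>" by (rule DERIV_imp_continuous_on, rule d(1), use I in blast)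
  have cc: "continuous_on {-\<theta>..\<theta>} c" by (rule DERIV_imp_continuous_on, rule dc(1))
  have ne: "{-\<theta>..\<theta>} \<noteq> {}" using \<theta> by simp
  obtain x0 where x0: "x0 \<in> {-\<theta>..\<theta>}" "\<And>t. t \<in> {-\<theta>..\<theta>} \<Longrightarrow> \<phi> x0 \<le> \<phi> t"
    using continuous_attains_inf[OF compact_Icc ne c\<phi>] by blast
  obtain x1 where x1: "x1 \<in> {-\<theta>..\<theta>}" "\<And>t. t \<in> {-\<theta>..\<theta>} \<Longrightarrow> c t \<le> c x1"
    using continuous_attains_sup[OF compact_Icc ne cc] by blast
  obtain x2 where x2: "x2 \<in> {-\<theta>..\<theta>}" "\<And>t. t \<in> {-\<theta>..\<theta>} \<Longrightarrow> \<phi> t \<le> \<phi> x2"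
    using continuous_attains_sup[OF compact_Icc ne c\<phi>] by blast
  define m where "m = \<phi> x0 / 2"
  have m: "m > 0" "2 * m = \<phi> x0" using pos[OF x0(1)] by (simp_all add: m_def)
  define \<epsilon> where "\<epsilon> = m / c x1"
  have \<epsilon>: "\<epsilon> > 0" "\<epsilon> * c x1 = m" using m(1) c_ge[of x1] by (auto simp: \<epsilon>_def)
  define h h1 h2 where "h t = \<phi> t - \<epsilon> * c t" and "h1 t = \<phi>1 t - \<epsilon> * c1 t" and "h2 t = \<phi>2 t - \<epsilon> * c2 t" for t
  have dh: "(h has_real_derivative h1 t) (at t)" "(h1 has_real_derivative h2 t) (at t)" if "t \<in> I" for t
    unfolding h_def h1_def h2_def using d(1,2)[OF that] dc by (auto intro!: DERIV_diff DERIV_cmult)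
  have ch2: "continuous_on I h2"
    unfolding h2_def using d(3) continuous_on_subset[OF cc2] by (auto intro!: continuous_intros)
  have hb: "m \<le> h t" "h t \<le> \<phi> x2" if t: "t \<in> {-\<theta>..\<theta>}" for t
  proof -
    have "\<epsilon> * c t \<le> m" unfolding \<epsilon>(2)[symmetric] using x1(2)[OF t] \<epsilon>(1) by (intro mult_left_mono) auto
    then show "m \<le> h t" using x0(2)[OF t] m(2) unfolding h_def by linarith
    have "\<epsilon> * c t > 0" using \<epsilon>(1) c_ge[of t] by simp
    then show "h t \<le> \<phi> x2" using x2(2)[OF t] unfolding h_def by linarith
  qed
  have pmh: "homog_pucci l L \<alpha> (h t) (h1 t) (h2 t) \<le> - \<epsilon>" if t: "t \<in> I" for t
  proof -
    have "pucci2 l L (\<epsilon> * (\<alpha> * (\<alpha> - 1) * c t)) (\<epsilon> * ((\<alpha> - 1) * c1 t)) (\<epsilon> * (\<alpha> * c t + c2 t))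
        = \<epsilon> * homog_pucci l L \<alpha> (c t) (c1 t) (c2 t)"
      by (rule pucci2_scale) (use \<epsilon> in simp)
    moreover have "\<alpha> * (\<alpha> - 1) * h t + \<epsilon> * (\<alpha> * (\<alpha> - 1) * c t) = \<alpha> * (\<alpha> - 1) * \<phi> t"
      "(\<alpha> - 1) * h1 t + \<epsilon> * ((\<alpha> - 1) * c1 t) = (\<alpha> - 1) * \<phi>1 t"
      "\<alpha> * h t + h2 t + \<epsilon> * (\<alpha> * c t + c2 t) = \<alpha> * \<phi> t + \<phi>2 t"
      unfolding h_def h1_def h2_def by algebra+
    moreover have "\<epsilon> * 1 \<le> \<epsilon> * homog_pucci l L \<alpha> (c t) (c1 t) (c2 t)"
      using pmc \<epsilon>(1) by (intro mult_left_mono) auto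
    ultimately show ?thesis
      using pucci2_superadd[OF l, of "\<alpha> * (\<alpha> - 1) * h t" "(\<alpha> - 1) * h1 t" "\<alpha> * h t + h2 t"
        "\<epsilon> * (\<alpha> * (\<alpha> - 1) * c t)" "\<epsilon> * ((\<alpha> - 1) * c1 t)" "\<epsilon> * (\<alpha> * c t + c2 t)"] pmle[OF t] by simp
  qed
  define Q where "Q = max (m powr p) (\<phi> x2 powr p)"
  have Q: "Q > 0" using m(1) by (simp add: Q_def less_max_iff_disj)
  have hp: "h t powr p \<le> Q" if t: "t \<in> {-\<theta>..\<theta>}" for t
  proof (cases "0 \<le> p")
    case True
    then have "h t powr p \<le> \<phi> x2 powr p" using hb[OF t] m(1) by (intro powr_mono2) auto
    then show ?thesis by (simp add: Q_def)
  next
    case False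
    then have "h t powr p \<le> m powr p" using hb[OF t] m(1) by (intro powr_mono2') auto
    then show ?thesis by (simp add: Q_def)
  qed
  (* solves \<open>k\<^sup>p Q = k \<epsilon>\<close> *)
  define k where "k = (\<epsilon> / Q) powr (1 / (p - 1))"
  have k: "k > 0" using \<epsilon>(1) Q by (simp add: k_def)
  have kp: "k powr p * Q = k * \<epsilon>"
  proof -
    have "k powr (p - 1) = \<epsilon> / Q" unfolding k_def using p \<epsilon>(1) Q by (simp add: powr_powr)
    moreover have "k powr p = k * k powr (p - 1)" using k by (simp add: powr_diff)
    ultimately show ?thesis using Q by simp
  qed
  define v where "v z = k * exp (\<alpha> * ln (norm z)) * h (ang z)" for z
  have vn: "v z = k * norm z powr \<alpha> * h (ang z)" if "z \<noteq> 0" for z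
    using that by (simp add: v_def powr_def)
  have cang: "y \<in> slit" "y \<noteq> 0" "ang y \<in> {-\<theta>..\<theta>}" if "y \<in> cone_C \<theta>" for y
    using that cone_ang[of \<theta> y] \<theta> cone_nz by (auto simp: abs_less_iff)
  have V: "cone_C \<theta> \<subseteq> slit" "\<And>y. y \<in> cone_C \<theta> \<Longrightarrow> ang y \<in> I" using cang I by blast+
  obtain G H where C: "C2_on (cone_C \<theta>) v G H" and H: "\<And>y. y \<in> cone_C \<theta> \<Longrightarrow>
      pucci_minus l L (H y) = k * norm y powr (\<alpha> - 2) *
       homog_pucci l L \<alpha> (h (ang y)) (h1 (ang y)) (h2 (ang y))"
    using power_times_profile[OF dh ch2 V k, of \<alpha> l L, folded v_def] by blast
  have vpos: "v z > 0" if "z \<in> cone_C \<theta>" for z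
    unfolding v_def using k hb(1)[OF cang(3)[OF that]] m(1) by simp
  have ineq: "pucci_minus l L (H y) + v y powr p \<le> 0" if y: "y \<in> cone_C \<theta>" for y
  proof -
    define t where "t = ang y"
    have t: "t \<in> {-\<theta>..\<theta>}" "t \<in> I" using cang(3)[OF y] I by (auto simp: t_def)
    have "pucci_minus l L (H y) \<le> k * norm y powr (\<alpha> - 2) * (- \<epsilon>)"
      unfolding H[OF y] using pmh[OF t(2)] k by (intro mult_left_mono) (auto simp: t_def)
    then have 1: "pucci_minus l L (H y) \<le> - ((k * \<epsilon>) * norm y powr (\<alpha> - 2))" by (simp add: mult_ac)
    have "v y powr p = (k powr p * norm y powr (\<alpha> * p)) * h t powr p"
      unfolding vn[OF cang(2)[OF y]] t_def[symmetric] using k hb(1)[OF t(1)] m(1)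
      by (simp add: powr_mult powr_powr)
    also have "\<dots> \<le> (k powr p * norm y powr (\<alpha> * p)) * Q" using hp[OF t(1)] by (intro mult_left_mono) auto
    also have "\<dots> = (k powr p * Q) * norm y powr (\<alpha> - 2)" unfolding \<alpha>p by simp
    finally show ?thesis using 1 unfolding kp by linarith
  qed
  have "viscosity_supersolution (pucci_minus l L) (\<lambda>s. s powr p) (cone_C \<theta>) v"
    by (rule classical_imp_viscosity[OF l C open_cone]) (rule ineq)
  then show ?thesis
    using vpos continuous_on_imp_lsc_on[OF C2_on_continuous[OF C]] by blast
qed

text \<open>In the range where \<open>g\<^sub>\<omega>\<close> is infinite the radial power \<open>r\<^sup>\<alpha>\<close> is already a supersolution in the whole
  punctured plane.\<close>

lemma pucci2_radial_nonpos:
  assumes l: "0 < l" "l \<le> L" and \<alpha>: "1 - L / l \<le> \<alpha>" "\<alpha> \<le> 1 - l / L"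
  shows "pucci2 l L (\<alpha> * (\<alpha> - 1)) 0 \<alpha> \<le> 0"
proof -
  have L: "L > 0" using l by simp
  have \<alpha>1: "l \<le> L * (1 - \<alpha>)" "l * (1 - \<alpha>) \<le> L" "\<alpha> < 1"
  proof -
    have "l / L \<le> 1 - \<alpha>" "1 - \<alpha> \<le> L / l" using \<alpha> by auto
    then show "l \<le> L * (1 - \<alpha>)" "l * (1 - \<alpha>) \<le> L" using l L by (simp_all add: pos_divide_le_eq pos_le_divide_eq mult.commute)
    have "0 < l / L" using l L by simp
    then show "\<alpha> < 1" using \<open>l / L \<le> 1 - \<alpha>\<close> by linarith
  qed
  define a where "a = \<alpha> * (\<alpha> - 1)"
  have "max \<bar>a + \<alpha>\<bar> (sqrt ((a - \<alpha>)\<^sup>2 + (2 * 0)\<^sup>2)) = \<bar>a\<bar> + \<bar>\<alpha>\<bar>" by (simp add: max_def abs_if)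
  then have e: "pucci2 l L a 0 \<alpha> = ((l + L) * (a + \<alpha>) - (L - l) * (\<bar>a\<bar> + \<bar>\<alpha>\<bar>)) / 2" unfolding pucci2_def by simp
  show ?thesis
  proof (cases "\<alpha> \<ge> 0")
    case True
    then have "a \<le> 0" using \<alpha>1(3) by (simp add: a_def mult_nonneg_nonpos)
    then have "pucci2 l L a 0 \<alpha> = L * a + l * \<alpha>" unfolding e using True by (simp add: field_simps)
    also have "\<dots> = \<alpha> * (l - L * (1 - \<alpha>))" by (simp add: a_def algebra_simps)
    also have "\<dots> \<le> 0" using True \<alpha>1(1) by (simp add: mult_nonneg_nonpos)
    finally show ?thesis by (simp add: a_def)
  next
    case False
    then have "a \<ge> 0" using \<alpha>1(3) by (simp add: a_def mult_nonpos_nonpos)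
    then have "pucci2 l L a 0 \<alpha> = l * a + L * \<alpha>" unfolding e using False by (simp add: field_simps)
    also have "\<dots> = \<alpha> * (L - l * (1 - \<alpha>))" by (simp add: a_def algebra_simps)
    also have "\<dots> \<le> 0" using False \<alpha>1(2) by (simp add: mult_nonpos_nonneg)
    finally show ?thesis by (simp add: a_def)
  qed
qed

text \<open>The three branches of \<open>g\<^sub>\<omega>\<close> are the half-openings of the explicit profile for \<open>(q, \<sigma>)\<close> equal to
  \<open>(\<omega>, 1)\<close>, \<open>(1 / \<omega>, 1)\<close> and \<open>(\<omega>, -1)\<close>.\<close>

lemma g_omega_profile:
  fixes \<alpha> :: real
  assumes l: "0 < l" "l \<le> L"
  defines "\<omega> \<equiv> L / l"
  assumes out: "\<not> (1 - \<omega> \<le> \<alpha> \<and> \<alpha> \<le> 1 - 1 / \<omega>)"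
  shows "\<exists>g g' \<phi> \<phi>1 \<phi>2. g_omega \<omega> \<alpha> = ereal g \<and> angular_profile l L \<alpha> g g' \<phi> \<phi>1 \<phi>2"
proof -
  have L: "L > 0" using l by simp
  have \<omega>: "\<omega> \<ge> 1" "1 / \<omega> = l / L" using l by (auto simp: \<omega>_def)
  have \<omega>': "0 < 1 / \<omega>" "1 / \<omega> \<le> 1" using \<omega>(1) by auto
  define A B where "A = \<alpha> - 1 + 1 / \<omega>" and "B = \<alpha> - 1 + \<omega>"
  have sq: "sqrt \<omega> * sqrt (A / B) = sqrt (\<omega> * A / B)" by (simp flip: real_sqrt_mult)
  consider "1 \<le> \<alpha>" | "1 - 1 / \<omega> < \<alpha>" "\<alpha> < 1" | "\<alpha> < 1 - \<omega>" using out by linarith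
  then show ?thesis
  proof cases
    case 1
    have "g_omega \<omega> \<alpha> = ereal (1 * arctan (sqrt \<omega>) + (2 - \<alpha>) / sqrt (A * B) * arctan (sqrt \<omega> * sqrt (A / B)))"
      using 1 unfolding g_omega_def Let_def sq A_def[symmetric] B_def[symmetric] by simp
    moreover have "\<exists>g' \<phi> \<phi>1 \<phi>2. angular_profile l L \<alpha> (1 * arctan (sqrt \<omega>) + (2 - \<alpha>) / sqrt (A * B) * arctan (sqrt \<omega> * sqrt (A / B))) g' \<phi> \<phi>1 \<phi>2"
      unfolding A_def B_def
      by (rule angular_profile_exists[OF l]) (use 1 \<omega> \<omega>' in \<open>auto simp: \<omega>_def\<close>)
    ultimately show ?thesis by blast
  next
    case 2
    have sq': "sqrt (1 / \<omega>) * sqrt (B / A) = sqrt (B / (\<omega> * A))" by (simp flip: real_sqrt_mult)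
    have "g_omega \<omega> \<alpha> = ereal (1 * arctan (sqrt (1 / \<omega>)) + (2 - \<alpha>) / sqrt (B * A) * arctan (sqrt (1 / \<omega>) * sqrt (B / A)))"
      using 2 unfolding g_omega_def Let_def sq' A_def[symmetric] B_def[symmetric] by (simp add: real_sqrt_divide mult.commute)
    moreover have "\<exists>g' \<phi> \<phi>1 \<phi>2. angular_profile l L \<alpha> (1 * arctan (sqrt (1 / \<omega>)) + (2 - \<alpha>) / sqrt (B * A) * arctan (sqrt (1 / \<omega>) * sqrt (B / A))) g' \<phi> \<phi>1 \<phi>2"
    proof -
      have e: "B = \<alpha> - 1 + 1 / (1 / \<omega>)" by (simp add: B_def)
      have "0 \<le> \<alpha>" using 2 \<omega>' by linarith
      then have "\<alpha> * (\<alpha> - 1) \<le> 0" using 2 by (simp add: mult_nonneg_nonpos)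
      then have q: "1 / \<omega> = L / l \<and> 0 \<le> \<alpha> * (\<alpha> - 1) \<or> 1 / \<omega> = l / L \<and> \<alpha> * (\<alpha> - 1) \<le> 0" using \<omega> by simp
      have "A > 0" using 2 unfolding A_def by linarith
      moreover have "B > 0" using 2 \<omega>(1) \<omega>' unfolding B_def by linarith
      ultimately have "1 * A > 0" "1 * B > 0" by simp_all
      then show ?thesis
        using angular_profile_exists[OF l _ q, of 1, folded e, folded A_def] by simp
    qed
    ultimately show ?thesis by blast
  next
    case 3
    have \<alpha>: "\<alpha> < 0" using 3 \<omega> by simp
    have n: "\<not> 1 \<le> \<alpha>" "\<not> 1 - 1 / \<omega> < \<alpha>" using 3 \<omega> \<omega>' by auto
    have "g_omega \<omega> \<alpha> = ereal (- 1 * arctan (sqrt \<omega>) + (2 - \<alpha>) / sqrt (A * B) * arctan (sqrt \<omega> * sqrt (A / B)))"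
      using 3 n unfolding g_omega_def Let_def sq A_def[symmetric] B_def[symmetric] by simp
    moreover have "\<exists>g' \<phi> \<phi>1 \<phi>2. angular_profile l L \<alpha> (- 1 * arctan (sqrt \<omega>) + (2 - \<alpha>) / sqrt (A * B) * arctan (sqrt \<omega> * sqrt (A / B))) g' \<phi> \<phi>1 \<phi>2"
      unfolding A_def B_def
    proof (rule angular_profile_exists[OF l])
      show "\<omega> = L / l \<and> 0 \<le> \<alpha> * (\<alpha> - 1) \<or> \<omega> = l / L \<and> \<alpha> * (\<alpha> - 1) \<le> 0"
        using \<alpha> by (simp add: \<omega>_def mult_nonpos_nonpos)
    qed (use 3 \<omega> \<omega>' in auto)
    ultimately show ?thesis by blast
  qed
qed


section \<open>The threshold\<close>

theorem theorem3p2: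
  fixes lam Lam \<omega> \<theta>\<^sub>0 p :: real
  assumes "0 < lam" and "lam \<le> Lam" and "\<omega> = Lam / lam"
    and "0 < \<theta>\<^sub>0" and "\<theta>\<^sub>0 < pi"
  shows "(\<not> (\<exists>u :: real^2 \<Rightarrow> real.
            (\<forall>z\<in>cone_C \<theta>\<^sub>0. u z > 0) \<and>
            lsc_on (cone_C \<theta>\<^sub>0) u \<and>
            viscosity_supersolution (pucci_minus lam Lam) (\<lambda>s. s powr p) (cone_C \<theta>\<^sub>0) u))
         \<longleftrightarrow> (p = 1 \<or> g_omega \<omega> (2 / (1 - p)) \<le> ereal \<theta>\<^sub>0)"
    (is "\<not> ?E \<longleftrightarrow> ?C")
proof -
  define \<alpha> where "\<alpha> = 2 / (1 - p)"
  have \<omega>: "1 \<le> \<omega>" "1 / \<omega> = lam / Lam" "1 / \<omega> \<le> 1" using assms by auto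
  have "\<not> ?E" if C: ?C
  proof
    assume ?E
    then obtain u where u: "\<And>z. z \<in> cone_C \<theta>\<^sub>0 \<Longrightarrow> u z > 0" "lsc_on (cone_C \<theta>\<^sub>0) u"
      "viscosity_supersolution (pucci_minus lam Lam) (\<lambda>s. s powr p) (cone_C \<theta>\<^sub>0) u" by blast
    interpret cone_supersolution lam Lam p \<theta>\<^sub>0 u
      by unfold_locales (use assms u in auto)
    have p: "p \<noteq> 1" by (rule p_ne_1)
    then have le: "g_omega \<omega> \<alpha> \<le> ereal \<theta>\<^sub>0" using C by (simp add: \<alpha>_def)
    have "\<not> (1 - \<omega> \<le> \<alpha> \<and> \<alpha> \<le> 1 - 1 / \<omega>)"
    proof
      assume a: "1 - \<omega> \<le> \<alpha> \<and> \<alpha> \<le> 1 - 1 / \<omega>"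
      have "0 < 1 / \<omega>" using \<omega>(1) by simp
      then have "\<not> \<alpha> \<ge> 1" "\<not> 1 - 1 / \<omega> < \<alpha>" "\<not> \<alpha> < 1 - \<omega>" using a by linarith+
      then have "g_omega \<omega> \<alpha> = \<infinity>" unfolding g_omega_def Let_def by simp
      then show False using le by simp
    qed
    then obtain g g' \<phi> \<phi>1 \<phi>2 where g: "g_omega \<omega> \<alpha> = ereal g" and prof: "angular_profile lam Lam \<alpha> g g' \<phi> \<phi>1 \<phi>2"
      using g_omega_profile[OF assms(1,2), of \<alpha>] assms(3) by blast
    have g0: "0 < g" "g \<le> \<theta>\<^sub>0" using le g angular_profileD(1)[OF prof] by auto
    have sub: "cone_C g \<subseteq> cone_C \<theta>\<^sub>0" using g0 assms by (intro cone_mono) auto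
    interpret g: cone_supersolution lam Lam p g u
      by unfold_locales (use assms g0 pos sub viscosity_restrict[OF visc sub] lsc_on_subset[OF lsc sub] in auto)
    show False
      using g.no_profile_inside_sublinear g.no_profile_inside_superlinear prof p unfolding \<alpha>_def
      by (metis linorder_neqE_linordered_idom)
  qed
  moreover have "?E" if nC: "\<not> ?C"
  proof -
    have p: "p \<noteq> 1" and gt: "\<not> g_omega \<omega> \<alpha> \<le> ereal \<theta>\<^sub>0" using nC by (auto simp: \<alpha>_def)
    show ?E
    proof (cases "1 - \<omega> \<le> \<alpha> \<and> \<alpha> \<le> 1 - 1 / \<omega>")
      case True
      show ?thesis
        by (rule supersolution_exists[OF assms(1,2,4,5) p, of UNIV "\<lambda>_. 1" "\<lambda>_. 0" "\<lambda>_. 0"])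
           (use pucci2_radial_nonpos[OF assms(1,2), of \<alpha>] True \<omega>(2) assms(3) in \<open>auto simp: \<alpha>_def\<close>)
    next
      case False
      then obtain g g' \<phi> \<phi>1 \<phi>2 where g: "g_omega \<omega> \<alpha> = ereal g" and prof: "angular_profile lam Lam \<alpha> g g' \<phi> \<phi>1 \<phi>2"
        using g_omega_profile[OF assms(1,2), of \<alpha>] assms(3) by blast
      note P = angular_profileD[OF prof]
      have "\<theta>\<^sub>0 < g" using gt g by simp
      then have I: "{-\<theta>\<^sub>0..\<theta>\<^sub>0} \<subseteq> {-g'<..<g'}" "{-\<theta>\<^sub>0..\<theta>\<^sub>0} \<subseteq> {-g<..<g}" using P(2) by auto
      show ?thesis
        by (rule supersolution_exists[OF assms(1,2,4,5) p I(1) P(3,4,6)])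
           (use P(5,7) I(2) in \<open>auto simp: \<alpha>_def\<close>)
    qed
  qed
  ultimately show ?thesis by blast
qed

end
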